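(* There is an absolute constant $c>0$ such that for all positive integers $n,k$ with $k \le 2^n/3$, $$\alpha\bigl(P^{\mathsf{rev}}_{k,n}\bigr) \;\ge\; \frac{c}{n^3 k}.$$
   Context: For a finite set $S$, $\Theta_{k,S}$ denotes the set of $k$-tuples $(x_1,\dots,x_k)\in S^k$ with pairwise distinct entries; $\Theta_{k,N}:=\Theta_{k,[N]}$. Width-2 simple permutations: $\Sigma$ is the set of permutations $f_{i,j_1,j_2,h}$ of $\{0,1\}^n$ indexed by $i,j_1,j_2\in[n]$ with $i\ne j_1$, $i\ne j_2$, and $h:\{0,1\}^2\to\{0,1\}$; $f_{i,j_1,j_2,h}$ maps $(x_1,\dots,x_n)$ to $(x_1,\dots,x_{i-1},x_i\oplus h(x_{j_1},x_{j_2}),x_{i+1},\dots,x_n)$. Reversible circuit Markov chain $P^{\mathsf{rev}}_{k,n}$: the Markov chain on state space $\Theta_{k,\{0,1\}^n}$ in which, from state $(x_1,\dots,x_k)$, one draws a uniformly random $\boldsymbol\sigma\in\Sigma$ and moves to $(\boldsymbol\sigma x_1,\dots,\boldsymbol\sigma x_k)$. Log-Sobolev constant: for an ergodic Markov chain with transition matrix $P$ on finite state space $V$ with stationary distribution $\pi$, the Dirichlet form of $g:V\to\mathbb R$ is $\mathcal E_P(g,g)=\frac12\sum_{x,y\in V}(g(x)-g(y))^2\pi(x)P(x,y)$; for $f:V\to\mathbb R_{\ge 0}$, $\mathrm{Ent}_\pi[f]=\sum_{x\in V}\pi(x)f(x)\log\frac{f(x)}{\mathbb E_\pi[f]}$ (natural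 log, $0\log 0=0$), with $\mathbb E_\pi[f]=\sum_x\pi(x)f(x)$; and $\alpha(P)=\inf\{\mathcal E_P(\sqrt f,\sqrt f)/\mathrm{Ent}_\pi[f] : f\ge 0,\ f \text{ non-constant}\}$. *)

theory Defs
  imports Complex_Main
begin

text \<open>Bit strings of length n: boolean lists of length n; coordinates are indexed
  0-based by 0..<n (a relabelling of [n]).\<close>
definition bits :: "nat \<Rightarrow> bool list set" where
  "bits n = {x. length x = n}"

definition Theta :: "nat \<Rightarrow> 'a set \<Rightarrow> 'a list set" where
  "Theta k S = {xs. length xs = k \<and> distinct xs \<and> set xs \<subseteq> S}"

text \<open>The width-2 simple permutation f_{i,j1,j2,h}, as a map on bits n
  (restricted to bits n, so that equality of permutations is equality on bits n).\<close>
definition simple_perm :: "nat \<Rightarrow> nat \<Rightarrow> nat \<Rightarrow> nat \<Rightarrow> (bool \<Rightarrow> bool \<Rightarrow> bool)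
    \<Rightarrow> bool list \<Rightarrow> bool list" where
  "simple_perm n i j1 j2 h =
     (\<lambda>x. if x \<in> bits n then x[i := (x ! i \<noteq> h (x ! j1) (x ! j2))] else undefined)"

definition Sigma_rev :: "nat \<Rightarrow> (bool list \<Rightarrow> bool list) set" where
  "Sigma_rev n = {simple_perm n i j1 j2 h | i j1 j2 h.
       i < n \<and> j1 < n \<and> j2 < n \<and> i \<noteq> j1 \<and> i \<noteq> j2}"

definition rev_states :: "nat \<Rightarrow> nat \<Rightarrow> bool list list set" where
  "rev_states k n = Theta k (bits n)"

definition P_rev :: "nat \<Rightarrow> nat \<Rightarrow> bool list list \<Rightarrow> bool list list \<Rightarrow> real" where
  "P_rev k n xs ys =
     real (card {\<sigma> \<in> Sigma_rev n. map \<sigma> xs = ys}) / real (card (Sigma_rev n))"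

definition is_stationary :: "'a set \<Rightarrow> ('a \<Rightarrow> 'a \<Rightarrow> real) \<Rightarrow> ('a \<Rightarrow> real) \<Rightarrow> bool" where
  "is_stationary V P \<pi> \<longleftrightarrow> (\<forall>x\<in>V. \<pi> x \<ge> 0) \<and> (\<Sum>x\<in>V. \<pi> x) = 1 \<and>
       (\<forall>y\<in>V. (\<Sum>x\<in>V. \<pi> x * P x y) = \<pi> y)"

definition stat_dist :: "'a set \<Rightarrow> ('a \<Rightarrow> 'a \<Rightarrow> real) \<Rightarrow> 'a \<Rightarrow> real" where
  "stat_dist V P = (THE \<pi>. is_stationary V P \<pi> \<and> (\<forall>x. x \<notin> V \<longrightarrow> \<pi> x = 0))"

definition dirichlet :: "'a set \<Rightarrow> ('a \<Rightarrow> 'a \<Rightarrow> real) \<Rightarrow> ('a \<Rightarrow> real) \<Rightarrow> ('a \<Rightarrow> real) \<Rightarrow> real" where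
  "dirichlet V P \<pi> g = (1/2) * (\<Sum>x\<in>V. \<Sum>y\<in>V. (g x - g y)^2 * \<pi> x * P x y)"

definition expec :: "'a set \<Rightarrow> ('a \<Rightarrow> real) \<Rightarrow> ('a \<Rightarrow> real) \<Rightarrow> real" where
  "expec V \<pi> f = (\<Sum>x\<in>V. \<pi> x * f x)"

text \<open>Entropy; the convention 0 log 0 = 0 holds since the summand is multiplied by f x.\<close>
definition entropy :: "'a set \<Rightarrow> ('a \<Rightarrow> real) \<Rightarrow> ('a \<Rightarrow> real) \<Rightarrow> real" where
  "entropy V \<pi> f = (\<Sum>x\<in>V. \<pi> x * f x * ln (f x / expec V \<pi> f))"

definition log_sobolev :: "'a set \<Rightarrow> ('a \<Rightarrow> 'a \<Rightarrow> real) \<Rightarrow> real" where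
  "log_sobolev V P =
     (let \<pi> = stat_dist V P in
      Inf {dirichlet V P \<pi> (\<lambda>x. sqrt (f x)) / entropy V \<pi> f | f.
             (\<forall>x\<in>V. f x \<ge> 0) \<and> (\<exists>x\<in>V. \<exists>y\<in>V. f x \<noteq> f y)})"

end

theory Submission
  imports Defs "HOL-Analysis.L2_Norm" "HOL-Combinatorics.Permutations" "HOL-Library.Cardinality"
begin

text \<open>Put $N = 2^n$ and let $T(\sigma)$ be the sum of $(g(x) - g(\sigma x))^2$ over all states, where
  $g = \sqrt f$. The entropy is compared with the generators through transpositions of points of
  the cube.

  First, the chain rule for entropy, one entry at a time, together with the log-Sobolev inequality
  with constant of order $1/\ln N$ for a uniform point gives
  $\mathrm{Ent}(f) = O(\frac{n}{N}) \sum_{i,z} T((i\,z))$ in unnormalised form.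

  Second, at a given state a transposition $(i\,z)$ can be replaced by any permutation that agrees
  with it on the $k$ occupied points. Fix a wire $\tau$, a set $J$ of $m$ wires with $2^m$ of order
  $k$, and the remaining wires $K$. After random linear shears, flipping $\tau$ on one pattern of $J$
  moves the points of a random affine subspace of codimension $m$ along a random direction; since
  $y \mapsto y_J + B y_K$ is a universal hash function, this subspace isolates a given pair with
  probability of order $1/k$, also in the worst case $k = N/3$.

  Third, shears over disjoint wire sets form an elementary abelian 2-group, so the Poincare inequality
  on a cube bounds their mean energy by the sum of the CNOT energies; and a pattern gate is a product
  of $O(m)$ gates on three wires. After averaging over all relabellings of the wires, both cost
  $O(n^2)$ times the Dirichlet form, against a total of $n^3$ for the sum over all gates.\<close>

section \<open>Entropy on injective tuples\<close>

text \<open>The factor \<open>n^3 * k\<close> comes from the following budget. A Toffoli gate on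
  random wires is one of order \<open>n^3\<close> generators, so its mean energy is of order
  \<open>Tot / n^3\<close>, with \<open>Tot\<close> the total energy of the generators.
  Displacements obey the triangle inequality in L2, so a word of \<open>O(n)\<close> gates costs
  \<open>n^2\<close> times as much, that is \<open>Tot / n\<close>. The number \<open>2^m\<close> of
  patterns contributes k, the saved factor n pays for \<open>ln N\<close>, and \<open>n^3\<close>
  enters when \<open>Tot\<close> is divided by the number of generators. A fixed labelling of the
  wires would not do: a single generator may carry all the energy.

  The dense range is the obstacle. Target and hash each take a wire outside J, so \<open>2^m\<close>
  is at most N / 4 while k may be close to N / 3, and a union bound over k - 1 differences with
  collision probability \<open>1 / 2^m\<close> may exceed one. The shear C, with targets in K,
  halves the probability for all differences but one and brings the total down to 2/3.

  Irreducibility needs no separate argument: the entropy inequality is proved for the uniform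
  distribution, and uniqueness of the stationary distribution follows from it.\<close>

lemma finite_Theta: "finite S \<Longrightarrow> finite (Theta k S)"
  unfolding Theta_def by (rule finite_subset[OF _ finite_lists_length_eq[of S k]]) auto

lemma map_in_Theta:
  assumes "bij_betw f S S'" "xs \<in> Theta k S"
  shows "map f xs \<in> Theta k S'"
  using assms unfolding Theta_def bij_betw_def
  by (auto simp: distinct_map intro: inj_on_subset)

lemma bij_betw_map_Theta:
  assumes "bij_betw f S S'"
  shows "bij_betw (map f) (Theta k S) (Theta k S')"
proof (rule bij_betw_byWitness[where f' = "map (the_inv_into S f)"])
  have inv: "bij_betw (the_inv_into S f) S' S"
    using assms by (rule bij_betw_the_inv_into)
  show "\<forall>xs\<in>Theta k S. map (the_inv_into S f) (map f xs) = xs"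
    using assms by (auto simp: Theta_def bij_betw_def the_inv_into_f_f intro!: map_idI)
  show "\<forall>xs\<in>Theta k S'. map f (map (the_inv_into S f) xs) = xs"
    using assms by (auto simp: Theta_def bij_betw_def f_the_inv_into_f intro!: map_idI)
  show "map f ` Theta k S \<subseteq> Theta k S'" using map_in_Theta[OF assms] by blast
  show "map (the_inv_into S f) ` Theta k S' \<subseteq> Theta k S" using map_in_Theta[OF inv] by blast
qed

lemma Theta_0: "Theta 0 S = {[]}"
  by (auto simp: Theta_def)

lemma Theta_Suc: "Theta (Suc k) S = (\<Union>x\<in>S. (#) x ` Theta k (S - {x}))"
proof (intro set_eqI iffI)
  fix xs assume "xs \<in> Theta (Suc k) S"
  moreover from this obtain x ys where "xs = x # ys" by (auto simp: Theta_def length_Suc_conv)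
  ultimately show "xs \<in> (\<Union>x\<in>S. (#) x ` Theta k (S - {x}))" by (auto simp: Theta_def)
qed (auto simp: Theta_def)

lemma sum_Theta_Suc:
  assumes "finite S"
  shows "(\<Sum>xs\<in>Theta (Suc k) S. F xs) = (\<Sum>x\<in>S. \<Sum>ys\<in>Theta k (S - {x}). F (x # ys))"
proof -
  have "(\<Sum>xs\<in>Theta (Suc k) S. F xs) = (\<Sum>x\<in>S. sum F ((#) x ` Theta k (S - {x})))"
    unfolding Theta_Suc
    by (rule sum.UNION_disjoint) (use assms in \<open>auto intro!: finite_Theta\<close>)
  also have "\<dots> = (\<Sum>x\<in>S. \<Sum>ys\<in>Theta k (S - {x}). F (x # ys))"
    by (rule sum.cong[OF refl]) (simp add: sum.reindex inj_on_def)
  finally show ?thesis .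
qed

lemma card_Theta_pos:
  assumes "finite S" "k \<le> card S"
  shows "card (Theta k S) > 0"
proof -
  obtain T where T: "T \<subseteq> S" "card T = k" "finite T"
    using obtain_subset_with_card_n[OF assms(2)] by blast
  obtain xs where "set xs = T" "distinct xs" using finite_distinct_list[OF T(3)] by blast
  then have "xs \<in> Theta k S" using T by (auto simp: Theta_def distinct_card)
  then show ?thesis using finite_Theta[OF assms(1)] by (auto simp: card_gt_0_iff)
qed

lemma bij_betw_transpose_Diff:
  assumes "x \<in> S" "z \<in> S"
  shows "bij_betw (transpose x z) (S - {x}) (S - {z})"
  by (rule bij_betw_byWitness[where f' = "transpose x z"])
    (use assms in \<open>auto simp: transpose_def split: if_splits\<close>)

section \<open>Log-Sobolev inequality for a uniform point and the chain rule\<close>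

definition ent_sum :: "'a set \<Rightarrow> ('a \<Rightarrow> real) \<Rightarrow> real" where
  "ent_sum V f = (\<Sum>x\<in>V. f x * ln (f x / (sum f V / real (card V))))"

text \<open>With \<open>f = t\<^sup>2\<close> the left side is \<open>f ln f - f + 1\<close>, which
  has a double zero at 1, so a quadratic bound exists; for large t its coefficient has to grow like
  \<open>ln t\<close>. Above 1/2, \<open>2 * t\<^sup>2 = 2 * (t - 1)\<^sup>2 + (4 * t - 2)\<close>
  and \<open>ln t \<le> t - 1\<close> give the constant 3; below 1/2 the logarithmic term is
  nonpositive and a polynomial bound suffices.\<close>

lemma two_point_bound:
  fixes t L :: real
  assumes t: "0 \<le> t" and L: "0 \<le> L" "t > 0 \<Longrightarrow> ln t \<le> L"
  shows "2 * (t\<^sup>2 * ln t) - t\<^sup>2 + 1 \<le> (3 + 2 * L) * (t - 1)\<^sup>2"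
proof (cases "t \<ge> 1/2")
  case True
  have ln: "ln t \<le> t - 1" using True ln_le_minus_one by simp
  have "2 * (t\<^sup>2 * ln t) = 2 * (t - 1)\<^sup>2 * ln t + (4 * t - 2) * ln t"
    by (simp add: power2_eq_square algebra_simps)
  also have "\<dots> \<le> 2 * (t - 1)\<^sup>2 * L + (4 * t - 2) * (t - 1)"
    using True ln L(2) by (intro add_mono mult_left_mono) auto
  finally show ?thesis by (simp add: power2_eq_square algebra_simps)
next
  case False
  have "t\<^sup>2 * ln t \<le> 0"
  proof (cases "t = 0")
    case False
    then have "ln t \<le> 0" using t \<open>\<not> t \<ge> 1/2\<close> by simp
    then show ?thesis by (simp add: mult_nonneg_nonpos)
  qed simp
  moreover have "1 - t\<^sup>2 \<le> 3 * (t - 1)\<^sup>2"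
  proof -
    have "0 \<le> (1 - t) * (2 - 4 * t)" using False by (intro mult_nonneg_nonneg) auto
    then show ?thesis by (simp add: power2_eq_square algebra_simps)
  qed
  moreover have "3 * (t - 1)\<^sup>2 \<le> (3 + 2 * L) * (t - 1)\<^sup>2"
    using L by (intro mult_right_mono) auto
  ultimately show ?thesis by linarith
qed

text \<open>The entropy is at most the Bregman-type sum
  $\sum_x (f \ln (f/c) - f + c)$ for every $c > 0$; here $c$ is the squared mean of $\sqrt f$.\<close>
lemma ent_sum_le_pairs:
  assumes S: "finite S" "S \<noteq> {}" and F: "\<And>x. x \<in> S \<Longrightarrow> F x \<ge> 0"
  shows "ent_sum S F \<le> (3 + 2 * ln (real (card S))) / (2 * real (card S)) *
           (\<Sum>x\<in>S. \<Sum>z\<in>S. (sqrt (F x) - sqrt (F z))\<^sup>2)"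
proof (cases "\<forall>x\<in>S. F x = 0")
  case True
  then show ?thesis by (simp add: ent_sum_def)
next
  case False
  define N where "N = real (card S)"
  define h where "h = (\<lambda>x. sqrt (F x))"
  define a where "a = sum h S / N"
  define m where "m = sum F S / N"
  have N: "N \<ge> 1" using S by (simp add: N_def Suc_le_eq card_gt_0_iff)
  have h0: "h x \<ge> 0" if "x \<in> S" for x using F that by (simp add: h_def)
  have Fh: "F x = (h x)\<^sup>2" if "x \<in> S" for x using F that by (simp add: h_def)
  obtain x0 where x0: "x0 \<in> S" "F x0 > 0" using False F by force
  have "sum h S > 0"
    by (rule sum_pos2[OF S(1) x0(1)]) (use h0 x0 in \<open>auto simp: h_def\<close>)
  then have a: "a > 0" using N by (simp add: a_def)
  have "sum F S > 0"
    by (rule sum_pos2[OF S(1) x0(1)]) (use F x0 in auto)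
  then have m: "m > 0" using N by (simp add: m_def)
  have sa: "sum h S = N * a" and sm: "sum F S = N * m" using N by (simp_all add: a_def m_def)
  have "ln (a\<^sup>2 / m) \<le> a\<^sup>2 / m - 1" using a m by (intro ln_le_minus_one) auto
  then have lnam: "m * (ln (a\<^sup>2) - ln m) \<le> a\<^sup>2 - m"
    using m a by (simp add: ln_div field_simps)
  \<comment> \<open>The left side is \<open>F x * ln (F x / a\<^sup>2) - F x + a\<^sup>2\<close>,
    written with the true mean \<open>m\<close> so that it can be summed against
    \<open>lnam\<close>.\<close>
  have point: "F x * ln (F x / m) - F x * (ln (a\<^sup>2) - ln m) - F x + a\<^sup>2
        \<le> (3 + 2 * ln N) * (h x - a)\<^sup>2" if x: "x \<in> S" for x
  proof -
    define t where "t = h x / a"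
    have t: "t \<ge> 0" "h x = t * a" using h0[OF x] a by (simp_all add: t_def)
    \<comment> \<open>No value exceeds the sum \<open>N * a\<close>, so \<open>t \<le> N\<close>.
      This is where \<open>ln N\<close> comes from.\<close>
    have "h x \<le> sum h S" using member_le_sum[of x S h] S x h0 by auto
    then have "t \<le> N" using a by (simp add: t_def sa field_simps)
    then have "2 * (t\<^sup>2 * ln t) - t\<^sup>2 + 1 \<le> (3 + 2 * ln N) * (t - 1)\<^sup>2"
      using t N by (intro two_point_bound) auto
    then have "a\<^sup>2 * (2 * (t\<^sup>2 * ln t) - t\<^sup>2 + 1) \<le> a\<^sup>2 * ((3 + 2 * ln N) * (t - 1)\<^sup>2)"
      by (intro mult_left_mono) auto
    moreover have "a\<^sup>2 * ((3 + 2 * ln N) * (t - 1)\<^sup>2) = (3 + 2 * ln N) * (h x - a)\<^sup>2"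
      by (simp add: t(2) power2_eq_square algebra_simps)
    moreover have "F x * ln (F x / m) - F x * (ln (a\<^sup>2) - ln m) - F x + a\<^sup>2
        = a\<^sup>2 * (2 * (t\<^sup>2 * ln t) - t\<^sup>2 + 1)"
    proof (cases "t = 0")
      case True
      then show ?thesis using Fh[OF x] t by simp
    next
      case False
      then have "t > 0" using t by simp
      then have "ln (F x / m) - (ln (a\<^sup>2) - ln m) = 2 * ln t"
        using a m Fh[OF x] t(2) by (simp add: ln_div ln_mult ln_realpow)
      then have "F x * ln (F x / m) - F x * (ln (a\<^sup>2) - ln m) = F x * (2 * ln t)"
        by (metis right_diff_distrib)
      then show ?thesis using Fh[OF x] t(2) by (simp add: power2_eq_square algebra_simps)
    qed
    ultimately show ?thesis by linarith
  qed
  have "ent_sum S F = (\<Sum>x\<in>S. F x * ln (F x / m))"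
    by (simp add: ent_sum_def m_def N_def)
  also have "\<dots> \<le> (\<Sum>x\<in>S. F x * ln (F x / m)) - N * (m * (ln (a\<^sup>2) - ln m) - (a\<^sup>2 - m))"
    using lnam N by (simp add: mult_nonneg_nonpos)
  also have "\<dots> = (\<Sum>x\<in>S. F x * ln (F x / m) - F x * (ln (a\<^sup>2) - ln m) - F x + a\<^sup>2)"
    by (simp add: sum.distrib sum_subtractf sm flip: sum_distrib_right)
       (simp add: N_def algebra_simps)
  also have "\<dots> \<le> (\<Sum>x\<in>S. (3 + 2 * ln N) * (h x - a)\<^sup>2)"
    by (intro sum_mono point)
  also have "\<dots> = (3 + 2 * ln N) * (\<Sum>x\<in>S. (h x - a)\<^sup>2)" by (simp add: sum_distrib_left)
  also have "(\<Sum>x\<in>S. (h x - a)\<^sup>2) = (\<Sum>x\<in>S. (h x)\<^sup>2) - N * a\<^sup>2"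
  proof -
    have "(\<Sum>x\<in>S. (h x - a)\<^sup>2) = (\<Sum>x\<in>S. (h x)\<^sup>2 - 2 * a * h x + a\<^sup>2)"
      by (intro sum.cong refl) (simp add: power2_eq_square algebra_simps)
    also have "\<dots> = (\<Sum>x\<in>S. (h x)\<^sup>2) - 2 * a * sum h S + N * a\<^sup>2"
      by (simp add: sum.distrib sum_subtractf sum_distrib_left N_def)
    finally show ?thesis by (simp add: sa power2_eq_square)
  qed
  also have "(\<Sum>x\<in>S. (h x)\<^sup>2) - N * a\<^sup>2 = (\<Sum>x\<in>S. \<Sum>z\<in>S. (h x - h z)\<^sup>2) / (2 * N)"
  proof -
    have "(\<Sum>x\<in>S. \<Sum>z\<in>S. (h x - h z)\<^sup>2) = (\<Sum>x\<in>S. \<Sum>z\<in>S. (h x)\<^sup>2 + (h z)\<^sup>2 - 2 * (h x * h z))"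
      by (intro sum.cong refl) (simp add: power2_eq_square algebra_simps)
    also have "\<dots> = N * (\<Sum>x\<in>S. (h x)\<^sup>2) + N * (\<Sum>x\<in>S. (h x)\<^sup>2) - 2 * (sum h S * sum h S)"
      by (simp add: sum.distrib sum_subtractf N_def sum_product flip: sum_distrib_left)
    finally show ?thesis using N by (simp add: sa power2_eq_square field_simps)
  qed
  finally show ?thesis by (simp add: N_def h_def)
qed

definition energy :: "'a list set \<Rightarrow> ('a list \<Rightarrow> real) \<Rightarrow> ('a \<Rightarrow> 'a) \<Rightarrow> real" where
  "energy V g \<sigma> = (\<Sum>xs\<in>V. (g xs - g (map \<sigma> xs))\<^sup>2)"

lemma energy_nonneg: "energy V g \<sigma> \<ge> 0"
  by (simp add: energy_def sum_nonneg)

text \<open>The reverse triangle inequality. It serves to compare square roots of marginals, which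
  are L2 norms of \<open>sqrt f\<close> over fibres.\<close>

lemma L2_set_diff_ge: "(L2_set u A - L2_set v A)\<^sup>2 \<le> (\<Sum>x\<in>A. (u x - v x)\<^sup>2)"
proof -
  have "L2_set u A \<le> L2_set (\<lambda>x. u x - v x) A + L2_set v A"
    using L2_set_triangle_ineq[of "\<lambda>x. u x - v x" v A] by simp
  moreover have "L2_set v A \<le> L2_set (\<lambda>x. u x - v x) A + L2_set u A"
    using L2_set_triangle_ineq[of "\<lambda>x. v x - u x" u A]
    by (simp add: L2_set_def power2_commute)
  ultimately have "\<bar>L2_set u A - L2_set v A\<bar> \<le> L2_set (\<lambda>x. u x - v x) A" by linarith
  then have "\<bar>L2_set u A - L2_set v A\<bar>\<^sup>2 \<le> (L2_set (\<lambda>x. u x - v x) A)\<^sup>2"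
    by (intro power_mono) auto
  then show ?thesis by (simp add: L2_set_def sum_nonneg)
qed

text \<open>Chain rule: when the entries are revealed one at a time, at least \<open>M\<close> sites remain for
  each of them, and the swap of its site with another one changes nothing revealed before.\<close>
lemma ent_sum_Theta_le:
  fixes f :: "'a list \<Rightarrow> real"
  assumes "finite S" "k \<le> card S" "card S \<le> N0" "real M \<le> real (card S) - real k + 1" "M > 0"
    and "\<And>xs. xs \<in> Theta k S \<Longrightarrow> f xs \<ge> 0"
  shows "ent_sum (Theta k S) f \<le> (3 + 2 * ln (real N0)) / (2 * real M) *
     (\<Sum>xs\<in>Theta k S. \<Sum>i\<in>set xs. \<Sum>z\<in>S.
        (sqrt (f xs) - sqrt (f (map (transpose i z) xs)))\<^sup>2)"
  using assms
proof (induction k arbitrary: S f)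
  case 0
  then show ?case by (simp add: Theta_0 ent_sum_def)
next
  case (Suc k)
  define c where "c = (3 + 2 * ln (real N0)) / (2 * real M)"
  define Y where "Y = (\<lambda>x. Theta k (S - {x}))"
  define D where "D = (\<lambda>xs. \<lambda>i. \<lambda>z. (sqrt (f xs) - sqrt (f (map (transpose i z) xs)))\<^sup>2)"
  define F where "F = (\<lambda>x. \<Sum>ys\<in>Y x. f (x # ys))"
  define n where "n = real (card S)"
  have fin: "finite S" by fact
  have S0: "S \<noteq> {}" and n: "n > 0" using Suc.prems(1,2) by (auto simp: n_def card_gt_0_iff)
  have N0: "N0 \<ge> 1" using Suc.prems(2,3) by linarith
  have ln0: "ln (real N0) \<ge> 0" using N0 by simp
  have c0: "c \<ge> 0" using ln0 by (simp add: c_def)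
  have f0: "f (x # ys) \<ge> 0" if "x \<in> S" "ys \<in> Y x" for x ys
    using Suc.prems(6) that by (auto simp: Theta_Suc Y_def)
  have F0: "F x \<ge> 0" if "x \<in> S" for x unfolding F_def using that by (intro sum_nonneg f0)
  have finY: "finite (Y x)" for x using fin by (simp add: Y_def finite_Theta)
  obtain y0 where y0: "y0 \<in> S" using S0 by blast
  define q where "q = real (card (Y y0))"
  have cardY: "real (card (Y x)) = q" if "x \<in> S" for x
    unfolding q_def Y_def using bij_betw_map_Theta[OF bij_betw_transpose_Diff[OF that y0]]
    by (metis bij_betw_same_card)
  have q: "q > 0" unfolding q_def Y_def using card_Theta_pos[of "S - {y0}" k] fin y0 Suc.prems(2) by simp
  have cardV: "real (card (Theta (Suc k) S)) = n * q"
  proof -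
    have "real (card (Theta (Suc k) S)) = (\<Sum>xs\<in>Theta (Suc k) S. 1)" by simp
    also have "\<dots> = (\<Sum>x\<in>S. real (card (Y x)))" by (subst sum_Theta_Suc[OF fin]) (simp add: Y_def)
    finally show ?thesis by (simp add: cardY n_def)
  qed
  have sumV: "sum f (Theta (Suc k) S) = sum F S"
    by (simp add: sum_Theta_Suc[OF fin] F_def Y_def)
  define m where "m = sum F S / (n * q)"
  have chain_pt: "f (x # ys) * ln (f (x # ys) / m) =
      f (x # ys) * ln (f (x # ys) / (F x / q)) + f (x # ys) * ln (F x / (sum F S / n))"
    if "x \<in> S" "ys \<in> Y x" for x ys
  proof (cases "f (x # ys) = 0")
    case False
    then have p: "f (x # ys) > 0" using f0[OF that] by simp
    have "F x > 0" unfolding F_def by (rule sum_pos2[where i = ys]) (use finY p f0 that in auto)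
    moreover have "sum F S > 0" by (rule sum_pos2[where i = x]) (use fin that \<open>F x > 0\<close> F0 in auto)
    ultimately show ?thesis using p n q by (simp add: m_def ln_div ln_mult algebra_simps)
  qed simp
  have "ent_sum (Theta (Suc k) S) f = (\<Sum>x\<in>S. \<Sum>ys\<in>Y x. f (x # ys) * ln (f (x # ys) / m))"
    unfolding ent_sum_def sumV cardV m_def by (simp add: sum_Theta_Suc[OF fin] Y_def)
  also have "\<dots> = (\<Sum>x\<in>S. (\<Sum>ys\<in>Y x. f (x # ys) * ln (f (x # ys) / (F x / q)))
        + F x * ln (F x / (sum F S / n)))"
    by (intro sum.cong refl) (simp add: chain_pt sum.distrib F_def flip: sum_distrib_right)
  also have "\<dots> = (\<Sum>x\<in>S. ent_sum (Y x) (\<lambda>ys. f (x # ys))) + ent_sum S F"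
    by (simp add: sum.distrib ent_sum_def n_def) (intro sum.cong refl, simp add: cardY F_def)
  finally have chain: "ent_sum (Theta (Suc k) S) f =
      (\<Sum>x\<in>S. ent_sum (Y x) (\<lambda>ys. f (x # ys))) + ent_sum S F" .
  have A: "ent_sum (Y x) (\<lambda>ys. f (x # ys)) \<le>
      c * (\<Sum>ys\<in>Y x. \<Sum>i\<in>set ys. \<Sum>z\<in>S. D (x # ys) i z)" if x: "x \<in> S" for x
  proof -
    \<comment> \<open>Passing to \<open>S - {x}\<close> lowers the number of sites and the tuple
      length by one each, so the lower bound M for their difference plus one persists.\<close>
    have "ent_sum (Y x) (\<lambda>ys. f (x # ys)) \<le> c * (\<Sum>ys\<in>Y x. \<Sum>i\<in>set ys. \<Sum>z\<in>S - {x}.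
        (sqrt (f (x # ys)) - sqrt (f (x # map (transpose i z) ys)))\<^sup>2)"
      unfolding c_def Y_def
      by (rule Suc.IH) (use Suc.prems x f0 in \<open>auto simp: Y_def Suc_diff_le card_Diff_singleton\<close>)
    also have "\<dots> = c * (\<Sum>ys\<in>Y x. \<Sum>i\<in>set ys. \<Sum>z\<in>S - {x}. D (x # ys) i z)"
    proof -
      have "transpose i z x = x" if "ys \<in> Y x" "i \<in> set ys" "z \<in> S - {x}" for ys i z
        using that by (intro transpose_apply_other) (auto simp: Y_def Theta_def)
      then show ?thesis by (simp add: D_def)
    qed
    also have "\<dots> \<le> c * (\<Sum>ys\<in>Y x. \<Sum>i\<in>set ys. \<Sum>z\<in>S. D (x # ys) i z)"
      by (intro mult_left_mono sum_mono sum_mono2 c0 fin) (auto simp: D_def)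
    finally show ?thesis .
  qed
  \<comment> \<open>Applied to the whole tuple, the transposition matches the fibre over x with the
    fibre over z, also when z already occurs in \<open>ys\<close>; then the two L2 norms are
    compared termwise.\<close>
  have B1: "(sqrt (F x) - sqrt (F z))\<^sup>2 \<le> (\<Sum>ys\<in>Y x. D (x # ys) x z)" if x: "x \<in> S" "z \<in> S" for x z
  proof -
    have 1: "sqrt (F x) = L2_set (\<lambda>ys. sqrt (f (x # ys))) (Y x)"
      by (simp add: F_def L2_set_def f0 x)
    have "F z = (\<Sum>ys\<in>Y x. f (z # map (transpose x z) ys))"
      unfolding F_def Y_def
      by (rule sum.reindex_bij_betw[OF bij_betw_map_Theta[OF bij_betw_transpose_Diff[OF x]], symmetric])
    moreover have "map (transpose x z) ys \<in> Y z" if "ys \<in> Y x" for ys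
      using map_in_Theta[OF bij_betw_transpose_Diff[OF x]] that by (simp add: Y_def)
    ultimately have 2: "sqrt (F z) = L2_set (\<lambda>ys. sqrt (f (map (transpose x z) (x # ys)))) (Y x)"
      by (simp add: L2_set_def f0 x)
    show ?thesis unfolding 1 2 D_def by (rule L2_set_diff_ge)
  qed
  have "ent_sum S F \<le> (3 + 2 * ln n) / (2 * n) * (\<Sum>x\<in>S. \<Sum>z\<in>S. (sqrt (F x) - sqrt (F z))\<^sup>2)"
    unfolding n_def by (rule ent_sum_le_pairs[OF fin S0 F0])
  also have "\<dots> \<le> c * (\<Sum>x\<in>S. \<Sum>z\<in>S. (sqrt (F x) - sqrt (F z))\<^sup>2)"
  proof (rule mult_right_mono)
    have "ln n \<le> ln (real N0)" using n Suc.prems(3) by (simp add: n_def)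
    moreover have "real M \<le> n" using Suc.prems(4) by (simp add: n_def)
    ultimately show "(3 + 2 * ln n) / (2 * n) \<le> c"
      unfolding c_def using ln0 Suc.prems(5) by (intro frac_le) auto
  qed (simp add: sum_nonneg)
  also have "\<dots> \<le> c * (\<Sum>x\<in>S. \<Sum>z\<in>S. \<Sum>ys\<in>Y x. D (x # ys) x z)"
    by (intro mult_left_mono sum_mono B1 c0)
  also have "(\<Sum>x\<in>S. \<Sum>z\<in>S. \<Sum>ys\<in>Y x. D (x # ys) x z) = (\<Sum>x\<in>S. \<Sum>ys\<in>Y x. \<Sum>z\<in>S. D (x # ys) x z)"
    by (intro sum.cong refl sum.swap)
  finally have B: "ent_sum S F \<le> c * (\<Sum>x\<in>S. \<Sum>ys\<in>Y x. \<Sum>z\<in>S. D (x # ys) x z)" .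
  have "ent_sum (Theta (Suc k) S) f \<le> (\<Sum>x\<in>S. c * (\<Sum>ys\<in>Y x. \<Sum>i\<in>set ys. \<Sum>z\<in>S. D (x # ys) i z))
      + c * (\<Sum>x\<in>S. \<Sum>ys\<in>Y x. \<Sum>z\<in>S. D (x # ys) x z)"
    unfolding chain by (intro add_mono sum_mono A B)
  also have "\<dots> = c * (\<Sum>x\<in>S. \<Sum>ys\<in>Y x. (\<Sum>z\<in>S. D (x # ys) x z) + (\<Sum>i\<in>set ys. \<Sum>z\<in>S. D (x # ys) i z))"
    by (simp add: sum.distrib sum_distrib_left algebra_simps)
  also have "\<dots> = c * (\<Sum>x\<in>S. \<Sum>ys\<in>Y x. \<Sum>i\<in>set (x # ys). \<Sum>z\<in>S. D (x # ys) i z)"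
  proof (intro arg_cong[where f = "(*) c"] sum.cong refl)
    fix x ys assume "ys \<in> Y x"
    then have "x \<notin> set ys" by (auto simp: Y_def Theta_def)
    then show "(\<Sum>z\<in>S. D (x # ys) x z) + (\<Sum>i\<in>set ys. \<Sum>z\<in>S. D (x # ys) i z) =
        (\<Sum>i\<in>set (x # ys). \<Sum>z\<in>S. D (x # ys) i z)" by simp
  qed
  also have "\<dots> = c * (\<Sum>xs\<in>Theta (Suc k) S. \<Sum>i\<in>set xs. \<Sum>z\<in>S. D xs i z)"
    by (simp only: sum_Theta_Suc[OF fin] Y_def)
  finally show ?case by (simp add: c_def D_def)
qed

corollary ent_sum_le_transposition_energy:
  fixes f :: "'a list \<Rightarrow> real"
  assumes S: "finite S" "3 * k \<le> card S" and "k > 0"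
    and f: "\<And>xs. xs \<in> Theta k S \<Longrightarrow> f xs \<ge> 0"
  shows "ent_sum (Theta k S) f \<le> (3 + 2 * ln (real (card S))) / real (card S) *
     (\<Sum>i\<in>S. \<Sum>z\<in>S. energy (Theta k S) (\<lambda>xs. sqrt (f xs)) (transpose i z))"
proof -
  define c where "c = (3 + 2 * ln (real (card S)))"
  define D where "D = (\<lambda>xs. \<lambda>i. \<lambda>z. (sqrt (f xs) - sqrt (f (map (transpose i z) xs)))\<^sup>2)"
  define M where "M = card S - k + 1"
  have M: "real M = real (card S) - real k + 1" using S by (simp add: M_def)
  \<comment> \<open>At least half of the sites remain available to every entry, so
    \<open>2 * M\<close> may be replaced by \<open>card S\<close>.\<close>
  have n: "real (card S) > 0" and n2: "real (card S) \<le> 2 * real M" using S assms(3) M by linarith+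
  have c: "c \<ge> 0" using n by (simp add: c_def)
  have "ent_sum (Theta k S) f \<le> c / (2 * real M) * (\<Sum>xs\<in>Theta k S. \<Sum>i\<in>set xs. \<Sum>z\<in>S. D xs i z)"
    unfolding c_def D_def
    by (rule ent_sum_Theta_le) (use S f M in \<open>auto simp: M_def\<close>)
  also have "\<dots> \<le> c / real (card S) * (\<Sum>xs\<in>Theta k S. \<Sum>i\<in>S. \<Sum>z\<in>S. D xs i z)"
  proof (rule mult_mono)
    show "c / (2 * real M) \<le> c / real (card S)" using c n n2 by (intro divide_left_mono) auto
    show "(\<Sum>xs\<in>Theta k S. \<Sum>i\<in>set xs. \<Sum>z\<in>S. D xs i z) \<le> (\<Sum>xs\<in>Theta k S. \<Sum>i\<in>S. \<Sum>z\<in>S. D xs i z)"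
      by (intro sum_mono sum_mono2 S sum_nonneg) (auto simp: Theta_def D_def)
  qed (use c in \<open>auto simp: D_def intro!: sum_nonneg\<close>)
  also have "(\<Sum>xs\<in>Theta k S. \<Sum>i\<in>S. \<Sum>z\<in>S. D xs i z) =
      (\<Sum>i\<in>S. \<Sum>z\<in>S. energy (Theta k S) (\<lambda>xs. sqrt (f xs)) (transpose i z))"
    unfolding energy_def D_def
    by (subst sum.swap, intro sum.cong refl, rule sum.swap)
  finally show ?thesis by (simp add: c_def)
qed

section \<open>Displacement of a function on tuples under permutations\<close>

lemma sum_Pow_insert:
  fixes F :: "'e set \<Rightarrow> real"
  assumes "finite E" "e \<notin> E"
  shows "(\<Sum>A\<in>Pow (insert e E). F A) = (\<Sum>A\<in>Pow E. F A) + (\<Sum>A\<in>Pow E. F (insert e A))"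
proof -
  have "(\<Sum>A\<in>Pow (insert e E). F A) = sum F (Pow E) + sum F (insert e ` Pow E)"
    unfolding Pow_insert by (rule sum.union_disjoint) (use assms in auto)
  also have "sum F (insert e ` Pow E) = (\<Sum>A\<in>Pow E. F (insert e A))"
    by (subst sum.reindex) (use assms in \<open>auto intro!: inj_onI\<close>)
  finally show ?thesis .
qed

text \<open>The sharp Poincare inequality, unnormalised. A canonical path argument would lose
  another factor of order \<open>card E\<close>, which shears with up to order \<open>n^2\<close>
  matrix entries cannot afford. The induction step expresses the cross terms between the two halves
  through the terms within them and the difference of the two sums, which Cauchy-Schwarz
  bounds.\<close>

lemma cube_poincare:
  fixes \<phi> :: "'e set \<Rightarrow> real"
  assumes "finite E"
  shows "(\<Sum>A\<in>Pow E. \<Sum>B\<in>Pow E. (\<phi> A - \<phi> B)\<^sup>2)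
     \<le> 2 ^ card E / 2 * (\<Sum>e\<in>E. \<Sum>A\<in>Pow E. (\<phi> A - \<phi> (sym_diff A {e}))\<^sup>2)"
  using assms
proof (induction E arbitrary: \<phi> rule: finite_induct)
  case empty
  then show ?case by simp
next
  case (insert e E)
  define \<psi> where "\<psi> = (\<lambda>A. \<phi> (insert e A))"
  define P where "P = Pow E"
  define M :: real where "M = 2 ^ card E"
  define Q where "Q = (\<lambda>u v. \<Sum>A\<in>P. \<Sum>B\<in>P. (u A - v B :: real)\<^sup>2)"
  define R where "R = (\<lambda>u. \<Sum>x\<in>E. \<Sum>A\<in>P. (u A - u (sym_diff A {x}) :: real)\<^sup>2)"
  define d where "d = (\<Sum>A\<in>P. (\<phi> A - \<psi> A)\<^sup>2)"
  have fP: "finite P" and cP: "real (card P) = M"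
    using insert.hyps by (simp_all add: P_def M_def card_Pow)
  have M: "M > 0" by (simp add: M_def)
  have Qexp: "Q u v = M * (\<Sum>A\<in>P. (u A)\<^sup>2) + M * (\<Sum>A\<in>P. (v A)\<^sup>2) - 2 * (sum u P * sum v P)" for u v
  proof -
    have "Q u v = (\<Sum>A\<in>P. \<Sum>B\<in>P. (u A)\<^sup>2 + (v B)\<^sup>2 - 2 * (u A * v B))"
      unfolding Q_def by (intro sum.cong refl) (simp add: power2_eq_square algebra_simps)
    also have "\<dots> = M * (\<Sum>A\<in>P. (u A)\<^sup>2) + M * (\<Sum>A\<in>P. (v A)\<^sup>2) - 2 * (sum u P * sum v P)"
      by (simp add: sum.distrib sum_subtractf cP sum_product flip: sum_distrib_left)
    finally show ?thesis .
  qed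
  have IH: "Q u u \<le> M / 2 * R u" for u
    unfolding Q_def R_def M_def P_def by (rule insert.IH)
  have "(sum \<phi> P - sum \<psi> P)\<^sup>2 \<le> M * d"
  proof -
    have "(\<Sum>A\<in>P. \<bar>\<phi> A - \<psi> A\<bar> * \<bar>1::real\<bar>)\<^sup>2 \<le> (L2_set (\<lambda>A. \<phi> A - \<psi> A) P * L2_set (\<lambda>_. 1) P)\<^sup>2"
      by (intro power_mono L2_set_mult_ineq sum_nonneg) auto
    also have "\<dots> = M * d"
      by (simp add: L2_set_def power_mult_distrib sum_nonneg cP d_def less_imp_le[OF M])
    finally have *: "(\<Sum>A\<in>P. \<bar>\<phi> A - \<psi> A\<bar>)\<^sup>2 \<le> M * d" by simp
    have "\<bar>sum \<phi> P - sum \<psi> P\<bar> \<le> (\<Sum>A\<in>P. \<bar>\<phi> A - \<psi> A\<bar>)"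
      unfolding sum_subtractf[symmetric] by (rule sum_abs)
    then have "\<bar>sum \<phi> P - sum \<psi> P\<bar>\<^sup>2 \<le> (\<Sum>A\<in>P. \<bar>\<phi> A - \<psi> A\<bar>)\<^sup>2" by (intro power_mono) auto
    with * show ?thesis by simp
  qed
  moreover have "Q \<phi> \<psi> + Q \<psi> \<phi> = Q \<phi> \<phi> + Q \<psi> \<psi> + 2 * (sum \<phi> P - sum \<psi> P)\<^sup>2"
    unfolding Qexp by (simp add: power2_eq_square algebra_simps)
  ultimately have cross: "Q \<phi> \<psi> + Q \<psi> \<phi> \<le> Q \<phi> \<phi> + Q \<psi> \<psi> + 2 * (M * d)" by linarith
  have "(\<Sum>A\<in>Pow (insert e E). \<Sum>B\<in>Pow (insert e E). (\<phi> A - \<phi> B)\<^sup>2)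
      = Q \<phi> \<phi> + Q \<phi> \<psi> + (Q \<psi> \<phi> + Q \<psi> \<psi>)"
    by (simp add: sum_Pow_insert insert.hyps sum.distrib Q_def P_def \<psi>_def)
  also have "\<dots> \<le> M * R \<phi> + M * R \<psi> + 2 * (M * d)"
    using cross IH[of \<phi>] IH[of \<psi>] by (simp add: field_simps)
  also have "\<dots> = M * (R \<phi> + R \<psi> + 2 * d)" by (simp add: algebra_simps)
  also have "R \<phi> + R \<psi> + 2 * d = (\<Sum>x\<in>insert e E. \<Sum>A\<in>Pow (insert e E). (\<phi> A - \<phi> (sym_diff A {x}))\<^sup>2)"
  proof -
    have 1: "(\<Sum>A\<in>Pow (insert e E). (\<phi> A - \<phi> (sym_diff A {e}))\<^sup>2) = 2 * d"
    proof -
      have "sym_diff A {e} = insert e A" "sym_diff (insert e A) {e} = A" if "A \<in> Pow E" for A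
        using that insert.hyps by auto
      then show ?thesis
        by (simp add: sum_Pow_insert insert.hyps d_def P_def \<psi>_def power2_commute)
    qed
    have 2: "(\<Sum>A\<in>Pow (insert e E). (\<phi> A - \<phi> (sym_diff A {x}))\<^sup>2) =
        (\<Sum>A\<in>P. (\<phi> A - \<phi> (sym_diff A {x}))\<^sup>2) + (\<Sum>A\<in>P. (\<psi> A - \<psi> (sym_diff A {x}))\<^sup>2)"
      if "x \<in> E" for x
    proof -
      have "sym_diff (insert e A) {x} = insert e (sym_diff A {x})" for A
        using that insert.hyps by auto
      then show ?thesis by (simp add: sum_Pow_insert insert.hyps P_def \<psi>_def)
    qed
    show ?thesis using insert.hyps
      by (simp add: 1 2 R_def sum.distrib)
  qed
  finally show ?case using insert.hyps by (simp add: M_def)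
qed

text \<open>A pair inside one half is routed through a point of the other half, averaged over all
  such points. Each half then costs 5 times the opposite pairs, and these occur once themselves, so
  11 = 5 + 5 + 1. The reason for the reduction is that a gate with target \<tau> only exchanges
  points that differ on \<tau>.\<close>

lemma sum_halves_le:
  fixes D :: "'a \<Rightarrow> 'a \<Rightarrow> real"
  assumes S: "finite S" and half: "card {x \<in> S. p x} = card {x \<in> S. \<not> p x}"
    and D0: "\<And>x y. D x y \<ge> 0"
    and tri: "\<And>x y z. x \<in> S \<Longrightarrow> y \<in> S \<Longrightarrow> z \<in> S \<Longrightarrow> D x z \<le> 5 * (D x y + D y z)"
  shows "(\<Sum>x\<in>S. \<Sum>z\<in>S. D x z) \<le> 11 * (\<Sum>x\<in>S. \<Sum>z\<in>{z \<in> S. p x \<noteq> p z}. D x z)"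
proof -
  define G where "G = (\<lambda>X Y. \<Sum>x\<in>X. \<Sum>y\<in>Y. D x y)"
  define H0 where "H0 = {x \<in> S. \<not> p x}"
  define H1 where "H1 = {x \<in> S. p x}"
  have fin: "finite H0" "finite H1" and c: "card H0 = card H1"
    using S half by (simp_all add: H0_def H1_def)
  have S_eq: "S = H0 \<union> H1" "H0 \<inter> H1 = {}" by (auto simp: H0_def H1_def)
  have G0: "G X Y \<ge> 0" for X Y by (simp add: G_def D0 sum_nonneg)
  have same: "G X X \<le> 5 * (G X Y + G Y X)"
    if XY: "X \<subseteq> S" "Y \<subseteq> S" "card X = card Y" for X Y
  proof (cases "card X = 0")
    case True
    then have "X = {}" using XY S finite_subset by fastforce
    then show ?thesis by (simp add: G_def)
  next
    case False
    have "real (card X) * G X X = (\<Sum>x\<in>X. \<Sum>z\<in>X. \<Sum>y\<in>Y. D x z)"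
      by (simp add: G_def XY sum_distrib_left)
    also have "\<dots> \<le> (\<Sum>x\<in>X. \<Sum>z\<in>X. \<Sum>y\<in>Y. 5 * (D x y + D y z))"
      by (intro sum_mono tri) (use XY in auto)
    also have "\<dots> = 5 * ((\<Sum>x\<in>X. \<Sum>z\<in>X. \<Sum>y\<in>Y. D x y) + (\<Sum>x\<in>X. \<Sum>z\<in>X. \<Sum>y\<in>Y. D y z))"
      by (simp add: sum.distrib flip: sum_distrib_left)
    also have "(\<Sum>x\<in>X. \<Sum>z\<in>X. \<Sum>y\<in>Y. D x y) = real (card X) * G X Y"
      by (simp add: G_def sum_distrib_left)
    also have "(\<Sum>x\<in>X. \<Sum>z\<in>X. \<Sum>y\<in>Y. D y z) = real (card X) * (\<Sum>z\<in>X. \<Sum>y\<in>Y. D y z)"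
      by simp
    also have "(\<Sum>z\<in>X. \<Sum>y\<in>Y. D y z) = G Y X" unfolding G_def by (rule sum.swap)
    finally have "real (card X) * G X X \<le> real (card X) * (5 * (G X Y + G Y X))"
      by (simp add: algebra_simps)
    then show ?thesis using False by simp
  qed
  have Gunion: "(\<Sum>x\<in>S. \<Sum>z\<in>S. D x z) = G H0 H0 + G H0 H1 + (G H1 H0 + G H1 H1)"
    unfolding S_eq(1) using fin S_eq(2) by (simp add: sum.union_disjoint sum.distrib G_def)
  have "(\<Sum>x\<in>S. \<Sum>z\<in>{z \<in> S. p x \<noteq> p z}. D x z) =
      (\<Sum>x\<in>H0. \<Sum>z\<in>{z \<in> S. p x \<noteq> p z}. D x z) + (\<Sum>x\<in>H1. \<Sum>z\<in>{z \<in> S. p x \<noteq> p z}. D x z)"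
    by (subst (1) S_eq(1)) (use fin S_eq(2) in \<open>simp add: sum.union_disjoint\<close>)
  also have "(\<Sum>x\<in>H0. \<Sum>z\<in>{z \<in> S. p x \<noteq> p z}. D x z) = G H0 H1"
    unfolding G_def by (intro sum.cong refl) (auto simp: H0_def H1_def)
  also have "(\<Sum>x\<in>H1. \<Sum>z\<in>{z \<in> S. p x \<noteq> p z}. D x z) = G H1 H0"
    unfolding G_def by (intro sum.cong refl) (auto simp: H0_def H1_def)
  finally have opp: "(\<Sum>x\<in>S. \<Sum>z\<in>{z \<in> S. p x \<noteq> p z}. D x z) = G H0 H1 + G H1 H0" .
  have "G H0 H0 \<le> 5 * (G H0 H1 + G H1 H0)" "G H1 H1 \<le> 5 * (G H1 H0 + G H0 H1)"
    using same[of H0 H1] same[of H1 H0] c by (auto simp: H0_def H1_def)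
  then have "G H0 H0 + G H0 H1 + (G H1 H0 + G H1 H1) \<le> 11 * (G H0 H1 + G H1 H0)"
    by (simp add: algebra_simps)
  then show ?thesis unfolding Gunion opp .
qed

section \<open>Energies of composed permutations\<close>

locale tuple_function =
  fixes S :: "'a set" and k :: nat and g :: "'a list \<Rightarrow> real"
  assumes fin: "finite S"
begin

abbreviation V :: "'a list set" where "V \<equiv> Theta k S"
abbreviation en :: "('a \<Rightarrow> 'a) \<Rightarrow> real" where "en \<sigma> \<equiv> energy V g \<sigma>"

text \<open>An L2 norm over the family and the states jointly. In this form the triangle inequality
  for a word of gates needs the energy of each gate only on average over W, not for every single
  member.\<close>

definition disp :: "'w set \<Rightarrow> ('w \<Rightarrow> 'a \<Rightarrow> 'a) \<Rightarrow> real" where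
  "disp W s = sqrt (\<Sum>w\<in>W. en (s w))"

lemma en_cong: "(\<And>x. x \<in> S \<Longrightarrow> \<sigma> x = \<tau> x) \<Longrightarrow> en \<sigma> = en \<tau>"
  unfolding energy_def
  by (intro sum.cong refl arg_cong2[where f = "\<lambda>a b. (a - g b)\<^sup>2"] map_cong) (auto simp: Theta_def)

lemma sum_V_reindex:
  assumes "bij_betw \<sigma> S S"
  shows "(\<Sum>xs\<in>V. F (map \<sigma> xs)) = (\<Sum>xs\<in>V. F xs)"
  by (rule sum.reindex_bij_betw[OF bij_betw_map_Theta[OF assms]])

lemma disp_cong: "(\<And>w x. w \<in> W \<Longrightarrow> x \<in> S \<Longrightarrow> s w x = t w x) \<Longrightarrow> disp W s = disp W t"
  unfolding disp_def by (intro arg_cong[where f = sqrt] sum.cong refl en_cong)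

lemma disp_nonneg: "disp W s \<ge> 0"
  by (simp add: disp_def sum_nonneg energy_nonneg)

lemma disp_power2: "(disp W s)\<^sup>2 = (\<Sum>w\<in>W. en (s w))"
  by (simp add: disp_def sum_nonneg energy_nonneg)

text \<open>Minkowski's inequality through the intermediate tuple \<open>map (t w) xs\<close>. As
  \<open>t w\<close> permutes the states, the second move contributes its full energy irrespective
  of the first.\<close>

lemma disp_comp:
  assumes W: "finite W" and t: "\<And>w. w \<in> W \<Longrightarrow> bij_betw (t w) S S"
  shows "disp W (\<lambda>w x. s w (t w x)) \<le> disp W s + disp W t"
proof -
  define a where "a = (\<lambda>(w, xs). g xs - g (map (t w) xs))"
  define b where "b = (\<lambda>(w, xs). g (map (t w) xs) - g (map (s w) (map (t w) xs)))"
  have dL: "disp W u = L2_set (\<lambda>(w, xs). g xs - g (map (u w) xs)) (W \<times> V)" for u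
    by (simp add: disp_def L2_set_def energy_def sum.cartesian_product case_prod_unfold)
  have "disp W (\<lambda>w x. s w (t w x)) = L2_set (\<lambda>p. b p + a p) (W \<times> V)"
    unfolding dL a_def b_def
    by (intro L2_set_cong refl) (auto simp: comp_def)
  also have "\<dots> \<le> L2_set b (W \<times> V) + L2_set a (W \<times> V)"
    by (rule L2_set_triangle_ineq)
  also have "L2_set a (W \<times> V) = disp W t" by (simp add: dL a_def)
  also have "L2_set b (W \<times> V) = disp W s"
  proof -
    have "(\<Sum>p\<in>W \<times> V. (b p)\<^sup>2) = (\<Sum>w\<in>W. \<Sum>xs\<in>V. (g (map (t w) xs) - g (map (s w) (map (t w) xs)))\<^sup>2)"
      by (simp add: b_def sum.cartesian_product case_prod_unfold)
    also have "\<dots> = (\<Sum>w\<in>W. en (s w))"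
    proof (rule sum.cong[OF refl])
      fix w assume "w \<in> W"
      show "(\<Sum>xs\<in>V. (g (map (t w) xs) - g (map (s w) (map (t w) xs)))\<^sup>2) = en (s w)"
        unfolding energy_def
        by (rule sum_V_reindex[OF t[OF \<open>w \<in> W\<close>], where F = "\<lambda>xs. (g xs - g (map (s w) xs))\<^sup>2"])
    qed
    finally show ?thesis by (simp add: L2_set_def disp_def)
  qed
  finally show ?thesis .
qed

lemma sqrt_en_comp:
  assumes "bij_betw \<tau> S S"
  shows "sqrt (en (\<lambda>x. \<sigma> (\<tau> x))) \<le> sqrt (en \<sigma>) + sqrt (en \<tau>)"
  using disp_comp[of "{()}" "\<lambda>_. \<tau>" "\<lambda>_. \<sigma>"] assms by (simp add: disp_def)

lemma en_comp2:
  assumes "bij_betw \<tau> S S"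
  shows "en (\<lambda>x. \<sigma> (\<tau> x)) \<le> 2 * (en \<sigma> + en \<tau>)"
proof -
  have "(sqrt (en (\<lambda>x. \<sigma> (\<tau> x))))\<^sup>2 \<le> (sqrt (en \<sigma>) + sqrt (en \<tau>))\<^sup>2"
    by (intro power_mono sqrt_en_comp assms) (simp add: energy_nonneg)
  also have "\<dots> \<le> 2 * ((sqrt (en \<sigma>))\<^sup>2 + (sqrt (en \<tau>))\<^sup>2)"
    using zero_le_power2[of "sqrt (en \<sigma>) - sqrt (en \<tau>)"]
    by (simp add: power2_eq_square algebra_simps)
  finally show ?thesis by (simp add: energy_nonneg)
qed

lemma en_conj:
  assumes \<sigma>: "bij_betw \<sigma> S S" and \<tau>: "bij_betw \<tau> S S"
  shows "en (\<lambda>x. \<tau> (\<sigma> (\<tau> x))) \<le> 5 * (en \<tau> + en \<sigma>)"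
proof -
  have 1: "bij_betw (\<lambda>x. \<sigma> (\<tau> x)) S S"
    using bij_betw_trans[OF \<tau> \<sigma>] by (simp add: comp_def)
  have "sqrt (en (\<lambda>x. \<tau> (\<sigma> (\<tau> x)))) \<le> 2 * sqrt (en \<tau>) + sqrt (en \<sigma>)"
    using sqrt_en_comp[OF 1, of \<tau>] sqrt_en_comp[OF \<tau>, of \<sigma>] by simp
  then have "(sqrt (en (\<lambda>x. \<tau> (\<sigma> (\<tau> x)))))\<^sup>2 \<le> (2 * sqrt (en \<tau>) + sqrt (en \<sigma>))\<^sup>2"
    by (intro power_mono) (simp_all add: energy_nonneg)
  also have "\<dots> \<le> 5 * ((sqrt (en \<tau>))\<^sup>2 + (sqrt (en \<sigma>))\<^sup>2)"
    using zero_le_power2[of "sqrt (en \<tau>) - 2 * sqrt (en \<sigma>)"]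
    by (simp add: power2_eq_square algebra_simps)
  finally show ?thesis by (simp add: energy_nonneg)
qed

text \<open>A core d conjugated by three maps is a word of length seven, and Cauchy-Schwarz gives
  the factor 7. This is the shape of \<open>gate\<close> below.\<close>

lemma en_conj3:
  assumes "bij_betw a S S" "bij_betw b S S" "bij_betw c S S" "bij_betw d S S"
  shows "en (\<lambda>x. a (b (c (d (c (b (a x))))))) \<le> 7 * (2 * en a + 2 * en b + 2 * en c + en d)"
proof -
  have comp: "bij_betw (\<lambda>x. u (v x)) S S" if "bij_betw u S S" "bij_betw v S S" for u v
    using bij_betw_trans[OF that(2,1)] by (simp add: comp_def)
  define A B C D where "A = sqrt (en a)" "B = sqrt (en b)" "C = sqrt (en c)" "D = sqrt (en d)"
  note bij = comp[OF assms(2,1)]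
  note bij = bij comp[OF assms(3) this]
  note bij = bij comp[OF assms(4) bij(2)]
  note bij = bij comp[OF assms(3) bij(3)]
  note bij = bij comp[OF assms(2) bij(4)]
  have "sqrt (en (\<lambda>x. a (b (c (d (c (b (a x)))))))) \<le> A + (B + (C + (D + (C + (B + A)))))"
    using sqrt_en_comp[OF bij(5), of a] sqrt_en_comp[OF bij(4), of b] sqrt_en_comp[OF bij(3), of c]
      sqrt_en_comp[OF bij(2), of d] sqrt_en_comp[OF bij(1), of c] sqrt_en_comp[OF assms(1), of b]
    unfolding A_B_C_D_def by linarith
  then have "(sqrt (en (\<lambda>x. a (b (c (d (c (b (a x)))))))))\<^sup>2 \<le> (A + (B + (C + (D + (C + (B + A))))))\<^sup>2"
    by (intro power_mono) (simp_all add: energy_nonneg)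
  also have "\<dots> \<le> 7 * (2 * A\<^sup>2 + 2 * B\<^sup>2 + 2 * C\<^sup>2 + D\<^sup>2)"
  proof -
    have "0 \<le> 4 * (A - B)\<^sup>2 + 4 * (A - C)\<^sup>2 + 4 * (B - C)\<^sup>2
        + 2 * (A - D)\<^sup>2 + 2 * (B - D)\<^sup>2 + 2 * (C - D)\<^sup>2" by simp
    then show ?thesis by (simp add: power2_eq_square algebra_simps)
  qed
  finally show ?thesis by (simp add: energy_nonneg A_B_C_D_def)
qed

text \<open>For a fixed tuple xs, sending A to \<open>g (map (sh A) xs)\<close> is a function on the
  cube, to which \<open>cube_poincare\<close> applies. After summation over xs, the squared
  difference between A and B depends only on their symmetric difference and equals the energy of the
  corresponding \<open>sh\<close>.\<close>

lemma sum_en_involutions_le: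
  assumes E: "finite E"
    and bij: "\<And>A. A \<subseteq> E \<Longrightarrow> bij_betw (sh A) S S"
    and hom: "\<And>A B x. A \<subseteq> E \<Longrightarrow> B \<subseteq> E \<Longrightarrow> x \<in> S \<Longrightarrow> sh (sym_diff A B) x = sh A (sh B x)"
  shows "(\<Sum>A\<in>Pow E. en (sh A)) \<le> 2 ^ card E / 2 * (\<Sum>e\<in>E. en (sh {e}))"
proof -
  define M :: real where "M = 2 ^ card E"
  have M: "M > 0" by (simp add: M_def)
  have cP: "real (card (Pow E)) = M" using E by (simp add: card_Pow M_def)
  have shift: "(\<Sum>xs\<in>V. (g (map (sh A) xs) - g (map (sh (sym_diff B A)) xs))\<^sup>2) = en (sh B)"
    if "A \<subseteq> E" "B \<subseteq> E" for A B
  proof -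
    have "map (sh (sym_diff B A)) xs = map (sh B) (map (sh A) xs)" if "xs \<in> V" for xs
      unfolding map_map comp_def
      by (rule map_cong[OF refl]) (use that \<open>A \<subseteq> E\<close> \<open>B \<subseteq> E\<close> in \<open>auto simp: Theta_def intro!: hom\<close>)
    then have "(\<Sum>xs\<in>V. (g (map (sh A) xs) - g (map (sh (sym_diff B A)) xs))\<^sup>2)
        = (\<Sum>xs\<in>V. (g (map (sh A) xs) - g (map (sh B) (map (sh A) xs)))\<^sup>2)"
      by (intro sum.cong refl) (simp only:)
    also have "\<dots> = en (sh B)"
      unfolding energy_def
      by (rule sum_V_reindex[OF bij[OF that(1)], where F = "\<lambda>xs. (g xs - g (map (sh B) xs))\<^sup>2"])
    finally show ?thesis .
  qed
  have translate: "(\<Sum>B\<in>Pow E. F B) = (\<Sum>B\<in>Pow E. F (sym_diff B A))" if "A \<subseteq> E" for A and F :: "_ \<Rightarrow> real"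
    by (rule sum.reindex_bij_witness[where i = "\<lambda>B. sym_diff B A" and j = "\<lambda>B. sym_diff B A"])
      (use that in \<open>auto intro!: arg_cong[where f = F]\<close>)
  have "M * (\<Sum>A\<in>Pow E. en (sh A)) = (\<Sum>A\<in>Pow E. \<Sum>B\<in>Pow E. en (sh B))"
    by (simp add: cP)
  also have "\<dots> = (\<Sum>A\<in>Pow E. \<Sum>B\<in>Pow E. \<Sum>xs\<in>V. (g (map (sh A) xs) - g (map (sh (sym_diff B A)) xs))\<^sup>2)"
    by (intro sum.cong refl) (simp add: shift)
  also have "\<dots> = (\<Sum>A\<in>Pow E. \<Sum>B\<in>Pow E. \<Sum>xs\<in>V. (g (map (sh A) xs) - g (map (sh B) xs))\<^sup>2)"
    by (rule sum.cong[OF refl], rule translate[symmetric, where F =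
      "\<lambda>B. \<Sum>xs\<in>V. (g (map (sh A) xs) - g (map (sh B) xs))\<^sup>2" for A]) simp
  also have "\<dots> = (\<Sum>xs\<in>V. \<Sum>A\<in>Pow E. \<Sum>B\<in>Pow E. (g (map (sh A) xs) - g (map (sh B) xs))\<^sup>2)"
    by (subst (2) sum.swap, subst sum.swap) (intro sum.cong refl sum.swap)
  also have "\<dots> \<le> (\<Sum>xs\<in>V. M / 2 * (\<Sum>e\<in>E. \<Sum>A\<in>Pow E.
        (g (map (sh A) xs) - g (map (sh (sym_diff A {e})) xs))\<^sup>2))"
    unfolding M_def by (intro sum_mono cube_poincare E)
  also have "\<dots> = M / 2 * (\<Sum>e\<in>E. \<Sum>A\<in>Pow E. \<Sum>xs\<in>V.
        (g (map (sh A) xs) - g (map (sh (sym_diff {e} A)) xs))\<^sup>2)"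
    unfolding sum_distrib_left[symmetric]
    by (subst sum.swap, subst (2) sum.swap) (simp add: Un_commute)
  also have "\<dots> = M / 2 * (\<Sum>e\<in>E. \<Sum>A\<in>Pow E. en (sh {e}))"
    by (intro arg_cong[where f = "(*) (M / 2)"] sum.cong refl shift) auto
  also have "\<dots> = M * (M / 2 * (\<Sum>e\<in>E. en (sh {e})))"
    by (simp add: cP sum_distrib_left)
  finally show ?thesis using M by (simp add: M_def)
qed

text \<open>The quasi-triangle inequality holds because (x z) is (y z) conjugated by (x y); the 5 is
  that of \<open>en_conj\<close>.\<close>

lemma sum_transpositions_le:
  assumes "card {x \<in> S. p x} = card {x \<in> S. \<not> p x}"
  shows "(\<Sum>x\<in>S. \<Sum>z\<in>S. en (transpose x z))
    \<le> 11 * (\<Sum>x\<in>S. \<Sum>z\<in>{z \<in> S. p x \<noteq> p z}. en (transpose x z))"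
proof (rule sum_halves_le[OF fin assms energy_nonneg])
  fix x y z assume *: "x \<in> S" "y \<in> S" "z \<in> S"
  show "en (transpose x z) \<le> 5 * (en (transpose x y) + en (transpose y z))"
  proof (cases "x = z \<or> x = y \<or> y = z")
    case True
    then show ?thesis
    proof (elim disjE)
      assume "x = z"
      then have "en (transpose x z) = 0" by (simp add: energy_def)
      then show ?thesis by (simp add: energy_nonneg)
    qed (use energy_nonneg[of V g "transpose x z"] in \<open>simp_all add: energy_nonneg\<close>)
  next
    case False
    then have "transpose x z = transpose x y \<circ> transpose y z \<circ> transpose x y"
      by (simp add: transpose_comp_triple)
    then have "en (transpose x z) = en (\<lambda>w. transpose x y (transpose y z (transpose x y w)))"
      by (simp add: comp_def)
    also have "\<dots> \<le> 5 * (en (transpose x y) + en (transpose y z))"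
      by (rule en_conj) (use * in auto)
    finally show ?thesis .
  qed
qed

end

section \<open>Shears of the Boolean cube and universal hashing\<close>

text \<open>A bit string is the set of coordinates that carry a one, so addition in $\mathbb{F}_2^U$
  is symmetric difference. A relation \<open>B\<close> is the 0-1 matrix of a linear map \<open>lin B\<close>, and
  a pair \<open>(l, c)\<close> in \<open>B\<close> is a CNOT with target \<open>l\<close> and control \<open>c\<close>.\<close>

definition lin :: "('a \<times> 'a) set \<Rightarrow> 'a set \<Rightarrow> 'a set" where
  "lin B X = {l. odd (card {c \<in> X. (l, c) \<in> B})}"

definition shear :: "('a \<times> 'a) set \<Rightarrow> 'a set \<Rightarrow> 'a set" where
  "shear B X = sym_diff X (lin B X)"

definition flip :: "'a \<Rightarrow> ('a set \<Rightarrow> bool) \<Rightarrow> 'a set \<Rightarrow> 'a set" where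
  "flip t p X = (if p X then sym_diff X {t} else X)"

lemma odd_card_sym_diff:
  assumes "finite A" "finite B"
  shows "odd (card (sym_diff A B)) \<longleftrightarrow> odd (card A) \<noteq> odd (card B)"
proof -
  have "card (sym_diff A B) = card (A - B) + card (B - A)"
    using assms by (intro card_Un_disjoint) auto
  moreover have "card A = card (A - B) + card (A \<inter> B)"
    using card_Int_Diff[OF assms(1), of B] by simp
  moreover have "card B = card (B - A) + card (A \<inter> B)"
    using card_Int_Diff[OF assms(2), of A] by (simp add: Int_commute)
  ultimately show ?thesis by auto
qed

lemma lin_sym_diff:
  assumes "finite X" "finite Y"
  shows "lin B (sym_diff X Y) = sym_diff (lin B X) (lin B Y)"
proof -
  have "{c \<in> sym_diff X Y. (l, c) \<in> B} = sym_diff {c \<in> X. (l, c) \<in> B} {c \<in> Y. (l, c) \<in> B}" for l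
    by auto
  then show ?thesis
    using assms by (auto simp: lin_def odd_card_sym_diff)
qed

lemma lin_sym_diff_rel:
  assumes "finite X"
  shows "lin (sym_diff A B) X = sym_diff (lin A X) (lin B X)"
proof -
  have "{c \<in> X. (l, c) \<in> sym_diff A B} = sym_diff {c \<in> X. (l, c) \<in> A} {c \<in> X. (l, c) \<in> B}" for l
    by auto
  then show ?thesis
    using assms by (auto simp: lin_def odd_card_sym_diff)
qed

lemma lin_empty [simp]: "lin B {} = {}"
  by (simp add: lin_def)

lemma lin_subset:
  assumes "B \<subseteq> T \<times> C"
  shows "lin B X \<subseteq> T"
proof
  fix l assume "l \<in> lin B X"
  then have "{c \<in> X. (l, c) \<in> B} \<noteq> {}" unfolding lin_def using card.empty by fastforce
  then show "l \<in> T" using assms by auto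
qed

lemma lin_cong:
  assumes "B \<subseteq> T \<times> C" "X \<inter> C = Y \<inter> C"
  shows "lin B X = lin B Y"
proof -
  have "{c \<in> X. (l, c) \<in> B} = {c \<in> Y. (l, c) \<in> B}" for l using assms by blast
  then show ?thesis by (simp add: lin_def)
qed

lemma shear_empty [simp]: "shear B {} = {}"
  by (simp add: shear_def)

lemma shear_subset:
  assumes "B \<subseteq> T \<times> C" "T \<subseteq> U" "X \<subseteq> U"
  shows "shear B X \<subseteq> U"
  using lin_subset[OF assms(1), of X] assms by (auto simp: shear_def)

lemma shear_sym_diff:
  assumes "finite X" "finite Y"
  shows "shear B (sym_diff X Y) = sym_diff (shear B X) (shear B Y)"
  unfolding shear_def lin_sym_diff[OF assms] by auto

text \<open>Controls are never targets, so the product of the two linear parts vanishes and (I +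
  A)(I + B) = I + A + B.\<close>

lemma shear_comp:
  assumes "A \<subseteq> T \<times> C" "B \<subseteq> T \<times> C" "T \<inter> C = {}" "finite X"
  shows "shear (sym_diff A B) X = shear A (shear B X)"
proof -
  have "lin A (shear B X) = lin A X"
    by (rule lin_cong[OF assms(1)]) (use lin_subset[OF assms(2), of X] assms(3) in \<open>auto simp: shear_def\<close>)
  then show ?thesis
    unfolding shear_def[of "sym_diff A B"] shear_def[of A] lin_sym_diff_rel[OF assms(4)]
    by (auto simp: shear_def)
qed

lemma shear_shear:
  assumes "A \<subseteq> T \<times> C" "T \<inter> C = {}" "finite X"
  shows "shear A (shear A X) = X"
  using shear_comp[OF assms(1,1,2,3)] by (simp add: shear_def lin_def)

lemma bij_betw_shear:
  assumes "A \<subseteq> T \<times> C" "T \<inter> C = {}" "finite U" "T \<subseteq> U"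
  shows "bij_betw (shear A) (Pow U) (Pow U)"
  by (rule bij_betw_byWitness[where f' = "shear A"])
    (use shear_shear[OF assms(1,2)] shear_subset[OF assms(1,4)] finite_subset[OF _ assms(3)] in auto)

lemma bij_betw_flip:
  assumes "t \<in> U" "\<And>X. X \<subseteq> U \<Longrightarrow> p (sym_diff X {t}) = p X"
  shows "bij_betw (flip t p) (Pow U) (Pow U)"
proof (rule bij_betw_byWitness[where f' = "flip t p"])
  show "\<forall>X\<in>Pow U. flip t p (flip t p X) = X" "\<forall>X\<in>Pow U. flip t p (flip t p X) = X"
    using assms(2) by (auto simp: flip_def)
  show "flip t p ` Pow U \<subseteq> Pow U" "flip t p ` Pow U \<subseteq> Pow U"
    using assms(1) by (auto simp: flip_def)
qed

text \<open>A uniformly random matrix sends a fixed nonzero vector to a uniform vector: toggling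
  entries in one column c of \<open>t\<close> translates any prescribed value into any other, so all
  classes have equal size.\<close>

lemma card_lin_eq:
  assumes fin: "finite J" "finite K" and t: "t \<subseteq> K" "t \<noteq> {}" and w: "w \<subseteq> J"
  shows "card {B \<in> Pow (J \<times> K). lin B t = w} * 2 ^ card J = card (Pow (J \<times> K))"
proof -
  define cls where "cls = (\<lambda>u. {B \<in> Pow (J \<times> K). lin B t = u})"
  obtain c where c: "c \<in> t" using t by blast
  have finJK: "finite (Pow (J \<times> K))" using fin by simp
  have finB: "finite (cls u)" for u unfolding cls_def using finJK by simp
  have ft: "finite t" using t fin finite_subset by blast
  have lin_c: "lin (u \<times> {c}) t = u" for u
  proof -
    have "{c' \<in> t. (l, c') \<in> u \<times> {c}} = (if l \<in> u then {c} else {})" for l using c by auto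
    then show ?thesis by (auto simp: lin_def split: if_splits)
  qed
  have same: "card (cls u) = card (cls w)" if u: "u \<subseteq> J" for u
  proof -
    define s where "s = sym_diff u w \<times> {c}"
    have s: "s \<subseteq> J \<times> K" using u w c t by (auto simp: s_def)
    have maps: "sym_diff B s \<in> cls b" if "B \<in> cls a" "sym_diff a (sym_diff u w) = b" for B a b
      using that s by (auto simp: cls_def lin_sym_diff_rel[OF ft] s_def lin_c)
    have inv: "sym_diff (sym_diff B s) s = B" for B by auto
    have "sym_diff u (sym_diff u w) = w" "sym_diff w (sym_diff u w) = u" by auto
    then have "bij_betw (\<lambda>B. sym_diff B s) (cls u) (cls w)"
      by (intro bij_betw_byWitness[where f' = "\<lambda>B. sym_diff B s"])
        (use maps[of _ u w] maps[of _ w u] inv in \<open>auto simp only: ball_simps image_subset_iff\<close>)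
    then show ?thesis by (rule bij_betw_same_card)
  qed
  have "Pow (J \<times> K) = (\<Union>u\<in>Pow J. cls u)"
    using lin_subset[of _ J K t] by (auto simp: cls_def)
  then have "card (Pow (J \<times> K)) = (\<Sum>u\<in>Pow J. card (cls u))"
    using fin finB by (simp only:) (intro card_UN_disjoint, auto simp: cls_def)
  also have "\<dots> = (\<Sum>u\<in>Pow J. card (cls w))" by (intro sum.cong refl same) auto
  also have "\<dots> = 2 ^ card J * card (cls w)" using fin by (simp add: card_Pow)
  finally show ?thesis by (simp add: cls_def)
qed

section \<open>Collision counts for random shears\<close>

locale wires =
  fixes \<tau> :: 'a and K J :: "'a set"
  assumes finK: "finite K" and finJ: "finite J" and KJ: "K \<inter> J = {}"
    and \<tau>K: "\<tau> \<notin> K" and \<tau>J: "\<tau> \<notin> J"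
begin

text \<open>A matrix in \<open>As\<close> copies \<tau> onto other wires and thereby chooses the
  direction of the move; one in \<open>Bs\<close> hashes the K part into J; one in \<open>Cs\<close>
  first randomises the K part of any difference that is nonzero on J, which is what the dense case
  requires.\<close>

definition Cs where "Cs = Pow (K \<times> J)"
definition Bs where "Bs = Pow (J \<times> K)"
definition As where "As = Pow ((K \<union> J) \<times> {\<tau>})"

lemma finite_Cs: "finite Cs" and finite_Bs: "finite Bs" and finite_As: "finite As"
  using finK finJ by (auto simp: Cs_def Bs_def As_def)

lemma hash_empty_iff:
  assumes C: "C \<in> Cs" and B: "B \<in> Bs"
  shows "shear B (shear C X) \<inter> J = {} \<longleftrightarrow> lin B (sym_diff (X \<inter> K) (lin C (X \<inter> J))) = X \<inter> J"
proof -
  have C': "C \<subseteq> K \<times> J" and B': "B \<subseteq> J \<times> K" using C B by (auto simp: Cs_def Bs_def)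
  have 1: "lin C X = lin C (X \<inter> J)" by (rule lin_cong[OF C']) auto
  have sub: "lin C X \<subseteq> K" by (rule lin_subset[OF C'])
  have 2: "lin B (shear C X) = lin B (sym_diff (X \<inter> K) (lin C (X \<inter> J)))"
    by (rule lin_cong[OF B']) (use sub 1 in \<open>auto simp: shear_def\<close>)
  have "lin B (shear C X) \<subseteq> J" by (rule lin_subset[OF B'])
  moreover have "shear C X \<inter> J = X \<inter> J" using sub KJ by (auto simp: shear_def)
  ultimately have "shear B (shear C X) \<inter> J = {} \<longleftrightarrow> lin B (shear C X) = X \<inter> J"
    by (auto simp: shear_def[of B])
  then show ?thesis by (simp add: 2)
qed

text \<open>X stands for the difference of two points: by linearity, they receive the same pattern
  on J precisely when their difference is sent to zero there.\<close>

definition collisions where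
  "collisions X = {(C, B). C \<in> Cs \<and> B \<in> Bs \<and> shear B (shear C X) \<inter> J = {}}"

lemma collisions_subset: "collisions X \<subseteq> Cs \<times> Bs"
  by (auto simp: collisions_def)

text \<open>For C with a nonzero K part, \<open>card_lin_eq\<close> lets a fraction
  \<open>1 / 2^card J\<close> of all B collide. If the K part vanishes, then the J part of X is
  nonzero, B adds nothing to it, and no collision occurs; such C may be left out of P.\<close>

lemma card_collisions_le_aux:
  fixes P
  assumes P: "P \<subseteq> Cs" "\<And>C. C \<in> Cs \<Longrightarrow> C \<notin> P \<Longrightarrow> sym_diff (X \<inter> K) (lin C (X \<inter> J)) = {}"
    and X: "X \<inter> (K \<union> J) \<noteq> {}"
  shows "real (card (collisions X)) * 2 ^ card J \<le> real (card P) * real (card Bs)"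
proof -
  define t where "t = (\<lambda>C. sym_diff (X \<inter> K) (lin C (X \<inter> J)))"
  define cB where "cB = (\<lambda>C. {B \<in> Bs. lin B (t C) = X \<inter> J})"
  have finP: "finite P" using P finite_Cs finite_subset by blast
  have emp: "cB C = {}" if "C \<in> Cs" "t C = {}" for C
  proof (cases "X \<inter> J = {}")
    case True
    then show ?thesis using that X by (auto simp: t_def)
  next
    case False
    then show ?thesis using that by (auto simp: cB_def)
  qed
  have "collisions X = (SIGMA C:Cs. cB C)"
  proof (rule set_eqI)
    fix p show "p \<in> collisions X \<longleftrightarrow> p \<in> (SIGMA C:Cs. cB C)"
      by (cases p) (simp add: collisions_def cB_def t_def hash_empty_iff cong: conj_cong)
  qed
  then have "card (collisions X) = (\<Sum>C\<in>Cs. card (cB C))"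
    using finite_Cs finite_Bs by (simp add: cB_def)
  also have "\<dots> = (\<Sum>C\<in>P. card (cB C))"
    by (rule sum.mono_neutral_right[OF finite_Cs P(1)]) (use P(2) emp in \<open>auto simp: t_def\<close>)
  finally have "card (collisions X) * 2 ^ card J = (\<Sum>C\<in>P. card (cB C) * 2 ^ card J)"
    by (simp add: sum_distrib_right)
  also have "\<dots> \<le> (\<Sum>C\<in>P. card Bs)"
  proof (rule sum_mono)
    fix C assume "C \<in> P"
    then have C: "C \<in> Cs" using P by auto
    show "card (cB C) * 2 ^ card J \<le> card Bs"
    proof (cases "t C = {}")
      case False
      have "t C \<subseteq> K" using lin_subset[of C K J "X \<inter> J"] C by (auto simp: t_def Cs_def)
      then show ?thesis unfolding cB_def Bs_def
        using card_lin_eq[OF finJ finK _ False, of "X \<inter> J"] by simp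
    qed (use emp[OF C] in simp)
  qed
  also have "\<dots> = card P * card Bs" by simp
  finally show ?thesis
    by (metis of_nat_mono of_nat_mult of_nat_power of_nat_numeral)
qed

lemma card_collisions_le:
  assumes "X \<inter> (K \<union> J) \<noteq> {}"
  shows "real (card (collisions X)) * 2 ^ card J \<le> real (card (Cs \<times> Bs))"
  using card_collisions_le_aux[of Cs X] assms by (simp add: card_cartesian_product)

text \<open>With K a single wire, \<open>lin C (X \<inter> J)\<close> is a uniform bit, by
  \<open>card_lin_eq\<close> with the roles of J and K exchanged. It cancels
  \<open>X \<inter> K\<close> for half of all C, and these give no collision.\<close>

lemma card_collisions_le_half:
  assumes K: "card K = 1" and X: "X \<inter> J \<noteq> {}"
  shows "2 * real (card (collisions X)) * 2 ^ card J \<le> real (card (Cs \<times> Bs))"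
proof -
  define P where "P = {C \<in> Cs. lin C (X \<inter> J) \<noteq> X \<inter> K}"
  have "card {C \<in> Cs. lin C (X \<inter> J) = X \<inter> K} * 2 = card Cs"
    unfolding Cs_def using card_lin_eq[OF finK finJ, of "X \<inter> J" "X \<inter> K"] X K by simp
  moreover have "card Cs = card P + card {C \<in> Cs. lin C (X \<inter> J) = X \<inter> K}"
    unfolding P_def using finite_Cs
    by (subst card_Un_disjoint[symmetric]) (auto intro!: arg_cong[where f = card])
  ultimately have cP: "2 * card P = card Cs" by linarith
  have "real (card (collisions X)) * 2 ^ card J \<le> real (card P) * real (card Bs)"
    by (rule card_collisions_le_aux) (use X in \<open>auto simp: P_def\<close>)
  then show ?thesis using cP by (simp add: card_cartesian_product flip: cP)
qed

text \<open>In the dense case (a single wire \<open>K\<close>) at most one difference vanishes on \<open>J\<close>, and all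
  others collide with half the generic probability.\<close>
lemma card_no_collision:
  assumes D: "D \<subseteq> Pow (K \<union> J) - {{}}" and k: "card D < k"
    and dens: "2 * k \<le> 2 ^ card J \<or> card K = 1 \<and> 3 * k \<le> 4 * 2 ^ card J"
  shows "real (card (Cs \<times> Bs)) \<le> 3 * real (card (Cs \<times> Bs - (\<Union>d\<in>D. collisions d)))"
proof -
  define \<Omega> where "\<Omega> = real (card (Cs \<times> Bs))"
  define q :: real where "q = 2 ^ card J"
  define bad where "bad = (\<Union>d\<in>D. collisions d)"
  have q: "q > 0" and \<Omega>: "\<Omega> \<ge> 0" by (simp_all add: q_def \<Omega>_def)
  have finD: "finite D" using D finK finJ by (meson finite_Diff finite_Pow_iff finite_UnI finite_subset)
  have ne: "d \<inter> (K \<union> J) \<noteq> {}" if "d \<in> D" for d using that D by auto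
  have "real (card bad) \<le> (\<Sum>d\<in>D. real (card (collisions d)))"
    unfolding bad_def using card_UN_le[OF finD, of collisions] by (simp flip: of_nat_sum)
  then have bad: "q * real (card bad) \<le> (\<Sum>d\<in>D. q * real (card (collisions d)))"
    using q by (simp flip: sum_distrib_left)
  have "3 * real (card bad) \<le> 2 * \<Omega>"
    using dens
  proof
    assume *: "2 * k \<le> 2 ^ card J"
    have "(\<Sum>d\<in>D. q * real (card (collisions d))) \<le> (\<Sum>d\<in>D. \<Omega>)"
      using card_collisions_le[OF ne] by (intro sum_mono) (simp add: q_def \<Omega>_def mult.commute)
    also have "\<dots> = real (card D) * \<Omega>" by simp
    also have "\<dots> \<le> q / 2 * \<Omega>"
    proof (rule mult_right_mono[OF _ \<Omega>])
      have "2 * card D \<le> 2 ^ card J" using * k by linarith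
      then have "real (2 * card D) \<le> real (2 ^ card J)" by (rule of_nat_mono)
      then show "real (card D) \<le> q / 2" by (simp add: q_def)
    qed
    finally have "q * real (card bad) \<le> q * (\<Omega> / 2)" using bad by (simp add: mult.commute)
    then show ?thesis using q \<Omega> by simp
  next
    assume *: "card K = 1 \<and> 3 * k \<le> 4 * 2 ^ card J"
    \<comment> \<open>Collision probability 1/(2q) for every difference except \<open>d = K\<close>,
      which has 1/q. The total is at most (card D + 1)/(2q), hence at most k/(2q) and so at most
      2/3.\<close>
    have "(\<Sum>d\<in>D. 2 * (q * real (card (collisions d)))) \<le> (\<Sum>d\<in>D. \<Omega> + (if d = K then \<Omega> else 0))"
    proof (rule sum_mono)
      fix d assume d: "d \<in> D"
      show "2 * (q * real (card (collisions d))) \<le> \<Omega> + (if d = K then \<Omega> else 0)"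
      proof (cases "d \<inter> J = {}")
        case True
        obtain \<kappa> where "K = {\<kappa>}" using * by (auto simp: card_1_singleton_iff)
        then have "d = K" using True ne[OF d] d D by auto
        then show ?thesis using card_collisions_le[OF ne[OF d]] by (simp add: q_def \<Omega>_def mult.commute)
      next
        case False
        moreover have "d \<noteq> K" using False KJ by auto
        ultimately show ?thesis using card_collisions_le_half[of d] * by (simp add: q_def \<Omega>_def mult_ac)
      qed
    qed
    also have "\<dots> \<le> real (card D) * \<Omega> + \<Omega>" using finD \<Omega> by (simp add: sum.distrib)
    also have "\<dots> = (real (card D) + 1) * \<Omega>" by (simp add: algebra_simps)
    also have "\<dots> \<le> 4 / 3 * q * \<Omega>"
    proof (rule mult_right_mono[OF _ \<Omega>])
      have "3 * (card D + 1) \<le> 3 * k" using k by simp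
      then have "3 * (card D + 1) \<le> 4 * 2 ^ card J" using conjunct2[OF *] by (rule le_trans)
      then have "real (3 * (card D + 1)) \<le> real (4 * 2 ^ card J)" by (rule of_nat_mono)
      then show "real (card D) + 1 \<le> 4 / 3 * q" by (simp add: q_def)
    qed
    finally have "q * (2 * real (card bad)) \<le> q * (4 / 3 * \<Omega>)"
      using bad by (simp flip: sum_distrib_left)
    then show ?thesis using q by simp
  qed
  moreover have "real (card (Cs \<times> Bs - bad)) = \<Omega> - real (card bad)"
  proof -
    have sub: "bad \<subseteq> Cs \<times> Bs" using collisions_subset by (auto simp: bad_def)
    have "finite (Cs \<times> Bs)" using finite_Cs finite_Bs by simp
    with sub show ?thesis
      using card_mono[OF _ sub] finite_subset[OF sub] by (simp add: card_Diff_subset of_nat_diff \<Omega>_def)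
  qed
  ultimately show ?thesis unfolding \<Omega>_def bad_def by linarith
qed

end

section \<open>Isolating a pair of points\<close>

locale wired_tuples = wires \<tau> K J + tuple_function "Pow (insert \<tau> (K \<union> J))" k g
  for \<tau> :: 'a and K J k g
begin

abbreviation "U \<equiv> insert \<tau> (K \<union> J)"

definition L where "L A C B X = shear B (shear C (shear A X))"
definition Li where "Li A C B X = shear A (shear C (shear B X))"

definition gate where
  "gate A C B \<beta> X = Li A C B (flip \<tau> (\<lambda>Y. Y \<inter> J = \<beta>) (L A C B X))"

lemma finU: "finite U" using finK finJ by simp
lemma finite_sub: "X \<subseteq> U \<Longrightarrow> finite X" using finU by (rule finite_subset[rotated])

lemma A_sub: "A \<in> As \<Longrightarrow> A \<subseteq> (K \<union> J) \<times> {\<tau>}"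
  and C_sub: "C \<in> Cs \<Longrightarrow> C \<subseteq> K \<times> J"
  and B_sub: "B \<in> Bs \<Longrightarrow> B \<subseteq> J \<times> K"
  by (auto simp: As_def Cs_def Bs_def)

lemma bij_A: "A \<in> As \<Longrightarrow> bij_betw (shear A) (Pow U) (Pow U)"
  by (rule bij_betw_shear[OF A_sub]) (use \<tau>K \<tau>J finU in auto)
lemma bij_C: "C \<in> Cs \<Longrightarrow> bij_betw (shear C) (Pow U) (Pow U)"
  by (rule bij_betw_shear[OF C_sub]) (use KJ finU in auto)
lemma bij_B: "B \<in> Bs \<Longrightarrow> bij_betw (shear B) (Pow U) (Pow U)"
  by (rule bij_betw_shear[OF B_sub]) (use KJ finU in auto)

lemma shear_in: 
  "A \<in> As \<Longrightarrow> X \<subseteq> U \<Longrightarrow> shear A X \<subseteq> U"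
  "C \<in> Cs \<Longrightarrow> X \<subseteq> U \<Longrightarrow> shear C X \<subseteq> U"
  "B \<in> Bs \<Longrightarrow> X \<subseteq> U \<Longrightarrow> shear B X \<subseteq> U"
  using bij_betw_apply[OF bij_A, of A X] bij_betw_apply[OF bij_C, of C X]
    bij_betw_apply[OF bij_B, of B X] by simp_all

lemma invol:
  "A \<in> As \<Longrightarrow> X \<subseteq> U \<Longrightarrow> shear A (shear A X) = X"
  "C \<in> Cs \<Longrightarrow> X \<subseteq> U \<Longrightarrow> shear C (shear C X) = X"
  "B \<in> Bs \<Longrightarrow> X \<subseteq> U \<Longrightarrow> shear B (shear B X) = X"
  using shear_shear[OF A_sub, of A X] shear_shear[OF C_sub, of C X] shear_shear[OF B_sub, of B X]
    \<tau>K \<tau>J KJ finite_sub[of X] by (simp_all add: Int_commute)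

context
  fixes A C B assumes A: "A \<in> As" and C: "C \<in> Cs" and B: "B \<in> Bs"
begin

lemma L_in: "X \<subseteq> U \<Longrightarrow> L A C B X \<subseteq> U" and Li_in: "X \<subseteq> U \<Longrightarrow> Li A C B X \<subseteq> U"
  unfolding L_def Li_def using A B C by (intro shear_in; simp)+

lemma Li_L: "X \<subseteq> U \<Longrightarrow> Li A C B (L A C B X) = X"
  unfolding L_def Li_def using A B C by (simp add: shear_in invol)

lemma L_sym_diff:
  assumes "X \<subseteq> U" "Y \<subseteq> U"
  shows "L A C B (sym_diff X Y) = sym_diff (L A C B X) (L A C B Y)"
  unfolding L_def using A B C assms by (simp add: shear_sym_diff shear_in finite_sub)

lemma Li_sym_diff:
  assumes "X \<subseteq> U" "Y \<subseteq> U"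
  shows "Li A C B (sym_diff X Y) = sym_diff (Li A C B X) (Li A C B Y)"
  unfolding Li_def using A B C assms by (simp add: shear_sym_diff shear_in finite_sub)

lemma Li_\<tau>: "Li A C B {\<tau>} = shear A {\<tau>}"
proof -
  have "lin B {\<tau>} = lin B {}" by (rule lin_cong[OF B_sub[OF B]]) (use \<tau>K in auto)
  moreover have "lin C {\<tau>} = lin C {}" by (rule lin_cong[OF C_sub[OF C]]) (use \<tau>J in auto)
  ultimately show ?thesis by (simp add: Li_def shear_def[of B] shear_def[of C])
qed

lemma L_direction: "L A C B (shear A {\<tau>}) = {\<tau>}"
proof -
  have "lin B {\<tau>} = lin B {}" by (rule lin_cong[OF B_sub[OF B]]) (use \<tau>K in auto)
  moreover have "lin C {\<tau>} = lin C {}" by (rule lin_cong[OF C_sub[OF C]]) (use \<tau>J in auto)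
  ultimately show ?thesis using A by (simp add: L_def shear_def[of B] shear_def[of C] invol)
qed

text \<open>\<open>Li\<close> is linear and inverts \<open>L\<close>, so flipping \<tau> in between
  is a translation by \<open>Li A C B {\<tau>}\<close>. Neither B nor C has \<tau> as a control,
  hence only A determines the direction.\<close>

lemma gate_eq:
  assumes "X \<subseteq> U"
  shows "gate A C B \<beta> X = (if L A C B X \<inter> J = \<beta> then sym_diff X (shear A {\<tau>}) else X)"
  using assms by (simp add: gate_def flip_def Li_L Li_sym_diff L_in Li_\<tau>)

end

text \<open>The second conjunct makes gate and transposition agree on the tuple; vacant points of
  the coset may move freely. The first discards pairs of vacant points, whose transposition fixes
  the tuple; otherwise every X in a vacant coset would count and \<open>card_isolating_le_2\<close>
  would fail.\<close>

definition isolating where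
  "isolating A C B xs X \<longleftrightarrow> (X \<in> set xs \<or> sym_diff X (shear A {\<tau>}) \<in> set xs) \<and>
     (\<forall>Y\<in>set xs. L A C B Y \<inter> J = L A C B X \<inter> J \<longrightarrow> Y = X \<or> Y = sym_diff X (shear A {\<tau>}))"

lemma gate_isolating:
  assumes A: "A \<in> As" and C: "C \<in> Cs" and B: "B \<in> Bs" and X: "X \<subseteq> U" and xs: "xs \<in> V"
    and iso: "isolating A C B xs X"
  shows "map (gate A C B (L A C B X \<inter> J)) xs = map (transpose X (sym_diff X (shear A {\<tau>}))) xs"
proof (rule map_cong[OF refl])
  fix Y assume Y: "Y \<in> set xs"
  define v where "v = shear A {\<tau>}"
  have v: "v \<subseteq> U" "v \<noteq> {}" 
    using shear_in(1)[OF A, of "{\<tau>}"] L_direction[OF A C B] by (auto simp: v_def L_def)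
  have YU: "Y \<subseteq> U" using Y xs by (auto simp: Theta_def)
  have "L A C B (sym_diff X v) \<inter> J = L A C B X \<inter> J"
    using L_sym_diff[OF A C B X v(1)] L_direction[OF A C B] \<tau>J by (auto simp: v_def)
  then have "L A C B Y \<inter> J = L A C B X \<inter> J \<longleftrightarrow> Y = X \<or> Y = sym_diff X v"
    using iso Y unfolding isolating_def v_def by auto
  moreover have "sym_diff (sym_diff X v) v = X" "sym_diff X v \<noteq> X" using v by auto
  ultimately show "gate A C B (L A C B X \<inter> J) Y = transpose X (sym_diff X (shear A {\<tau>})) Y"
    unfolding gate_eq[OF A C B YU] v_def[symmetric] transpose_def by auto
qed

text \<open>One isolating X provides an occupied Y of pattern \<beta>, and every isolating X with
  this pattern is Y or its translate.\<close>

lemma card_isolating_le_2: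
  assumes A: "A \<in> As" and C: "C \<in> Cs" and B: "B \<in> Bs"
  shows "card {X \<in> Pow U. isolating A C B xs X \<and> L A C B X \<inter> J = \<beta>} \<le> 2"
proof (cases "{X \<in> Pow U. isolating A C B xs X \<and> L A C B X \<inter> J = \<beta>} = {}")
  case False
  then obtain X where X: "X \<subseteq> U" "isolating A C B xs X" "L A C B X \<inter> J = \<beta>" by blast
  define v where "v = shear A {\<tau>}"
  have v: "v \<subseteq> U" using shear_in(1)[OF A, of "{\<tau>}"] by (auto simp: v_def)
  have "L A C B (sym_diff X v) \<inter> J = L A C B X \<inter> J"
    using L_sym_diff[OF A C B X(1) v] L_direction[OF A C B] \<tau>J by (auto simp: v_def)
  then obtain Y where Y: "Y \<in> set xs" "L A C B Y \<inter> J = \<beta>"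
    using X unfolding isolating_def v_def by metis
  have "X' \<in> {Y, sym_diff Y v}"
    if "isolating A C B xs X'" "L A C B X' \<inter> J = \<beta>" for X'
  proof -
    have "Y = X' \<or> Y = sym_diff X' v" using that Y by (auto simp: isolating_def v_def)
    then show ?thesis by auto
  qed
  then have "card {X \<in> Pow U. isolating A C B xs X \<and> L A C B X \<inter> J = \<beta>} \<le> card {Y, sym_diff Y v}"
    by (intro card_mono) auto
  also have "\<dots> \<le> 2" by (simp add: card_insert_if)
  finally show ?thesis .
next
  case True
  show ?thesis unfolding True by simp
qed

lemma shear_\<tau>:
  shows "shear A {\<tau>} = sym_diff {\<tau>} {l. (l, \<tau>) \<in> A}"
proof -
  have "{c \<in> {\<tau>}. (l, c) \<in> A} = (if (l, \<tau>) \<in> A then {\<tau>} else {})" for l by auto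
  then show ?thesis by (auto simp: shear_def lin_def split: if_splits)
qed

text \<open>\<open>shear A {\<tau>}\<close> consists of \<tau> and an arbitrary set of other wires,
  so A runs exactly once through the differences that contain \<tau>.\<close>

lemma sum_opposite:
  fixes F :: "'a set \<Rightarrow> real"
  assumes X: "X \<subseteq> U"
  shows "(\<Sum>Z\<in>{Z \<in> Pow U. (\<tau> \<in> X) \<noteq> (\<tau> \<in> Z)}. F Z) = (\<Sum>A\<in>As. F (sym_diff X (shear A {\<tau>})))"
  by (rule sum.reindex_bij_witness[where j = "\<lambda>Z. (sym_diff X Z - {\<tau>}) \<times> {\<tau>}"
      and i = "\<lambda>A. sym_diff X (shear A {\<tau>})"])
    (use X \<tau>K \<tau>J in \<open>auto simp: As_def shear_\<tau> intro!: arg_cong[where f = F]\<close>)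

lemma card_isolating_ge:
  assumes A: "A \<in> As" and X: "X \<subseteq> U" and xs: "xs \<in> V"
    and occ: "X \<in> set xs \<or> sym_diff X (shear A {\<tau>}) \<in> set xs"
    and dens: "2 * k \<le> 2 ^ card J \<or> card K = 1 \<and> 3 * k \<le> 4 * 2 ^ card J"
  shows "real (card (Cs \<times> Bs)) \<le> 3 * real (card {(C, B) \<in> Cs \<times> Bs. isolating A C B xs X})"
proof -
  define Z where "Z = sym_diff X (shear A {\<tau>})"
  \<comment> \<open>The hash does not see \<tau>, so that coordinate is dropped; what remains is
    zero only for Y equal to X or Z.\<close>
  define D where "D = (\<lambda>Y. shear A (sym_diff Y X) \<inter> (K \<union> J)) ` (set xs - {X, Z})"
  have xsU: "Y \<subseteq> U" if "Y \<in> set xs" for Y using that xs by (auto simp: Theta_def)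
  have "card D \<le> card (set xs - {X, Z})" unfolding D_def by (rule card_image_le) simp
  \<comment> \<open>One of X and Z is occupied, which leaves at most k - 1 differences. The dense
    case of \<open>card_no_collision\<close> relies on the strict inequality.\<close>
  also have "\<dots> < card (set xs)" using occ by (intro psubset_card_mono) (auto simp: Z_def)
  also have "\<dots> = k" using xs by (simp add: Theta_def distinct_card)
  finally have k: "card D < k" .
  have "{} \<notin> D"
  proof
    assume "{} \<in> D"
    then obtain Y where Y: "Y \<in> set xs" "Y \<noteq> X" "Y \<noteq> Z" "shear A (sym_diff Y X) \<inter> (K \<union> J) = {}"
      by (auto simp: D_def)
    have sub: "sym_diff Y X \<subseteq> U" using xsU[OF Y(1)] X by auto
    have "shear A (sym_diff Y X) \<subseteq> {\<tau>}" using shear_in(1)[OF A sub] Y(4) by auto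
    then have "shear A (sym_diff Y X) = {} \<or> shear A (sym_diff Y X) = {\<tau>}" by auto
    then have "sym_diff Y X = {} \<or> sym_diff Y X = shear A {\<tau>}"
      using invol(1)[OF A sub] by force
    then show False using Y(2,3) unfolding Z_def by blast
  qed
  then have D: "D \<subseteq> Pow (K \<union> J) - {{}}" by (auto simp: D_def)
  have "Cs \<times> Bs - (\<Union>d\<in>D. collisions d) \<subseteq> {(C, B) \<in> Cs \<times> Bs. isolating A C B xs X}"
  proof safe
    fix C B assume C: "C \<in> Cs" and B: "B \<in> Bs" and no: "(C, B) \<notin> (\<Union>d\<in>D. collisions d)"
    show "isolating A C B xs X"
      unfolding isolating_def
    proof (intro conjI occ ballI impI, rule ccontr)
      fix Y assume Y: "Y \<in> set xs" "L A C B Y \<inter> J = L A C B X \<inter> J"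
        and ne: "\<not> (Y = X \<or> Y = sym_diff X (shear A {\<tau>}))"
      define W where "W = shear A (sym_diff Y X)"
      have "L A C B (sym_diff Y X) \<inter> J = {}"
        using L_sym_diff[OF A C B xsU[OF Y(1)] X] Y(2) by auto
      then have "shear B (shear C W) \<inter> J = {}" by (simp add: L_def W_def)
      then have "shear B (shear C (W \<inter> (K \<union> J))) \<inter> J = {}"
        unfolding hash_empty_iff[OF C B] by (simp add: Int_assoc Int_absorb1)
      moreover have "W \<inter> (K \<union> J) \<in> D" using Y(1) ne by (auto simp: D_def W_def Z_def)
      ultimately show False using no C B by (auto simp: collisions_def)
    qed
  qed
  then have "card (Cs \<times> Bs - (\<Union>d\<in>D. collisions d)) \<le> card {(C, B) \<in> Cs \<times> Bs. isolating A C B xs X}"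
  proof (rule card_mono[rotated])
    have "finite (Cs \<times> Bs)" using finite_Cs finite_Bs by simp
    then show "finite {(C, B) \<in> Cs \<times> Bs. isolating A C B xs X}" by (rule rev_finite_subset) auto
  qed
  with card_no_collision[OF D k dens] show ?thesis by linarith
qed

text \<open>Double counting at each state. A transposition is charged to its isolating pairs (C, B),
  at least a third of all, together with the single pattern \<beta> of X; a gate is charged at most
  twice. Hence 6 = 3 * 2.\<close>

lemma sum_opposite_transpositions_le:
  assumes dens: "2 * k \<le> 2 ^ card J \<or> card K = 1 \<and> 3 * k \<le> 4 * 2 ^ card J"
  shows "real (card (Cs \<times> Bs)) *
      (\<Sum>X\<in>Pow U. \<Sum>Z\<in>{Z \<in> Pow U. (\<tau> \<in> X) \<noteq> (\<tau> \<in> Z)}. en (transpose X Z))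
    \<le> 6 * (\<Sum>A\<in>As. \<Sum>(C, B, \<beta>)\<in>Cs \<times> Bs \<times> Pow J. en (gate A C B \<beta>))"
proof -
  define \<Omega> where "\<Omega> = real (card (Cs \<times> Bs))"
  define W where "W = Cs \<times> Bs \<times> Pow J"
  define d where "d = (\<lambda>X A xs. (g xs - g (map (transpose X (sym_diff X (shear A {\<tau>}))) xs))\<^sup>2)"
  define F where "F = (\<lambda>A. \<lambda>(C, B, \<beta>). \<lambda>xs. (g xs - g (map (gate A C B \<beta>) xs))\<^sup>2)"
  define I where "I = (\<lambda>X A xs. \<lambda>(C, B, \<beta>). isolating A C B xs X \<and> L A C B X \<inter> J = \<beta>)"
  have F0: "F A w xs \<ge> 0" for A w xs by (simp add: F_def case_prod_unfold)
  have finW: "finite W" using finite_Cs finite_Bs finJ by (simp add: W_def)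
  have point: "\<Omega> * d X A xs \<le> 3 * (\<Sum>w\<in>W. if I X A xs w then F A w xs else 0)"
    if X: "X \<subseteq> U" and A: "A \<in> As" and xs: "xs \<in> V" for X A xs
  proof (cases "X \<in> set xs \<or> sym_diff X (shear A {\<tau>}) \<in> set xs")
    case False
    then have "map (transpose X (sym_diff X (shear A {\<tau>}))) xs = xs"
      by (intro map_idI transpose_apply_other) auto
    then have "d X A xs = 0" by (simp add: d_def)
    then show ?thesis using F0 by (auto intro!: sum_nonneg)
  next
    case True
    have inner: "(\<Sum>\<beta>\<in>Pow J. if I X A xs (C, B, \<beta>) then F A (C, B, \<beta>) xs else 0)
        = (if isolating A C B xs X then d X A xs else 0)" if "C \<in> Cs" "B \<in> Bs" for C B
    proof (cases "isolating A C B xs X")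
      case iso: True
      have "(\<Sum>\<beta>\<in>Pow J. if I X A xs (C, B, \<beta>) then F A (C, B, \<beta>) xs else 0)
          = (\<Sum>\<beta>\<in>Pow J. if L A C B X \<inter> J = \<beta> then F A (C, B, \<beta>) xs else 0)"
        using iso by (simp add: I_def)
      also have "\<dots> = F A (C, B, L A C B X \<inter> J) xs" using finJ by (simp add: sum.delta)
      also have "\<dots> = d X A xs"
        by (simp only: F_def d_def prod.case gate_isolating[OF A that X xs iso])
      finally show ?thesis using iso by simp
    qed (simp add: I_def)
    have "\<Omega> * d X A xs \<le> 3 * real (card {(C, B) \<in> Cs \<times> Bs. isolating A C B xs X}) * d X A xs"
      unfolding \<Omega>_def by (intro mult_right_mono card_isolating_ge A X xs True dens) (simp add: d_def)
    also have "\<dots> = 3 * (\<Sum>p\<in>{p \<in> Cs \<times> Bs. isolating A (fst p) (snd p) xs X}. d X A xs)"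
      by (simp add: case_prod_unfold mem_Times_iff)
    also have "\<dots> = 3 * (\<Sum>p\<in>Cs \<times> Bs. if isolating A (fst p) (snd p) xs X then d X A xs else 0)"
      using finite_Cs finite_Bs by (simp add: sum.inter_filter del: sum_constant)
    also have "\<dots> = 3 * (\<Sum>C\<in>Cs. \<Sum>B\<in>Bs. if isolating A C B xs X then d X A xs else 0)"
      by (simp add: sum.cartesian_product case_prod_unfold)
    also have "\<dots> = 3 * (\<Sum>C\<in>Cs. \<Sum>B\<in>Bs. \<Sum>\<beta>\<in>Pow J. if I X A xs (C, B, \<beta>) then F A (C, B, \<beta>) xs else 0)"
      by (simp add: inner)
    also have "\<dots> = 3 * (\<Sum>w\<in>W. if I X A xs w then F A w xs else 0)"
      unfolding W_def by (simp add: sum.cartesian_product case_prod_unfold cong: if_cong)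
    finally show ?thesis .
  qed
  have "\<Omega> * (\<Sum>X\<in>Pow U. \<Sum>Z\<in>{Z \<in> Pow U. (\<tau> \<in> X) \<noteq> (\<tau> \<in> Z)}. en (transpose X Z))
      = (\<Sum>X\<in>Pow U. \<Sum>A\<in>As. \<Sum>xs\<in>V. \<Omega> * d X A xs)"
    unfolding sum_distrib_left[symmetric] d_def energy_def[symmetric]
    by (intro arg_cong[where f = "(*) \<Omega>"] sum.cong refl sum_opposite) simp
  also have "\<dots> \<le> (\<Sum>X\<in>Pow U. \<Sum>A\<in>As. \<Sum>xs\<in>V. 3 * (\<Sum>w\<in>W. if I X A xs w then F A w xs else 0))"
    by (intro sum_mono point) auto
  also have "\<dots> = 3 * (\<Sum>X\<in>Pow U. \<Sum>A\<in>As. \<Sum>xs\<in>V. \<Sum>w\<in>W. if I X A xs w then F A w xs else 0)"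
    by (simp only: sum_distrib_left)
  also have "(\<Sum>X\<in>Pow U. \<Sum>A\<in>As. \<Sum>xs\<in>V. \<Sum>w\<in>W. if I X A xs w then F A w xs else 0) =
      (\<Sum>A\<in>As. \<Sum>w\<in>W. \<Sum>xs\<in>V. \<Sum>X\<in>Pow U. if I X A xs w then F A w xs else 0)"
  proof (subst sum.swap, rule sum.cong[OF refl])
    fix A
    have "(\<Sum>X\<in>Pow U. \<Sum>xs\<in>V. \<Sum>w\<in>W. if I X A xs w then F A w xs else 0)
        = (\<Sum>X\<in>Pow U. \<Sum>w\<in>W. \<Sum>xs\<in>V. if I X A xs w then F A w xs else 0)"
      by (rule sum.cong[OF refl], rule sum.swap)
    also have "\<dots> = (\<Sum>w\<in>W. \<Sum>X\<in>Pow U. \<Sum>xs\<in>V. if I X A xs w then F A w xs else 0)"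
      by (rule sum.swap)
    also have "\<dots> = (\<Sum>w\<in>W. \<Sum>xs\<in>V. \<Sum>X\<in>Pow U. if I X A xs w then F A w xs else 0)"
      by (rule sum.cong[OF refl], rule sum.swap)
    finally show "(\<Sum>X\<in>Pow U. \<Sum>xs\<in>V. \<Sum>w\<in>W. if I X A xs w then F A w xs else 0)
        = (\<Sum>w\<in>W. \<Sum>xs\<in>V. \<Sum>X\<in>Pow U. if I X A xs w then F A w xs else 0)" .
  qed
  also have "3 * \<dots> \<le> 3 * (\<Sum>A\<in>As. \<Sum>w\<in>W. \<Sum>xs\<in>V. 2 * F A w xs)"
  proof (intro mult_left_mono sum_mono)
    fix A w xs assume A: "A \<in> As" and w: "w \<in> W"
    obtain C B \<beta> where w_eq: "w = (C, B, \<beta>)" by (cases w) auto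
    have CB: "C \<in> Cs" "B \<in> Bs" using w by (auto simp: w_eq W_def)
    have "(\<Sum>X\<in>Pow U. if I X A xs w then F A w xs else 0) =
        real (card {X \<in> Pow U. I X A xs w}) * F A w xs"
      using fin by (simp add: sum.inter_filter[symmetric])
    also have "\<dots> \<le> real 2 * F A w xs"
      by (intro mult_right_mono F0 of_nat_mono)
         (use card_isolating_le_2[OF A CB] in \<open>simp add: I_def w_eq\<close>)
    finally show "(\<Sum>X\<in>Pow U. if I X A xs w then F A w xs else 0) \<le> 2 * F A w xs" by simp
  qed simp
  also have "\<dots> = 6 * (\<Sum>A\<in>As. \<Sum>w\<in>W. \<Sum>xs\<in>V. F A w xs)"
    by (simp flip: sum_distrib_left)
  also have "(\<Sum>A\<in>As. \<Sum>w\<in>W. \<Sum>xs\<in>V. F A w xs) = (\<Sum>A\<in>As. \<Sum>(C, B, \<beta>)\<in>W. en (gate A C B \<beta>))"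
    by (intro sum.cong refl) (auto simp: F_def energy_def)
  finally show ?thesis by (simp add: \<Omega>_def W_def)
qed

end

section \<open>Averages over relabellings of the wires\<close>

lemma ex_permutes_map:
  assumes U: "finite U" and ps: "ps \<in> Theta r U" and qs: "qs \<in> Theta r U"
  shows "\<exists>\<rho>. \<rho> permutes U \<and> map \<rho> qs = ps"
proof -
  have len: "length ps = r" "length qs = r" and dist: "distinct ps" "distinct qs"
    and sub: "set ps \<subseteq> U" "set qs \<subseteq> U" using ps qs by (auto simp: Theta_def)
  define f where "f = (\<lambda>x. the (map_of (zip qs ps) x))"
  have f_nth: "f (qs ! i) = ps ! i" if "i < r" for i
    using map_of_zip_nth[of qs ps i] len dist that by (simp add: f_def)
  have f_map: "map f qs = ps" by (rule nth_equalityI) (use len f_nth in auto)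
  have f_bij: "bij_betw f (set qs) (set ps)"
    using dist f_map by (metis bij_betw_def distinct_map set_map)
  have "card (U - set qs) = card (U - set ps)"
    using U sub dist len by (simp add: card_Diff_subset distinct_card)
  then obtain h where h: "bij_betw h (U - set qs) (U - set ps)"
    using finite_same_card_bij[of "U - set qs" "U - set ps"] U by blast
  define \<rho> where "\<rho> = (\<lambda>x. if x \<in> set qs then f x else if x \<in> U then h x else x)"
  have "bij_betw \<rho> (set qs \<union> (U - set qs)) (set ps \<union> (U - set ps))"
  proof (rule bij_betw_combine)
    show "bij_betw \<rho> (set qs) (set ps)"
      using f_bij by (subst bij_betw_cong[where g = f]) (auto simp: \<rho>_def)
    show "bij_betw \<rho> (U - set qs) (U - set ps)"
      using h by (subst bij_betw_cong[where g = h]) (auto simp: \<rho>_def)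
  qed auto
  then have "bij_betw \<rho> U U" using sub by (simp add: Un_absorb1)
  then have "\<rho> permutes U" by (rule bij_imp_permutes) (use sub in \<open>auto simp: \<rho>_def\<close>)
  moreover have "map \<rho> qs = ps" unfolding f_map[symmetric] by (auto simp: \<rho>_def)
  ultimately show ?thesis by blast
qed

text \<open>Permutations act transitively on injective tuples. By right translation the sum over
  \<omega> is the same for all tuples, so it may be averaged over them, and there each \<omega> only
  rearranges the terms.\<close>

lemma sum_permutes_map:
  fixes F :: "'a list \<Rightarrow> real"
  assumes U: "finite U" and ps: "ps \<in> Theta r U"
  shows "real (card (Theta r U)) * (\<Sum>\<omega>\<in>{\<omega>. \<omega> permutes U}. F (map \<omega> ps))
    = real (card {\<omega>. \<omega> permutes U}) * (\<Sum>qs\<in>Theta r U. F qs)"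
proof -
  define W where "W = {\<omega>. \<omega> permutes U}"
  have same: "(\<Sum>\<omega>\<in>W. F (map \<omega> qs)) = (\<Sum>\<omega>\<in>W. F (map \<omega> ps))" if qs: "qs \<in> Theta r U" for qs
  proof -
    obtain \<rho> where \<rho>: "\<rho> permutes U" "map \<rho> ps = qs" using ex_permutes_map[OF U qs ps] by blast
    have "(\<Sum>\<omega>\<in>W. F (map \<omega> qs)) = (\<Sum>\<omega>\<in>W. F (map (\<omega> \<circ> \<rho>) ps))" by (simp flip: \<rho>(2))
    also have "\<dots> = (\<Sum>\<omega>\<in>W. F (map \<omega> ps))" unfolding W_def
      by (rule sum_permutations_compose_right[OF \<rho>(1), symmetric])
    finally show ?thesis .
  qed
  have "real (card (Theta r U)) * (\<Sum>\<omega>\<in>W. F (map \<omega> ps)) = (\<Sum>qs\<in>Theta r U. \<Sum>\<omega>\<in>W. F (map \<omega> qs))"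
    by (simp add: same)
  also have "\<dots> = (\<Sum>\<omega>\<in>W. \<Sum>qs\<in>Theta r U. F (map \<omega> qs))" by (rule sum.swap)
  also have "\<dots> = (\<Sum>\<omega>\<in>W. \<Sum>qs\<in>Theta r U. F qs)"
    by (rule sum.cong[OF refl], rule sum.reindex_bij_betw, rule bij_betw_map_Theta)
       (simp add: W_def permutes_imp_bij)
  finally show ?thesis by (simp add: W_def)
qed

lemma sum_Theta_1: "finite U \<Longrightarrow> (\<Sum>ps\<in>Theta (Suc 0) U. F ps) = (\<Sum>i\<in>U. F [i])"
  using sum_Theta_Suc[of U F 0] by (simp add: Theta_0)

lemma sum_Theta_2: "finite U \<Longrightarrow> (\<Sum>ps\<in>Theta 2 U. F ps) = (\<Sum>i\<in>U. \<Sum>j\<in>U - {i}. F [i, j])"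
  using sum_Theta_Suc[of U F "Suc 0"] by (simp add: sum_Theta_1 numeral_2_eq_2[symmetric])

lemma sum_Theta_3:
  "finite U \<Longrightarrow> (\<Sum>ps\<in>Theta 3 U. F ps) = (\<Sum>i\<in>U. \<Sum>j\<in>U - {i}. \<Sum>l\<in>U - {i} - {j}. F [i, j, l])"
  using sum_Theta_Suc[of U F 2] by (simp add: sum_Theta_2 numeral_3_eq_3[symmetric])

lemma card_Theta_small:
  assumes "finite U"
  shows "real (card (Theta (Suc 0) U)) = real (card U)"
    "card U \<ge> 1 \<Longrightarrow> real (card (Theta 2 U)) = real (card U) * (real (card U) - 1)"
    "card U \<ge> 2 \<Longrightarrow> real (card (Theta 3 U)) = real (card U) * (real (card U) - 1) * (real (card U) - 2)"
  using sum_Theta_1[OF assms, of "\<lambda>_. 1 :: real"] sum_Theta_2[OF assms, of "\<lambda>_. 1 :: real"]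
    sum_Theta_3[OF assms, of "\<lambda>_. 1 :: real"] assms
  by (simp_all add: of_nat_diff)

section \<open>Multiply controlled gates from three-wire gates\<close>

lemma bij_betw_flip_wires:
  assumes "t \<in> U" "C \<subseteq> U - {t}" "\<And>X. p X = p (X \<inter> C)"
  shows "bij_betw (flip t p) (Pow U) (Pow U)"
proof (rule bij_betw_flip[OF assms(1)])
  fix X
  have "sym_diff X {t} \<inter> C = X \<inter> C" using assms(2) by auto
  then show "p (sym_diff X {t}) = p X" using assms(3) by metis
qed

definition cnot :: "nat \<Rightarrow> nat \<Rightarrow> bool \<Rightarrow> nat set \<Rightarrow> nat set" where
  "cnot i j a = flip i (\<lambda>X. (j \<in> X) = a)"

definition toffoli :: "nat \<Rightarrow> nat \<Rightarrow> nat \<Rightarrow> bool \<Rightarrow> bool \<Rightarrow> nat set \<Rightarrow> nat set" where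
  "toffoli i j l a b = flip i (\<lambda>X. (j \<in> X) = a \<and> (l \<in> X) = b)"

text \<open>\<open>Tot\<close> abstracts the total energy of the generators. The 2 in
  \<open>toffoli_sum\<close> arises because the controls j and l are summed in both orders.\<close>

locale gate_energy = tuple_function "Pow {..<n}" k g for n k :: nat and g +
  fixes Tot :: real
  assumes n2: "n \<ge> 2" and Tot0: "Tot \<ge> 0"
    and toffoli_sum: "\<And>a b. (\<Sum>i<n. \<Sum>j\<in>{..<n} - {i}. \<Sum>l\<in>{..<n} - {i} - {j}.
          en (toffoli i j l a b)) \<le> 2 * Tot"
    and cnot_le: "\<And>i j a. i < n \<Longrightarrow> j < n \<Longrightarrow> i \<noteq> j \<Longrightarrow> en (cnot i j a) \<le> Tot"
begin

abbreviation "W \<equiv> {\<omega>. \<omega> permutes {..<n}}"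

text \<open>A common bound for the displacement of one NOT, CNOT or Toffoli gate on random wires.
  The constant 192 is the one that NOT requires in \<open>disp_not\<close>.\<close>

definition \<delta> where "\<delta> = sqrt (real (card W) * 192 * Tot / real n ^ 3)"

lemma finW: "finite W" by (simp add: finite_permutations)

section \<open>Mean energies of elementary gates on random wires\<close>

lemma bij_cnot: "i < n \<Longrightarrow> j < n \<Longrightarrow> i \<noteq> j \<Longrightarrow> bij_betw (cnot i j a) (Pow {..<n}) (Pow {..<n})"
  unfolding cnot_def by (rule bij_betw_flip_wires[where C = "{j}"]) auto

lemma bij_toffoli:
  "i < n \<Longrightarrow> j < n \<Longrightarrow> l < n \<Longrightarrow> i \<noteq> j \<Longrightarrow> i \<noteq> l \<Longrightarrow>
   bij_betw (toffoli i j l a b) (Pow {..<n}) (Pow {..<n})"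
  unfolding toffoli_def by (rule bij_betw_flip_wires[where C = "{j, l}"]) auto

text \<open>Among about $n^3$ generators there are only $n^2$ CNOTs; splitting each CNOT into two Toffoli
  gates, in all ways over the third wire, recovers the missing factor $n$.\<close>
lemma cnot_sum: "(\<Sum>i<n. \<Sum>j\<in>{..<n} - {i}. en (cnot i j a)) \<le> 24 * Tot / real n"
proof (cases "n = 2")
  case True
  \<comment> \<open>With two wires there is no third one to split over, and the trivial bound on the
    two ordered pairs suffices.\<close>
  have "(\<Sum>i<n. \<Sum>j\<in>{..<n} - {i}. en (cnot i j a)) \<le> (\<Sum>i<n. \<Sum>j\<in>{..<n} - {i}. Tot)"
    by (intro sum_mono cnot_le) auto
  also have "\<dots> = 2 * Tot" using True by simp
  finally show ?thesis using True Tot0 by simp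
next
  case False
  then have n3: "n \<ge> 3" using n2 by simp
  have split: "en (cnot i j a) \<le> 2 * (en (toffoli i j l a True) + en (toffoli i j l a False))"
    if "i < n" "j < n" "l < n" "i \<noteq> j" "i \<noteq> l" for i j l
  proof -
    have "cnot i j a X = toffoli i j l a True (toffoli i j l a False X)" for X
      using that by (auto simp: cnot_def toffoli_def flip_def)
    then have "en (cnot i j a) = en (\<lambda>X. toffoli i j l a True (toffoli i j l a False X))"
      by (intro en_cong)
    also have "\<dots> \<le> 2 * (en (toffoli i j l a True) + en (toffoli i j l a False))"
      by (rule en_comp2[OF bij_toffoli]) (use that in auto)
    finally show ?thesis .
  qed
  have "(real n - 2) * (\<Sum>i<n. \<Sum>j\<in>{..<n} - {i}. en (cnot i j a))
      = (\<Sum>i<n. \<Sum>j\<in>{..<n} - {i}. \<Sum>l\<in>{..<n} - {i} - {j}. en (cnot i j a))"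
    using n3 by (simp add: sum_distrib_left of_nat_diff)
  also have "\<dots> \<le> (\<Sum>i<n. \<Sum>j\<in>{..<n} - {i}. \<Sum>l\<in>{..<n} - {i} - {j}.
      2 * (en (toffoli i j l a True) + en (toffoli i j l a False)))"
    by (intro sum_mono split) auto
  also have "\<dots> \<le> 8 * Tot"
    using toffoli_sum[of a True] toffoli_sum[of a False]
    by (simp add: sum.distrib flip: sum_distrib_left)
  finally have "(\<Sum>i<n. \<Sum>j\<in>{..<n} - {i}. en (cnot i j a)) \<le> 8 * Tot / (real n - 2)"
    using n3 by (simp add: field_simps)
  also have "\<dots> = 3 * (8 * Tot) / (3 * (real n - 2))"
    by (rule mult_divide_mult_cancel_left[symmetric]) simp
  also have "\<dots> = 24 * Tot / (3 * (real n - 2))" by simp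
  also have "\<dots> \<le> 24 * Tot / real n" using n3 Tot0 by (intro divide_left_mono) auto
  finally show ?thesis .
qed

text \<open>NOT is the product of the CNOTs that fire on either value of a control; averaging over
  the control gains another factor of order n.\<close>

lemma not_sum: "(\<Sum>i<n. en (flip i (\<lambda>_. True))) \<le> 96 * Tot / (real n * (real n - 1))"
proof -
  have split: "en (flip i (\<lambda>_. True)) \<le> 2 * (en (cnot i j True) + en (cnot i j False))"
    if "i < n" "j < n" "i \<noteq> j" for i j
  proof -
    have "flip i (\<lambda>_. True) X = cnot i j True (cnot i j False X)" for X
      using that by (auto simp: cnot_def flip_def)
    then have "en (flip i (\<lambda>_. True)) = en (\<lambda>X. cnot i j True (cnot i j False X))"
      by (intro en_cong)
    also have "\<dots> \<le> 2 * (en (cnot i j True) + en (cnot i j False))"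
      by (rule en_comp2[OF bij_cnot]) (use that in auto)
    finally show ?thesis .
  qed
  have "(real n - 1) * (\<Sum>i<n. en (flip i (\<lambda>_. True)))
      = (\<Sum>i<n. \<Sum>j\<in>{..<n} - {i}. en (flip i (\<lambda>_. True)))"
    using n2 by (simp add: sum_distrib_left of_nat_diff)
  also have "\<dots> \<le> (\<Sum>i<n. \<Sum>j\<in>{..<n} - {i}. 2 * (en (cnot i j True) + en (cnot i j False)))"
    by (intro sum_mono split) auto
  also have "\<dots> \<le> 96 * Tot / real n"
    using cnot_sum[of True] cnot_sum[of False]
    by (simp add: sum.distrib flip: sum_distrib_left)
  finally show ?thesis using n2 by (simp add: field_simps)
qed

lemma disp_leI:
  assumes "(\<Sum>\<omega>\<in>W. en (s \<omega>)) \<le> real (card W) * (x * Tot)" "x \<le> 192 / real n ^ 3"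
  shows "disp W s \<le> \<delta>"
proof -
  have "real (card W) * (x * Tot) \<le> real (card W) * (192 / real n ^ 3 * Tot)"
    using assms(2) Tot0 by (intro mult_left_mono mult_right_mono) auto
  with assms(1) have "(\<Sum>\<omega>\<in>W. en (s \<omega>)) \<le> real (card W) * 192 * Tot / real n ^ 3" by simp
  then show ?thesis unfolding disp_def \<delta>_def by simp
qed

lemma disp_not:
  assumes "t < n"
  shows "disp W (\<lambda>\<omega>. flip (\<omega> t) (\<lambda>_. True)) \<le> \<delta>"
proof (rule disp_leI)
  have t: "[t] \<in> Theta (Suc 0) {..<n}" using assms by (simp add: Theta_def)
  have "real n * (\<Sum>\<omega>\<in>W. en (flip (\<omega> t) (\<lambda>_. True))) = real (card W) * (\<Sum>i<n. en (flip i (\<lambda>_. True)))"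
    using sum_permutes_map[OF _ t, of "\<lambda>ps. en (flip (ps ! 0) (\<lambda>_. True))"]
    by (simp add: card_Theta_small sum_Theta_1)
  also have "\<dots> \<le> real (card W) * (96 * Tot / (real n * (real n - 1)))"
    by (intro mult_left_mono not_sum) auto
  finally show "(\<Sum>\<omega>\<in>W. en (flip (\<omega> t) (\<lambda>_. True)))
      \<le> real (card W) * (96 / (real n * (real n * (real n - 1))) * Tot)"
    using n2 by (simp add: field_simps)
  have "real n * (real n * (real n - 1)) \<ge> real n * (real n * (real n / 2))"
    using n2 by (intro mult_left_mono) auto
  then have "96 / (real n * (real n * (real n - 1))) \<le> 96 / (real n * (real n * (real n / 2)))"
    using n2 by (intro divide_left_mono) auto
  then show "96 / (real n * (real n * (real n - 1))) \<le> 192 / real n ^ 3"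
    by (simp add: power3_eq_cube)
qed

lemma disp_cnot:
  assumes "i < n" "j < n" "i \<noteq> j"
  shows "disp W (\<lambda>\<omega>. cnot (\<omega> i) (\<omega> j) a) \<le> \<delta>"
proof (rule disp_leI)
  have t: "[i, j] \<in> Theta 2 {..<n}" using assms by (simp add: Theta_def)
  have "real n * (real n - 1) * (\<Sum>\<omega>\<in>W. en (cnot (\<omega> i) (\<omega> j) a))
      = real (card W) * (\<Sum>i<n. \<Sum>j\<in>{..<n} - {i}. en (cnot i j a))"
    using sum_permutes_map[OF _ t, of "\<lambda>ps. en (cnot (ps ! 0) (ps ! 1) a)"] n2
    by (simp add: card_Theta_small sum_Theta_2)
  also have "\<dots> \<le> real (card W) * (24 * Tot / real n)"
    by (intro mult_left_mono cnot_sum) auto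
  finally show "(\<Sum>\<omega>\<in>W. en (cnot (\<omega> i) (\<omega> j) a))
      \<le> real (card W) * (24 / (real n * (real n * (real n - 1))) * Tot)"
    using n2 by (simp add: field_simps)
  have "real n * (real n * (real n - 1)) \<ge> real n * (real n * (real n / 2))"
    using n2 by (intro mult_left_mono) auto
  then have "24 / (real n * (real n * (real n - 1))) \<le> 24 / (real n * (real n * (real n / 2)))"
    using n2 by (intro divide_left_mono) auto
  also have "\<dots> \<le> 192 / real n ^ 3"
    by (simp add: power3_eq_cube mult.assoc divide_right_mono)
  finally show "24 / (real n * (real n * (real n - 1))) \<le> 192 / real n ^ 3" .
qed

lemma disp_toffoli:
  assumes "i < n" "j < n" "l < n" "i \<noteq> j" "i \<noteq> l" "j \<noteq> l"
  shows "disp W (\<lambda>\<omega>. toffoli (\<omega> i) (\<omega> j) (\<omega> l) a b) \<le> \<delta>"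
proof (rule disp_leI)
  have t: "[i, j, l] \<in> Theta 3 {..<n}" using assms by (simp add: Theta_def)
  have n3: "n \<ge> 3" using assms by linarith
  define N where "N = real n * (real n - 1) * (real n - 2)"
  have N: "N > 0" using n3 by (simp add: N_def)
  have "N * (\<Sum>\<omega>\<in>W. en (toffoli (\<omega> i) (\<omega> j) (\<omega> l) a b))
      = real (card W) * (\<Sum>i<n. \<Sum>j\<in>{..<n} - {i}. \<Sum>l\<in>{..<n} - {i} - {j}. en (toffoli i j l a b))"
    using sum_permutes_map[OF _ t, of "\<lambda>ps. en (toffoli (ps ! 0) (ps ! 1) (ps ! 2) a b)"] n2
    by (simp add: card_Theta_small sum_Theta_3 N_def)
  also have "\<dots> \<le> real (card W) * (2 * Tot)"
    by (intro mult_left_mono toffoli_sum) auto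
  finally show "(\<Sum>\<omega>\<in>W. en (toffoli (\<omega> i) (\<omega> j) (\<omega> l) a b)) \<le> real (card W) * (2 / N * Tot)"
    using N by (simp add: field_simps)
  have "N \<ge> real n * (real n / 2) * (real n / 3)"
    unfolding N_def using n3 by (intro mult_mono) auto
  then have "2 / N \<le> 2 / (real n * (real n / 2) * (real n / 3))"
    using n3 by (intro divide_left_mono mult_pos_pos N) auto
  also have "\<dots> \<le> 192 / real n ^ 3"
    by (simp add: power3_eq_cube mult.assoc divide_right_mono)
  finally show "2 / N \<le> 192 / real n ^ 3" .
qed

section \<open>Ladders with borrowed wires\<close>

definition lit :: "(nat \<Rightarrow> nat) \<Rightarrow> (nat \<Rightarrow> bool) \<Rightarrow> nat \<Rightarrow> nat set \<Rightarrow> bool" where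
  "lit \<omega> b c X \<longleftrightarrow> (\<omega> c \<in> X) = b c"

definition lits :: "(nat \<Rightarrow> nat) \<Rightarrow> (nat \<Rightarrow> bool) \<Rightarrow> (nat \<Rightarrow> nat) \<Rightarrow> nat \<Rightarrow> nat set \<Rightarrow> bool" where
  "lits \<omega> b \<gamma> s X \<longleftrightarrow> (\<forall>u\<in>{1..s}. lit \<omega> b (\<gamma> u) X)"

lemma lits_Suc: "lits \<omega> b \<gamma> (Suc s) X \<longleftrightarrow> lit \<omega> b (\<gamma> (Suc s)) X \<and> lits \<omega> b \<gamma> s X"
proof -
  have "{1..Suc s} = insert (Suc s) {1..s}" by auto
  then show ?thesis by (simp add: lits_def)
qed

text \<open>The ladder with controls \<open>\<gamma> 1, \<dots>, \<gamma> j\<close> on the wires \<open>\<alpha> 1, \<dots>, \<alpha> j\<close>: every wire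
  \<open>\<alpha> s\<close> is flipped by the conjunction of the first \<open>s\<close> literals. All wires below \<open>\<alpha> j\<close> are
  borrowed; they are restored by running the shorter ladder afterwards.\<close>
definition ladder ::
    "(nat \<Rightarrow> bool) \<Rightarrow> (nat \<Rightarrow> nat) \<Rightarrow> (nat \<Rightarrow> nat) \<Rightarrow> nat \<Rightarrow> (nat \<Rightarrow> nat) \<Rightarrow> nat set \<Rightarrow> nat set" where
  "ladder b \<alpha> \<gamma> j \<omega> X =
     {l. (l \<in> X) \<noteq> (\<exists>s\<in>{1..j}. l = \<omega> (\<alpha> s) \<and> lits \<omega> b \<gamma> s X)}"

lemma ladder_0: "ladder b \<alpha> \<gamma> 0 \<omega> X = X"
  by (simp add: ladder_def)

lemma ladder_1: "ladder b \<alpha> \<gamma> (Suc 0) \<omega> X = cnot (\<omega> (\<alpha> 1)) (\<omega> (\<gamma> 1)) (b (\<gamma> 1)) X"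
  by (auto simp: ladder_def cnot_def flip_def lits_def lit_def)

context
  fixes \<omega> \<alpha> \<gamma> :: "nat \<Rightarrow> nat" and p :: nat
  assumes \<omega>: "\<omega> permutes {..<n}" and \<alpha>_inj: "inj_on \<alpha> {1..p}"
    and \<alpha>_n: "\<alpha> ` {1..p} \<subseteq> {..<n}" and \<gamma>_n: "\<gamma> ` {1..p} \<subseteq> {..<n}"
    and disj: "\<alpha> ` {1..p} \<inter> \<gamma> ` {1..p} = {}"
begin

lemma \<omega>_eq: "\<omega> x = \<omega> y \<longleftrightarrow> x = y"
  using permutes_inj[OF \<omega>] by (simp add: inj_eq)

lemma \<omega>_less: "x < n \<Longrightarrow> \<omega> x < n"
  using permutes_in_image[OF \<omega>, of x] by simp

lemma \<alpha>_eq: "s \<in> {1..p} \<Longrightarrow> s' \<in> {1..p} \<Longrightarrow> \<alpha> s = \<alpha> s' \<longleftrightarrow> s = s'"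
  by (rule inj_on_eq_iff[OF \<alpha>_inj])

lemma \<alpha>_\<gamma>: "s \<in> {1..p} \<Longrightarrow> s' \<in> {1..p} \<Longrightarrow> \<alpha> s \<noteq> \<gamma> s'"
  using disj by blast

lemma lit_ladder:
  assumes "j \<le> p" "u \<in> {1..p}"
  shows "lit \<omega> b (\<gamma> u) (ladder b' \<alpha> \<gamma> j \<omega> X) = lit \<omega> b (\<gamma> u) X"
proof -
  have "\<omega> (\<gamma> u) \<noteq> \<omega> (\<alpha> s)" if "s \<in> {1..j}" for s
    using \<alpha>_\<gamma>[of s u] assms that by (auto simp: \<omega>_eq)
  then show ?thesis by (auto simp: lit_def ladder_def)
qed

lemma ladder_mem:
  assumes "j \<le> p" "s \<in> {1..p}"
  shows "\<omega> (\<alpha> s) \<in> ladder b \<alpha> \<gamma> j \<omega> X \<longleftrightarrow>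
    (\<omega> (\<alpha> s) \<in> X) \<noteq> (s \<le> j \<and> lits \<omega> b \<gamma> s X)"
proof -
  have "\<omega> (\<alpha> s) = \<omega> (\<alpha> s') \<longleftrightarrow> s = s'" if "s' \<in> {1..j}" for s'
    unfolding \<omega>_eq by (rule \<alpha>_eq) (use assms that in auto)
  then have "(\<exists>s'\<in>{1..j}. \<omega> (\<alpha> s) = \<omega> (\<alpha> s') \<and> lits \<omega> b \<gamma> s' X) \<longleftrightarrow>
      (\<exists>s'\<in>{1..j}. s = s' \<and> lits \<omega> b \<gamma> s' X)"
    by (intro bex_cong) auto
  also have "\<dots> \<longleftrightarrow> s \<le> j \<and> lits \<omega> b \<gamma> s X" using assms by auto
  finally show ?thesis unfolding ladder_def mem_Collect_eq by (rule arg_cong)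
qed

lemma ladder_mem_other:
  assumes "l \<notin> (\<lambda>s. \<omega> (\<alpha> s)) ` {1..j}"
  shows "l \<in> ladder b \<alpha> \<gamma> j \<omega> X \<longleftrightarrow> l \<in> X"
  using assms by (auto simp: ladder_def)

text \<open>T adds wire \<open>\<alpha> j\<close>, gated by the new literal, to the next wire both
  before and after the shorter ladder changes \<open>\<alpha> j\<close> by the first j literals. The
  unknown content of the borrowed wire cancels and the conjunction of all literals remains.\<close>

lemma ladder_Suc:
  assumes j: "1 \<le> j" "Suc j \<le> p"
  shows "ladder b \<alpha> \<gamma> (Suc j) \<omega> X =
    (let T = toffoli (\<omega> (\<alpha> (Suc j))) (\<omega> (\<gamma> (Suc j))) (\<omega> (\<alpha> j)) (b (\<gamma> (Suc j))) True
     in T (ladder b \<alpha> \<gamma> j \<omega> (T X)))"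
proof -
  define T where "T = toffoli (\<omega> (\<alpha> (Suc j))) (\<omega> (\<gamma> (Suc j))) (\<omega> (\<alpha> j)) (b (\<gamma> (Suc j))) True"
  define c where "c = lit \<omega> b (\<gamma> (Suc j))"
  have T_mem: "l \<in> T Y \<longleftrightarrow> (l \<in> Y) \<noteq> (l = \<omega> (\<alpha> (Suc j)) \<and> c Y \<and> \<omega> (\<alpha> j) \<in> Y)" for l Y
    by (auto simp: T_def toffoli_def flip_def c_def lit_def)
  have lit_T: "lit \<omega> b (\<gamma> u) (T Y) = lit \<omega> b (\<gamma> u) Y" if "u \<in> {1..p}" for u Y
    using \<alpha>_\<gamma>[of "Suc j" u] that j by (auto simp: lit_def T_mem \<omega>_eq)
  have all_T: "lits \<omega> b \<gamma> s (T X) = lits \<omega> b \<gamma> s X" if "s \<le> p" for s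
    using that lit_T by (auto simp: lits_def)
  have ne: "\<omega> (\<alpha> s) \<noteq> \<omega> (\<alpha> (Suc j))" if "s \<in> {1..j}" for s
    using \<alpha>_eq[of s "Suc j"] that j by (auto simp: \<omega>_eq)
  define Y where "Y = ladder b \<alpha> \<gamma> j \<omega> (T X)"
  have cY: "c Y = c X" unfolding c_def Y_def using lit_ladder[of j "Suc j" b b "T X"] lit_T[of "Suc j" X] j by simp
  have Yj: "\<omega> (\<alpha> j) \<in> Y \<longleftrightarrow> (\<omega> (\<alpha> j) \<in> X) \<noteq> lits \<omega> b \<gamma> j X"
    unfolding Y_def using ladder_mem[of j j b "T X"] all_T[of j] ne[of j] j by (simp add: T_mem)
  have "l \<in> ladder b \<alpha> \<gamma> (Suc j) \<omega> X \<longleftrightarrow> l \<in> T Y" for l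
  proof (cases "l = \<omega> (\<alpha> (Suc j))")
    case l: True
    have "l \<in> Y \<longleftrightarrow> l \<in> T X"
      unfolding Y_def by (rule ladder_mem_other) (use ne l in force)
    then have "l \<in> T Y \<longleftrightarrow> (l \<in> X) \<noteq> (c X \<and> lits \<omega> b \<gamma> j X)"
      using cY Yj l by (auto simp: T_mem)
    then show ?thesis using l ladder_mem[of "Suc j" "Suc j" b X] j by (simp add: c_def lits_Suc)
  next
    case l: False
    have "l \<in> T Y \<longleftrightarrow> l \<in> Y" using l by (simp add: T_mem)
    also have "\<dots> \<longleftrightarrow> l \<in> ladder b \<alpha> \<gamma> (Suc j) \<omega> X"
    proof (cases "l \<in> (\<lambda>s. \<omega> (\<alpha> s)) ` {1..j}")
      case True
      then obtain s where s: "s \<in> {1..j}" "l = \<omega> (\<alpha> s)" by auto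
      then show ?thesis
        using ladder_mem[of j s b "T X"] ladder_mem[of "Suc j" s b X] all_T[of s] j l
        by (auto simp: Y_def T_mem)
    next
      case False
      moreover have "l \<notin> (\<lambda>s. \<omega> (\<alpha> s)) ` {1..Suc j}"
        using False l by (auto simp: le_Suc_eq)
      ultimately show ?thesis
        using ladder_mem_other[of l j b "T X"] ladder_mem_other[of l "Suc j" b X] l
        by (simp add: Y_def T_mem)
    qed
    finally show ?thesis by simp
  qed
  then show ?thesis unfolding Let_def T_def[symmetric] Y_def[symmetric] by blast
qed

text \<open>Ladders leave the literals unchanged, so the two runs flip every wire below the top by
  the same bit and these flips cancel.\<close>

lemma ladder_diff:
  assumes "1 \<le> p"
  shows "ladder b \<alpha> \<gamma> p \<omega> (ladder b \<alpha> \<gamma> (p - 1) \<omega> X) =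
    flip (\<omega> (\<alpha> p)) (lits \<omega> b \<gamma> p) X"
proof (rule set_eqI)
  fix l
  define Y where "Y = ladder b \<alpha> \<gamma> (p - 1) \<omega> X"
  have lits: "lits \<omega> b \<gamma> s Y = lits \<omega> b \<gamma> s X" if "s \<le> p" for s
    unfolding Y_def lits_def using that lit_ladder[of "p - 1" _ b b X] by auto
  show "l \<in> ladder b \<alpha> \<gamma> p \<omega> (ladder b \<alpha> \<gamma> (p - 1) \<omega> X) \<longleftrightarrow>
      l \<in> flip (\<omega> (\<alpha> p)) (lits \<omega> b \<gamma> p) X"
  proof (cases "l \<in> (\<lambda>s. \<omega> (\<alpha> s)) ` {1..p}")
    case True
    then obtain s where s: "s \<in> {1..p}" "l = \<omega> (\<alpha> s)" by auto
    have "\<omega> (\<alpha> s) = \<omega> (\<alpha> p) \<longleftrightarrow> s = p" using \<alpha>_eq[of s p] s assms by (simp add: \<omega>_eq)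
    moreover have "s = p \<or> s \<le> p - 1" "s \<le> p" using s by auto
    ultimately show ?thesis
      using ladder_mem[of p s b Y] ladder_mem[of "p - 1" s b X] lits[of s] s assms
      by (auto simp: Y_def flip_def)
  next
    case False
    then have "l \<notin> (\<lambda>s. \<omega> (\<alpha> s)) ` {1..p - 1}" "l \<noteq> \<omega> (\<alpha> p)" using assms by auto
    then show ?thesis
      using False ladder_mem_other[of l p b Y] ladder_mem_other[of l "p - 1" b X]
      by (auto simp: Y_def flip_def)
  qed
qed

lemma bij_ladder_toffoli:
  assumes "1 \<le> j" "Suc j \<le> p"
  shows "bij_betw (toffoli (\<omega> (\<alpha> (Suc j))) (\<omega> (\<gamma> (Suc j))) (\<omega> (\<alpha> j)) a c) (Pow {..<n}) (Pow {..<n})"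
proof -
  have j: "j \<in> {1..p}" "Suc j \<in> {1..p}" using assms by auto
  then have "\<alpha> (Suc j) < n" "\<gamma> (Suc j) < n" "\<alpha> j < n" using \<alpha>_n \<gamma>_n by blast+
  then show ?thesis
    using \<alpha>_\<gamma>[OF j(2,2)] \<alpha>_eq[OF j(2,1)] by (intro bij_toffoli \<omega>_less) (auto simp: \<omega>_eq)
qed

lemma bij_ladder: "j \<le> p \<Longrightarrow> bij_betw (ladder b \<alpha> \<gamma> j \<omega>) (Pow {..<n}) (Pow {..<n})"
proof (induction j)
  case 0
  have "ladder b \<alpha> \<gamma> 0 \<omega> = id" by (auto simp: ladder_0)
  then show ?case by (simp only: bij_betw_id)
next
  case (Suc j)
  show ?case
  proof (cases "j = 0")
    case True
    have "bij_betw (cnot (\<omega> (\<alpha> 1)) (\<omega> (\<gamma> 1)) (b (\<gamma> 1))) (Pow {..<n}) (Pow {..<n})"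
    proof -
      have 1: "1 \<in> {1..p}" using Suc.prems by auto
      then have "\<alpha> 1 < n" "\<gamma> 1 < n" using \<alpha>_n \<gamma>_n by blast+
      then show ?thesis using \<alpha>_\<gamma>[OF 1 1] by (intro bij_cnot \<omega>_less) (auto simp: \<omega>_eq)
    qed
    moreover have "ladder b \<alpha> \<gamma> (Suc j) \<omega> = cnot (\<omega> (\<alpha> 1)) (\<omega> (\<gamma> 1)) (b (\<gamma> 1))"
      using True by (auto simp: ladder_1)
    ultimately show ?thesis by simp
  next
    case False
    define T where "T = toffoli (\<omega> (\<alpha> (Suc j))) (\<omega> (\<gamma> (Suc j))) (\<omega> (\<alpha> j)) (b (\<gamma> (Suc j))) True"
    have T: "bij_betw T (Pow {..<n}) (Pow {..<n})"
      unfolding T_def using False Suc.prems by (intro bij_ladder_toffoli) auto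
    have eq: "ladder b \<alpha> \<gamma> (Suc j) \<omega> = T \<circ> (ladder b \<alpha> \<gamma> j \<omega> \<circ> T)"
      using False Suc.prems by (auto simp: ladder_Suc T_def Let_def)
    have L: "bij_betw (ladder b \<alpha> \<gamma> j \<omega>) (Pow {..<n}) (Pow {..<n})" using Suc by simp
    show ?thesis unfolding eq by (rule bij_betw_trans[OF bij_betw_trans[OF T L] T])
  qed
qed

end

lemma \<delta>_nonneg: "\<delta> \<ge> 0"
  using Tot0 by (simp add: \<delta>_def)

text \<open>One CNOT at the bottom and two Toffoli gates for each further control.\<close>

lemma disp_ladder:
  assumes \<alpha>: "inj_on \<alpha> {1..p}" "\<alpha> ` {1..p} \<subseteq> {..<n}" and \<gamma>: "\<gamma> ` {1..p} \<subseteq> {..<n}"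
    and disj: "\<alpha> ` {1..p} \<inter> \<gamma> ` {1..p} = {}"
  shows "Suc j \<le> p \<Longrightarrow> disp W (ladder b \<alpha> \<gamma> (Suc j)) \<le> (2 * real j + 1) * \<delta>"
proof (induction j)
  case 0
  have "disp W (ladder b \<alpha> \<gamma> (Suc 0)) = disp W (\<lambda>\<omega>. cnot (\<omega> (\<alpha> 1)) (\<omega> (\<gamma> 1)) (b (\<gamma> 1)))"
    by (rule disp_cong) (simp add: ladder_1)
  also have "\<dots> \<le> \<delta>"
    using 0 assms by (intro disp_cnot) force+
  finally show ?case by simp
next
  case (Suc j)
  define T where "T = (\<lambda>\<omega>. toffoli (\<omega> (\<alpha> (Suc (Suc j)))) (\<omega> (\<gamma> (Suc (Suc j))))
      (\<omega> (\<alpha> (Suc j))) (b (\<gamma> (Suc (Suc j)))) True)"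
  have dT: "disp W T \<le> \<delta>" unfolding T_def
  proof (rule disp_toffoli)
    have j: "Suc j \<in> {1..p}" "Suc (Suc j) \<in> {1..p}" using Suc.prems by auto
    show "\<alpha> (Suc (Suc j)) < n" "\<gamma> (Suc (Suc j)) < n" "\<alpha> (Suc j) < n" using \<alpha>(2) \<gamma> j by blast+
    show "\<alpha> (Suc (Suc j)) \<noteq> \<gamma> (Suc (Suc j))" "\<gamma> (Suc (Suc j)) \<noteq> \<alpha> (Suc j)" using disj j by blast+
    show "\<alpha> (Suc (Suc j)) \<noteq> \<alpha> (Suc j)" using inj_onD[OF \<alpha>(1) _ j(2,1)] by auto
  qed
  have bT: "bij_betw (T \<omega>) (Pow {..<n}) (Pow {..<n})" if "\<omega> \<in> W" for \<omega>
    unfolding T_def using that assms Suc.prems by (intro bij_ladder_toffoli) auto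
  have bL: "bij_betw (ladder b \<alpha> \<gamma> (Suc j) \<omega>) (Pow {..<n}) (Pow {..<n})" if "\<omega> \<in> W" for \<omega>
    using that assms Suc.prems by (intro bij_ladder[of \<omega> \<alpha> p]) auto
  have "disp W (ladder b \<alpha> \<gamma> (Suc (Suc j))) = disp W (\<lambda>\<omega> X. T \<omega> (ladder b \<alpha> \<gamma> (Suc j) \<omega> (T \<omega> X)))"
    using assms Suc.prems by (intro disp_cong) (simp add: ladder_Suc[of _ \<alpha> p] T_def Let_def)
  also have "\<dots> \<le> disp W T + disp W (\<lambda>\<omega> X. ladder b \<alpha> \<gamma> (Suc j) \<omega> (T \<omega> X))"
  proof (rule disp_comp[OF finW])
    fix \<omega> assume "\<omega> \<in> W"
    then show "bij_betw (\<lambda>X. ladder b \<alpha> \<gamma> (Suc j) \<omega> (T \<omega> X)) (Pow {..<n}) (Pow {..<n})"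
      using bij_betw_trans[OF bT bL] by (simp add: comp_def)
  qed
  also have "disp W (\<lambda>\<omega> X. ladder b \<alpha> \<gamma> (Suc j) \<omega> (T \<omega> X)) \<le> disp W (ladder b \<alpha> \<gamma> (Suc j)) + disp W T"
    by (rule disp_comp[OF finW bT])
  finally show ?case using dT Suc by (simp add: algebra_simps)
qed

text \<open>Two ladders of fewer than 2p gates each. The price is p - 1 borrowed wires besides the
  target, more than are free when nearly all wires are controls; \<open>disp_pattern_gate\<close>
  therefore splits the controls.\<close>

lemma disp_multi_controlled:
  assumes p: "1 \<le> p" and \<alpha>: "inj_on \<alpha> {1..p}" "\<alpha> ` {1..p} \<subseteq> {..<n}"
    and \<gamma>: "\<gamma> ` {1..p} \<subseteq> {..<n}" and disj: "\<alpha> ` {1..p} \<inter> \<gamma> ` {1..p} = {}"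
  shows "disp W (\<lambda>\<omega>. flip (\<omega> (\<alpha> p)) (lits \<omega> b \<gamma> p)) \<le> 4 * real p * \<delta>"
proof -
  have "disp W (\<lambda>\<omega>. flip (\<omega> (\<alpha> p)) (lits \<omega> b \<gamma> p))
      = disp W (\<lambda>\<omega> X. ladder b \<alpha> \<gamma> p \<omega> (ladder b \<alpha> \<gamma> (p - 1) \<omega> X))"
    using assms by (intro disp_cong ladder_diff[symmetric]) auto
  also have "\<dots> \<le> disp W (ladder b \<alpha> \<gamma> p) + disp W (ladder b \<alpha> \<gamma> (p - 1))"
  proof (rule disp_comp[OF finW])
    fix \<omega> assume "\<omega> \<in> W"
    then show "bij_betw (ladder b \<alpha> \<gamma> (p - 1) \<omega>) (Pow {..<n}) (Pow {..<n})"
      using assms by (intro bij_ladder[of \<omega> \<alpha> p]) auto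
  qed
  also have "disp W (ladder b \<alpha> \<gamma> p) \<le> 2 * real p * \<delta>"
  proof -
    have "disp W (ladder b \<alpha> \<gamma> p) \<le> (2 * real (p - 1) + 1) * \<delta>"
      using disp_ladder[OF \<alpha> \<gamma> disj, of "p - 1"] p by simp
    also have "\<dots> \<le> 2 * real p * \<delta>"
      using p \<delta>_nonneg by (intro mult_right_mono) (auto simp: of_nat_diff)
    finally show ?thesis .
  qed
  also have "disp W (ladder b \<alpha> \<gamma> (p - 1)) \<le> 2 * real p * \<delta>"
  proof (cases "p = 1")
    case True
    have "disp W (ladder b \<alpha> \<gamma> (p - 1)) = disp W (\<lambda>\<omega> X. X)"
      using True by (intro disp_cong) (simp add: ladder_0)
    also have "\<dots> = 0" by (simp add: disp_def energy_def)
    finally show ?thesis using \<delta>_nonneg by simp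
  next
    case False
    have "disp W (ladder b \<alpha> \<gamma> (p - 1)) \<le> (2 * real (p - 2) + 1) * \<delta>"
    proof -
      have "Suc (p - 2) = p - 1" using p False by simp
      then show ?thesis using disp_ladder[OF \<alpha> \<gamma> disj, of "p - 2"] by (metis diff_le_self)
    qed
    also have "\<dots> \<le> 2 * real p * \<delta>"
      using p \<delta>_nonneg by (intro mult_right_mono) (auto simp: of_nat_diff)
    finally show ?thesis .
  qed
  finally show ?thesis by simp
qed

text \<open>Only one spare wire is needed: with wire 1 as intermediate target, the gate is the
  commutator of two gates that split the controls, and either half can borrow the other.\<close>
lemma disp_pattern_gate:
  assumes m: "m + 2 \<le> n"
  shows "disp W (\<lambda>\<omega>. flip (\<omega> 0) (\<lambda>X. \<forall>j\<in>{2..<m+2}. lit \<omega> b j X)) \<le> 8 * real n * \<delta>"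
proof -
  \<comment> \<open>\<open>G1\<close> has m1 controls and borrows m1 - 1 of the m2 wires of the
    other half; \<open>G2\<close> has m2 + 1 controls, wire 1 included, and borrows m2 of the m1
    wires. Both fit since \<open>m2 \<le> m1 \<le> m2 + 1\<close>.\<close>
  define m1 where "m1 = (m + 1) div 2"
  define m2 where "m2 = m - m1"
  have mm: "m1 + m2 = m" "m2 \<le> m1" "m1 \<le> m2 + 1" by (auto simp: m1_def m2_def)
  \<comment> \<open>Wire 1 is no part of the pattern; it enters \<open>G2\<close> as a positive
    control.\<close>
  define b' where "b' = b(Suc 0 := True)"
  define G1 where "G1 = (\<lambda>\<omega>. flip (\<omega> 1) (\<lambda>X. \<forall>j\<in>{2..<m1+2}. lit \<omega> b' j X))"
  define G2 where "G2 = (\<lambda>\<omega>. flip (\<omega> 0) (\<lambda>X. \<forall>j\<in>insert 1 {m1+2..<m+2}. lit \<omega> b' j X))"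
  \<comment> \<open>The summand 1 covers \<open>m1 = 0\<close>, where \<open>G1\<close> is a plain
    NOT.\<close>
  have d1: "disp W G1 \<le> (4 * real m1 + 1) * \<delta>"
  proof (cases "m1 = 0")
    case True
    then show ?thesis using disp_not[of 1] n2 by (simp add: G1_def)
  next
    case False
    define \<alpha> where "\<alpha> = (\<lambda>s. if s = m1 then 1 else m1 + 1 + s)"
    have d: "disp W (\<lambda>\<omega>. flip (\<omega> (\<alpha> m1)) (lits \<omega> b' Suc m1)) \<le> 4 * real m1 * \<delta>"
      by (rule disp_multi_controlled) (use False mm m in \<open>auto simp: \<alpha>_def inj_on_def\<close>)
    have "{2..<m1+2} = Suc ` {1..m1}" by (auto simp: image_Suc_atLeastAtMost)
    then have "(\<lambda>X. \<forall>j\<in>{2..<m1+2}. lit \<omega> b' j X) = lits \<omega> b' Suc m1" for \<omega>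
      by (intro ext) (simp only: lits_def ball_simps)
    with d have "disp W G1 \<le> 4 * real m1 * \<delta>" by (simp only: G1_def \<alpha>_def if_True refl)
    also have "\<dots> \<le> (4 * real m1 + 1) * \<delta>" using \<delta>_nonneg by (simp add: algebra_simps)
    finally show ?thesis .
  qed
  have d2: "disp W G2 \<le> 4 * real (m2 + 1) * \<delta>"
  proof -
    define \<alpha> where "\<alpha> = (\<lambda>s. if s = m2 + 1 then 0 else s + 1)"
    define \<gamma> where "\<gamma> = (\<lambda>u. if u = m2 + 1 then 1 else m1 + 1 + u)"
    have d: "disp W (\<lambda>\<omega>. flip (\<omega> (\<alpha> (m2 + 1))) (lits \<omega> b' \<gamma> (m2 + 1))) \<le> 4 * real (m2 + 1) * \<delta>"
      by (rule disp_multi_controlled) (use mm m in \<open>auto simp: \<alpha>_def \<gamma>_def inj_on_def\<close>)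
    have img: "\<gamma> ` {1..m2+1} = insert 1 {m1+2..<m+2}"
    proof -
      have "{1..m2+1} = insert (m2 + 1) {1..m2}" by auto
      moreover have "\<gamma> (m2 + 1) = 1" by (simp add: \<gamma>_def)
      ultimately have "\<gamma> ` {1..m2+1} = insert 1 (\<gamma> ` {1..m2})" by (simp only: image_insert)
      also have "\<gamma> ` {1..m2} = (+) (m1 + 1) ` {1..m2}"
        by (rule image_cong) (auto simp: \<gamma>_def)
      also have "\<dots> = {m1+2..<m+2}"
        using mm by (simp only: image_add_atLeastAtMost) auto
      finally show ?thesis .
    qed
    have "(\<lambda>X. \<forall>j\<in>insert 1 {m1+2..<m+2}. lit \<omega> b' j X) = lits \<omega> b' \<gamma> (m2 + 1)" for \<omega>
      unfolding lits_def img[symmetric] by (intro ext) (simp only: ball_simps)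
    with d show ?thesis by (simp only: G2_def \<alpha>_def if_True refl)
  qed
  have perm: "\<omega> x = \<omega> y \<longleftrightarrow> x = y" "x < n \<Longrightarrow> \<omega> x < n" if "\<omega> \<in> W" for \<omega> x y
    using permutes_inj[of \<omega> "{..<n}"] permutes_in_image[of \<omega> "{..<n}" x] that by (auto simp: inj_eq)
  have b1: "bij_betw (G1 \<omega>) (Pow {..<n}) (Pow {..<n})" if "\<omega> \<in> W" for \<omega>
    unfolding G1_def
    by (rule bij_betw_flip_wires[where C = "\<omega> ` {2..<m1+2}"])
      (use perm[OF that] mm m in \<open>auto simp: lit_def\<close>)
  have b2: "bij_betw (G2 \<omega>) (Pow {..<n}) (Pow {..<n})" if "\<omega> \<in> W" for \<omega>
    unfolding G2_def
    by (rule bij_betw_flip_wires[where C = "\<omega> ` insert 1 {m1+2..<m+2}"])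
      (use perm[OF that] mm m in \<open>auto simp: lit_def\<close>)
  have b12: "bij_betw (\<lambda>X. G2 \<omega> (G1 \<omega> X)) (Pow {..<n}) (Pow {..<n})" if "\<omega> \<in> W" for \<omega>
    using bij_betw_trans[OF b1 b2] that by (simp add: comp_def)
  \<comment> \<open>Let w be the content of wire 1. Wire 0 receives (w + P1) P2, then wire 1 is
    restored, then wire 0 receives w P2; modulo 2 this adds up to P1 P2.\<close>
  have "flip (\<omega> 0) (\<lambda>X. \<forall>j\<in>{2..<m+2}. lit \<omega> b j X) X = G2 \<omega> (G1 \<omega> (G2 \<omega> (G1 \<omega> X)))"
    if \<omega>: "\<omega> \<in> W" for \<omega> X
  proof -
    define P1 where "P1 = (\<lambda>X. \<forall>j\<in>{2..<m1+2}. lit \<omega> b' j X)"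
    define P2 where "P2 = (\<lambda>X. \<forall>j\<in>{m1+2..<m+2}. lit \<omega> b' j X)"
    have G1: "l \<in> G1 \<omega> Y \<longleftrightarrow> (l \<in> Y) \<noteq> (l = \<omega> 1 \<and> P1 Y)" for l Y
      by (auto simp: G1_def flip_def P1_def)
    have G2: "l \<in> G2 \<omega> Y \<longleftrightarrow> (l \<in> Y) \<noteq> (l = \<omega> 0 \<and> \<omega> 1 \<in> Y \<and> P2 Y)" for l Y
      by (auto simp: G2_def flip_def P2_def lit_def b'_def)
    have ne: "\<omega> j \<noteq> \<omega> 0" "\<omega> j \<noteq> \<omega> 1" "\<omega> 1 \<noteq> \<omega> 0" "\<omega> 0 \<noteq> \<omega> 1" if "j \<ge> 2" for j
      using that perm(1)[OF \<omega>] by auto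
    have P: "P1 (G1 \<omega> Y) = P1 Y" "P1 (G2 \<omega> Y) = P1 Y" "P2 (G1 \<omega> Y) = P2 Y" "P2 (G2 \<omega> Y) = P2 Y" for Y
      using ne unfolding P1_def P2_def by (auto simp: lit_def G1 G2)
    have "{2..<m+2} = {2..<m1+2} \<union> {m1+2..<m+2}" using mm by auto
    then have "(\<forall>j\<in>{2..<m+2}. lit \<omega> b j X) = (P1 X \<and> P2 X)"
      by (auto simp: P1_def P2_def lit_def b'_def ball_Un)
    then show ?thesis
      using ne(3,4)[of 2] by (intro set_eqI) (auto simp: flip_def G1 G2 P)
  qed
  then have "disp W (\<lambda>\<omega>. flip (\<omega> 0) (\<lambda>X. \<forall>j\<in>{2..<m+2}. lit \<omega> b j X))
      = disp W (\<lambda>\<omega> X. G2 \<omega> (G1 \<omega> (G2 \<omega> (G1 \<omega> X))))"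
    by (intro disp_cong)
  also have "\<dots> \<le> disp W (\<lambda>\<omega> X. G2 \<omega> (G1 \<omega> X)) + disp W (\<lambda>\<omega> X. G2 \<omega> (G1 \<omega> X))"
    by (rule disp_comp[OF finW b12, where s = "\<lambda>\<omega> X. G2 \<omega> (G1 \<omega> X)"])
  finally have bound1: "disp W (\<lambda>\<omega>. flip (\<omega> 0) (\<lambda>X. \<forall>j\<in>{2..<m+2}. lit \<omega> b j X))
      \<le> disp W (\<lambda>\<omega> X. G2 \<omega> (G1 \<omega> X)) + disp W (\<lambda>\<omega> X. G2 \<omega> (G1 \<omega> X))" .
  have bound2: "disp W (\<lambda>\<omega> X. G2 \<omega> (G1 \<omega> X)) \<le> disp W G2 + disp W G1"
    by (rule disp_comp[OF finW b1])
  have "disp W (\<lambda>\<omega>. flip (\<omega> 0) (\<lambda>X. \<forall>j\<in>{2..<m+2}. lit \<omega> b j X))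
      \<le> 2 * (4 * real (m2 + 1) * \<delta> + (4 * real m1 + 1) * \<delta>)"
  proof -
    have "x \<le> 2 * (a' + c')" if "x \<le> y + y" "y \<le> a + c" "c \<le> c'" "a \<le> a'"
      for x y a c a' c' :: real using that unfolding distrib_left by linarith
    from this[OF bound1 bound2 d1 d2] show ?thesis .
  qed
  also have "\<dots> = (8 * real (m1 + m2) + 10) * \<delta>" by (simp add: algebra_simps)
  also have "\<dots> \<le> 8 * real n * \<delta>"
    using m mm \<delta>_nonneg by (intro mult_right_mono) auto
  finally show ?thesis .
qed

text \<open>The squared word length, of order \<open>n^2\<close>, meets the mean energy of order
  \<open>1 / n^3\<close> per gate; 12288 = 64 * 192.\<close>

lemma sum_pattern_gate:
  assumes m: "m + 2 \<le> n"
  shows "(\<Sum>\<omega>\<in>W. en (flip (\<omega> 0) (\<lambda>X. \<forall>j\<in>{2..<m+2}. lit \<omega> b j X)))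
    \<le> real (card W) * (12288 * Tot / real n)"
proof -
  have "(\<Sum>\<omega>\<in>W. en (flip (\<omega> 0) (\<lambda>X. \<forall>j\<in>{2..<m+2}. lit \<omega> b j X))) \<le> (8 * real n * \<delta>)\<^sup>2"
    unfolding disp_power2[symmetric] using disp_pattern_gate[OF m] disp_nonneg by (intro power_mono)
  also have "\<dots> = 64 * real n ^ 2 * (real (card W) * 192 * Tot / real n ^ 3)"
    using Tot0 by (simp add: \<delta>_def power_mult_distrib)
  also have "\<dots> = real (card W) * (12288 * Tot / real n)"
    using n2 by (simp add: power2_eq_square power3_eq_cube field_simps)
  finally show ?thesis .
qed

end

section \<open>The transposition energy is dominated by the gate energy\<close>

context wired_tuples
begin

lemma bij_pattern_gate: "bij_betw (flip \<tau> (\<lambda>Y. Y \<inter> J = \<beta>)) (Pow U) (Pow U)"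
  by (rule bij_betw_flip_wires[where C = J]) (use \<tau>J in \<open>auto simp: Int_assoc\<close>)

lemma en_gate_le:
  assumes A: "A \<in> As" and C: "C \<in> Cs" and B: "B \<in> Bs"
  shows "en (gate A C B \<beta>) \<le>
    7 * (2 * en (shear A) + 2 * en (shear C) + 2 * en (shear B) + en (flip \<tau> (\<lambda>Y. Y \<inter> J = \<beta>)))"
  unfolding gate_def[abs_def] L_def Li_def
  by (rule en_conj3[OF bij_A[OF A] bij_C[OF C] bij_B[OF B] bij_pattern_gate])

lemma sum_shear_le:
  assumes "T \<inter> C = {}" "T \<union> C \<subseteq> U"
  shows "(\<Sum>A\<in>Pow (T \<times> C). en (shear A)) \<le>
    real (card (Pow (T \<times> C))) / 2 * (\<Sum>i\<in>U. \<Sum>j\<in>U - {i}. en (shear {(i, j)}))"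
proof -
  have fin: "finite T" "finite C" using assms finU finite_subset by auto
  have "(\<Sum>A\<in>Pow (T \<times> C). en (shear A)) \<le> 2 ^ card (T \<times> C) / 2 * (\<Sum>e\<in>T \<times> C. en (shear {e}))"
  proof (rule sum_en_involutions_le)
    fix A assume "A \<subseteq> T \<times> C"
    then show "bij_betw (shear A) (Pow U) (Pow U)" by (rule bij_betw_shear) (use assms finU in auto)
  next
    fix A B X assume "A \<subseteq> T \<times> C" "B \<subseteq> T \<times> C" "X \<in> Pow U"
    then show "shear (sym_diff A B) X = shear A (shear B X)"
      using finite_sub[of X] assms by (intro shear_comp) auto
  qed (use fin in simp)
  also have "\<dots> \<le> 2 ^ card (T \<times> C) / 2 * (\<Sum>e\<in>(SIGMA i:U. U - {i}). en (shear {e}))"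
    using assms finU by (intro mult_left_mono sum_mono2) (auto simp: energy_nonneg)
  also have "(\<Sum>e\<in>(SIGMA i:U. U - {i}). en (shear {e})) = (\<Sum>i\<in>U. \<Sum>j\<in>U - {i}. en (shear {(i, j)}))"
    using finU by (subst sum.Sigma) (auto simp: case_prod_unfold)
  finally show ?thesis using fin by (simp add: card_Pow)
qed

lemma card_halves: "card {X \<in> Pow U. \<tau> \<in> X} = card {X \<in> Pow U. \<tau> \<notin> X}"
  by (rule bij_betw_same_card[of "\<lambda>X. sym_diff X {\<tau>}"],
      rule bij_betw_byWitness[where f' = "\<lambda>X. sym_diff X {\<tau>}"]) auto

text \<open>The constant is 462 = 11 * 6 * 7: pairs opposite on \<tau>, isolation, words of length
  seven. Each of the three shears occurs twice with Poincare constant 1/2, which gives the 3. The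
  shears do not depend on \<beta>, so they carry the number \<open>2 ^ card J\<close> of patterns,
  while \<open>2 ^ card (K \<union> J)\<close> is the number of directions A.\<close>

lemma sum_transpositions_le_gates:
  assumes dens: "2 * k \<le> 2 ^ card J \<or> card K = 1 \<and> 3 * k \<le> 4 * 2 ^ card J"
  shows "(\<Sum>X\<in>Pow U. \<Sum>Z\<in>Pow U. en (transpose X Z)) \<le> 462 * 2 ^ card (K \<union> J) *
    (3 * 2 ^ card J * (\<Sum>i\<in>U. \<Sum>j\<in>U - {i}. en (shear {(i, j)})) +
     (\<Sum>\<beta>\<in>Pow J. en (flip \<tau> (\<lambda>Y. Y \<inter> J = \<beta>))))"
proof -
  define a c b q :: real where "a = real (card As)" and "c = real (card Cs)"
    and "b = real (card Bs)" and "q = 2 ^ card J"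
  define N where "N = (\<Sum>i\<in>U. \<Sum>j\<in>U - {i}. en (shear {(i, j)}))"
  define X where "X = (\<lambda>\<beta>. en (flip \<tau> (\<lambda>Y. Y \<inter> J = \<beta>)))"
  define Opp where "Opp = (\<Sum>X\<in>Pow U. \<Sum>Z\<in>{Z \<in> Pow U. (\<tau> \<in> X) \<noteq> (\<tau> \<in> Z)}. en (transpose X Z))"
  have pos: "a > 0" "c > 0" "b > 0" "q > 0"
    using finite_As finite_Bs finite_Cs
    by (auto simp: a_def b_def c_def q_def As_def Bs_def Cs_def card_gt_0_iff)
  have qJ: "real (card (Pow J)) = q" using finJ by (simp add: card_Pow q_def)
  have sA: "(\<Sum>A\<in>As. en (shear A)) \<le> a / 2 * N"
    unfolding As_def a_def N_def by (rule sum_shear_le) (use \<tau>K \<tau>J in auto)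
  have sC: "(\<Sum>C\<in>Cs. en (shear C)) \<le> c / 2 * N"
    unfolding Cs_def c_def N_def by (rule sum_shear_le) (use KJ in auto)
  have sB: "(\<Sum>B\<in>Bs. en (shear B)) \<le> b / 2 * N"
    unfolding Bs_def b_def N_def by (rule sum_shear_le) (use KJ in auto)
  have "c * b * Opp \<le> 6 * (\<Sum>A\<in>As. \<Sum>(C, B, \<beta>)\<in>Cs \<times> Bs \<times> Pow J. en (gate A C B \<beta>))"
    using sum_opposite_transpositions_le[OF dens] by (simp add: Opp_def c_def b_def card_cartesian_product)
  also have "(\<Sum>A\<in>As. \<Sum>(C, B, \<beta>)\<in>Cs \<times> Bs \<times> Pow J. en (gate A C B \<beta>))
      = (\<Sum>A\<in>As. \<Sum>C\<in>Cs. \<Sum>B\<in>Bs. \<Sum>\<beta>\<in>Pow J. en (gate A C B \<beta>))"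
    by (simp add: sum.cartesian_product case_prod_unfold)
  also have "\<dots> \<le> (\<Sum>A\<in>As. \<Sum>C\<in>Cs. \<Sum>B\<in>Bs. \<Sum>\<beta>\<in>Pow J.
      7 * (2 * en (shear A) + 2 * en (shear C) + 2 * en (shear B) + X \<beta>))"
    unfolding X_def by (intro sum_mono en_gate_le)
  also have "\<dots> = 7 * (2 * (c * (b * (q * (\<Sum>A\<in>As. en (shear A)))))
      + 2 * (a * (b * (q * (\<Sum>C\<in>Cs. en (shear C)))))
      + 2 * (a * (c * (q * (\<Sum>B\<in>Bs. en (shear B)))))
      + a * (c * (b * (\<Sum>\<beta>\<in>Pow J. X \<beta>))))"
    by (simp add: sum.distrib qJ a_def b_def c_def flip: sum_distrib_left) (simp add: algebra_simps)
  also have "\<dots> \<le> 7 * (2 * (c * (b * (q * (a / 2 * N)))) + 2 * (a * (b * (q * (c / 2 * N))))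
      + 2 * (a * (c * (q * (b / 2 * N)))) + a * (c * (b * (\<Sum>\<beta>\<in>Pow J. X \<beta>))))"
    using pos sA sB sC by (intro mult_left_mono add_mono order_refl) auto
  also have "\<dots> = c * b * (7 * a * (3 * q * N + (\<Sum>\<beta>\<in>Pow J. X \<beta>)))" by (simp add: algebra_simps)
  finally have "c * b * Opp \<le> c * b * (42 * a * (3 * q * N + (\<Sum>\<beta>\<in>Pow J. X \<beta>)))" by simp
  then have "Opp \<le> 42 * a * (3 * q * N + (\<Sum>\<beta>\<in>Pow J. X \<beta>))" using pos by simp
  moreover have "(\<Sum>X\<in>Pow U. \<Sum>Z\<in>Pow U. en (transpose X Z)) \<le> 11 * Opp"
    unfolding Opp_def by (rule sum_transpositions_le[OF card_halves])
  ultimately have "(\<Sum>X\<in>Pow U. \<Sum>Z\<in>Pow U. en (transpose X Z)) \<le> 462 * a * (3 * q * N + (\<Sum>\<beta>\<in>Pow J. X \<beta>))"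
    by simp
  moreover have "a = 2 ^ card (K \<union> J)"
    using finK finJ by (simp add: a_def As_def card_Pow card_cartesian_product)
  ultimately show ?thesis by (simp add: q_def N_def X_def)
qed

end

text \<open>Two wires are reserved, for the target and for K. The least m with
  \<open>2 * k \<le> 2 ^ m\<close> satisfies the upper bound by minimality. If it does not fit,
  \<open>m = n - 2\<close> leaves a single wire for K, and the hypothesis on k becomes
  \<open>3 * k \<le> 4 * 2 ^ m\<close>.\<close>

lemma ex_number_of_controls:
  fixes n k :: nat
  assumes n: "n \<ge> 2" and k: "k > 0" "3 * k \<le> 2 ^ n"
  shows "\<exists>m. m + 2 \<le> n \<and> 2 ^ m \<le> 4 * k \<and> (2 * k \<le> 2 ^ m \<or> m + 2 = n \<and> 3 * k \<le> 4 * 2 ^ m)"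
proof (cases "2 * k \<le> 2 ^ (n - 2)")
  case True
  define m where "m = (LEAST m. 2 * k \<le> 2 ^ m)"
  have m: "2 * k \<le> 2 ^ m" "m \<le> n - 2" unfolding m_def using True by (auto intro: LeastI Least_le)
  have "m \<noteq> 0" using m(1) k by (intro notI) simp
  then obtain m' where m': "m = Suc m'" by (cases m) auto
  then have "\<not> 2 * k \<le> 2 ^ m'" using not_less_Least[of m' "\<lambda>m. 2 * k \<le> 2 ^ m"] by (simp add: m_def)
  then show ?thesis using m m' n by (intro exI[of _ m]) auto
next
  case False
  have "2 ^ n = 4 * (2 :: nat) ^ (n - 2)"
    using power_add[of "2 :: nat" 2 "n - 2"] unfolding le_add_diff_inverse[OF n] by simp
  then show ?thesis using False k n by (intro exI[of _ "n - 2"]) auto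
qed

context gate_energy
begin

lemma sum_transpositions_le_gate_energy:
  assumes k: "k > 0" "3 * k \<le> 2 ^ n"
  shows "(\<Sum>X\<in>Pow {..<n}. \<Sum>Z\<in>Pow {..<n}. en (transpose X Z)) \<le> 11420640 * 2 ^ n * real k * Tot / real n"
proof -
  obtain m where m: "m + 2 \<le> n" "2 ^ m \<le> 4 * k" "2 * k \<le> 2 ^ m \<or> m + 2 = n \<and> 3 * k \<le> 4 * 2 ^ m"
    using ex_number_of_controls[OF n2 k] by blast
  define F where "F = (\<Sum>X\<in>Pow {..<n}. \<Sum>Z\<in>Pow {..<n}. en (transpose X Z))"
  define J0 where "J0 = {2..<m+2}"
  define p where "p = (\<lambda>\<omega> \<beta>. en (flip (\<omega> 0) (\<lambda>X. \<forall>j\<in>J0. lit \<omega> (\<lambda>j. j \<in> \<beta>) j X)))"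
  have cW: "real (card W) > 0"
  proof -
    have "id \<in> W" by (simp add: permutes_id)
    then have "W \<noteq> {}" by blast
    then show ?thesis using finW by (simp only: of_nat_0_less_iff card_gt_0_iff) simp
  qed
  \<comment> \<open>F does not depend on \<omega>, so every relabelling bounds the same quantity and
    the bounds may be averaged. The sum over CNOTs is already symmetric; only the pattern gates
    profit from the average.\<close>
  have F_le: "F \<le> 462 * 2 ^ (n - 1) * (3 * 2 ^ m * (24 * Tot / real n) + (\<Sum>\<beta>\<in>Pow J0. p \<omega> \<beta>))"
    if \<omega>: "\<omega> \<in> W" for \<omega>
  proof -
    \<comment> \<open>Wire 1 always lies in K, which makes it available as the intermediate target
      in \<open>disp_pattern_gate\<close>; for \<open>m + 2 = n\<close> it is all of K.\<close>
    define K where "K = \<omega> ` insert 1 {m+2..<n}"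
    define J where "J = \<omega> ` J0"
    have inj: "inj \<omega>" and img: "\<omega> ` {..<n} = {..<n}"
      using permutes_inj[of \<omega> "{..<n}"] permutes_image[of \<omega> "{..<n}"] \<omega> by auto
    have split: "{..<n} = insert 0 (insert 1 {m+2..<n} \<union> J0)" using m(1) by (auto simp: J0_def)
    have U: "insert (\<omega> 0) (K \<union> J) = {..<n}"
      using img unfolding K_def J_def by (subst (asm) split) (simp add: image_Un)
    interpret T: wired_tuples "\<omega> 0" K J k g
    proof
      show "K \<inter> J = {}" unfolding K_def J_def using inj
        by (subst image_Int[symmetric]) (auto simp: J0_def)
      show "\<omega> 0 \<notin> K" "\<omega> 0 \<notin> J" using inj by (auto simp: K_def J_def J0_def inj_eq)
    qed (auto simp: K_def J_def J0_def)
    have cJ: "card J = m" using inj by (simp add: J_def J0_def card_image inj_on_subset)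
    have cK: "card K = n - (m + 1)" 
      unfolding K_def card_image[OF inj_on_subset[OF inj subset_UNIV]] using m(1) by simp
    have cKJ: "card (K \<union> J) = n - 1"
      using T.KJ T.finK T.finJ m(1) by (simp add: card_Un_disjoint cJ cK)
    have "2 * k \<le> 2 ^ card J \<or> card K = 1 \<and> 3 * k \<le> 4 * 2 ^ card J"
      using m(3) by (auto simp: cJ cK)
    from T.sum_transpositions_le_gates[OF this]
    have "F \<le> 462 * 2 ^ (n - 1) *
      (3 * 2 ^ m * (\<Sum>i\<in>{..<n}. \<Sum>j\<in>{..<n} - {i}. en (shear {(i, j)})) +
       (\<Sum>\<beta>\<in>Pow J. en (flip (\<omega> 0) (\<lambda>Y. Y \<inter> J = \<beta>))))"
      unfolding F_def U cJ cKJ .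
    also have "(\<Sum>i\<in>{..<n}. \<Sum>j\<in>{..<n} - {i}. en (shear {(i, j)})) = (\<Sum>i<n. \<Sum>j\<in>{..<n} - {i}. en (cnot i j True))"
    proof (intro sum.cong refl en_cong)
      fix i j :: nat and X
      have "{c \<in> X. (l, c) \<in> {(i, j)}} = (if l = i \<and> j \<in> X then {j} else {})" for l by auto
      then show "shear {(i, j)} X = cnot i j True X"
        by (auto simp: shear_def lin_def cnot_def flip_def split: if_splits)
    qed
    also have "(\<Sum>\<beta>\<in>Pow J. en (flip (\<omega> 0) (\<lambda>Y. Y \<inter> J = \<beta>))) = (\<Sum>\<beta>\<in>Pow J0. p \<omega> \<beta>)"
    proof -
      have "bij_betw ((`) \<omega>) (Pow J0) (Pow J)"
        unfolding J_def using inj by (intro bij_betw_Pow) (auto simp: bij_betw_def intro: inj_on_subset[OF inj])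
      then have "(\<Sum>\<beta>\<in>Pow J. en (flip (\<omega> 0) (\<lambda>Y. Y \<inter> J = \<beta>)))
          = (\<Sum>\<beta>\<in>Pow J0. en (flip (\<omega> 0) (\<lambda>Y. Y \<inter> J = \<omega> ` \<beta>)))"
        by (rule sum.reindex_bij_betw[symmetric])
      also have "\<dots> = (\<Sum>\<beta>\<in>Pow J0. p \<omega> \<beta>)"
      proof (rule sum.cong[OF refl])
        fix \<beta> assume "\<beta> \<in> Pow J0"
        then have \<beta>: "\<beta> \<subseteq> J0" by simp
        have mem: "\<omega> j \<in> \<omega> ` \<beta> \<longleftrightarrow> j \<in> \<beta>" for j by (rule inj_image_mem_iff[OF inj])
        have "Y \<inter> J = \<omega> ` \<beta> \<longleftrightarrow> (\<forall>j\<in>J0. (\<omega> j \<in> Y) = (j \<in> \<beta>))" for Y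
        proof
          assume Y: "Y \<inter> J = \<omega> ` \<beta>"
          show "\<forall>j\<in>J0. (\<omega> j \<in> Y) = (j \<in> \<beta>)"
            unfolding mem[symmetric] Y[symmetric] by (auto simp: J_def)
        qed (use \<beta> in \<open>auto simp: J_def\<close>)
        then have "(\<lambda>Y. Y \<inter> J = \<omega> ` \<beta>) = (\<lambda>X. \<forall>j\<in>J0. lit \<omega> (\<lambda>j. j \<in> \<beta>) j X)"
          by (simp add: lit_def)
        then show "en (flip (\<omega> 0) (\<lambda>Y. Y \<inter> J = \<omega> ` \<beta>)) = p \<omega> \<beta>" by (simp add: p_def)
      qed
      finally show ?thesis .
    qed
    also have "462 * 2 ^ (n - 1) * (3 * 2 ^ m * (\<Sum>i<n. \<Sum>j\<in>{..<n} - {i}. en (cnot i j True)) + (\<Sum>\<beta>\<in>Pow J0. p \<omega> \<beta>))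
       \<le> 462 * 2 ^ (n - 1) * (3 * 2 ^ m * (24 * Tot / real n) + (\<Sum>\<beta>\<in>Pow J0. p \<omega> \<beta>))"
      by (intro mult_left_mono add_right_mono cnot_sum) auto
    finally show ?thesis .
  qed
  have cJ0: "real (card (Pow J0)) = 2 ^ m" by (simp add: J0_def card_Pow)
  have "real (card W) * F = (\<Sum>\<omega>\<in>W. F)" by simp
  also have "\<dots> \<le> (\<Sum>\<omega>\<in>W. 462 * 2 ^ (n - 1) * (3 * 2 ^ m * (24 * Tot / real n) + (\<Sum>\<beta>\<in>Pow J0. p \<omega> \<beta>)))"
    by (intro sum_mono F_le)
  also have "\<dots> = 462 * 2 ^ (n - 1) * (real (card W) * (3 * 2 ^ m * (24 * Tot / real n)) + (\<Sum>\<omega>\<in>W. \<Sum>\<beta>\<in>Pow J0. p \<omega> \<beta>))"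
    by (simp add: sum.distrib flip: sum_distrib_left)
  also have "(\<Sum>\<omega>\<in>W. \<Sum>\<beta>\<in>Pow J0. p \<omega> \<beta>) = (\<Sum>\<beta>\<in>Pow J0. \<Sum>\<omega>\<in>W. p \<omega> \<beta>)" by (rule sum.swap)
  also have "462 * 2 ^ (n - 1) * (real (card W) * (3 * 2 ^ m * (24 * Tot / real n)) + \<dots>) \<le>
      462 * 2 ^ (n - 1) * (real (card W) * (3 * 2 ^ m * (24 * Tot / real n)) +
        (\<Sum>\<beta>\<in>Pow J0. real (card W) * (12288 * Tot / real n)))"
    unfolding p_def J0_def
    by (intro mult_left_mono add_left_mono sum_mono sum_pattern_gate m(1)) auto
  \<comment> \<open>5710320 = 462 * (3 * 24 + 12288).\<close>
  also have "\<dots> = real (card W) * (5710320 * 2 ^ (n - 1) * 2 ^ m * Tot / real n)"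
    by (simp add: cJ0 field_simps)
  finally have "F \<le> 5710320 * 2 ^ (n - 1) * 2 ^ m * Tot / real n"
    using cW by (rule mult_left_le_imp_le)
  also have "\<dots> \<le> 5710320 * 2 ^ (n - 1) * (4 * real k) * Tot / real n"
  proof (intro divide_right_mono mult_right_mono mult_left_mono)
    have "real (2 ^ m) \<le> real (4 * k)" using m(2) by (rule of_nat_mono)
    then show "2 ^ m \<le> 4 * real k" by simp
  qed (use Tot0 in auto)
  also have "\<dots> = 11420640 * 2 ^ n * real k * Tot / real n"
    using n2 power_Suc[of "2 :: real" "n - 1"] by simp
  finally show ?thesis by (simp add: F_def)
qed

end

section \<open>The reversible circuit chain\<close>

definition ones :: "nat \<Rightarrow> bool list \<Rightarrow> nat set" where
  "ones n x = {l. l < n \<and> x ! l}"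

definition string_of :: "nat \<Rightarrow> nat set \<Rightarrow> bool list" where
  "string_of n X = map (\<lambda>l. l \<in> X) [0..<n]"

lemma string_of_in_bits: "string_of n X \<in> bits n"
  by (simp add: string_of_def bits_def)

lemma bij_betw_string_of: "bij_betw (string_of n) (Pow {..<n}) (bits n)"
  by (rule bij_betw_byWitness[where f' = "ones n"])
    (auto simp: string_of_def ones_def bits_def intro!: nth_equalityI)

lemma card_bits: "card (bits n) = 2 ^ n"
  using bij_betw_same_card[OF bij_betw_string_of, of n] by (simp add: card_Pow)

lemma finite_bits: "finite (bits n)"
  using bij_betw_finite[OF bij_betw_string_of, of n] by simp

lemma simple_perm_string_of:
  assumes "j < n" "l < n"
  shows "simple_perm n i j l h (string_of n X) = string_of n (flip i (\<lambda>X. h (j \<in> X) (l \<in> X)) X)"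
  using assms unfolding simple_perm_def
  by (auto simp: string_of_in_bits) (auto simp: string_of_def flip_def nth_list_update intro!: nth_equalityI)

lemma Sigma_rev_subset:
  "Sigma_rev n \<subseteq> (\<lambda>(i, j1, j2, h). simple_perm n i j1 j2 h) ` ({..<n} \<times> {..<n} \<times> {..<n} \<times> UNIV)"
proof
  fix \<sigma> assume "\<sigma> \<in> Sigma_rev n"
  then obtain i j1 j2 h where "\<sigma> = simple_perm n i j1 j2 h" "i < n" "j1 < n" "j2 < n"
    by (auto simp: Sigma_rev_def)
  then show "\<sigma> \<in> (\<lambda>(i, j1, j2, h). simple_perm n i j1 j2 h) ` ({..<n} \<times> {..<n} \<times> {..<n} \<times> UNIV)"
    by (intro image_eqI[of _ _ "(i, j1, j2, h)"]) auto
qed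

lemma finite_Sigma_rev: "finite (Sigma_rev n)"
  by (rule finite_subset[OF Sigma_rev_subset]) simp

lemma card_Sigma_rev_le: "card (Sigma_rev n) \<le> 16 * n ^ 3"
proof -
  have "card (Sigma_rev n) \<le> card ({..<n} \<times> {..<n} \<times> {..<n} \<times> (UNIV :: (bool \<Rightarrow> bool \<Rightarrow> bool) set))"
    by (rule surj_card_le[OF _ Sigma_rev_subset]) simp
  also have "\<dots> = 16 * n ^ 3" by (simp add: card_cartesian_product card_fun power3_eq_cube)
  finally show ?thesis .
qed

lemma simple_perm_in_bits: "x \<in> bits n \<Longrightarrow> simple_perm n i j1 j2 h x \<in> bits n"
  by (simp add: simple_perm_def bits_def)

lemma simple_perm_involution:
  assumes "i \<noteq> j1" "i \<noteq> j2" "x \<in> bits n"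
  shows "simple_perm n i j1 j2 h (simple_perm n i j1 j2 h x) = x"
proof (cases "i < n")
  case True
  then show ?thesis using assms
    by (cases "h (x ! j1) (x ! j2)") (simp_all add: simple_perm_def bits_def)
next
  case False
  then show ?thesis using assms by (auto simp: simple_perm_def bits_def list_update_beyond)
qed

text \<open>\<open>Sigma_rev\<close> is a set of maps, so parameters that name the same map count
  once, and a sum over parameters is controlled only when their multiplicity is known. For a
  conjunction gate an input on which it fires reveals the target, and toggling one bit of this input
  reveals whether the bit is a control.\<close>

lemma toffoli_inj:
  assumes eq: "\<And>X. X \<subseteq> {..<n} \<Longrightarrow> toffoli i j l a b X = toffoli i' j' l' a b X"
    and lt: "j < n" "l < n" and dist: "i \<noteq> j" "i \<noteq> l" "j \<noteq> l" "i' \<noteq> j'" "i' \<noteq> l'" "j' \<noteq> l'"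
  shows "i = i' \<and> {j, l} = {j', l'}"
proof -
  define X where "X = (if a then {j} else {}) \<union> (if b then {l} else {})"
  have X: "X \<subseteq> {..<n}" "(j \<in> X) = a" "(l \<in> X) = b" using lt dist by (auto simp: X_def)
  have moved: "toffoli i j l a b X = sym_diff X {i}" by (simp add: toffoli_def flip_def X)
  then have moved': "toffoli i' j' l' a b X = sym_diff X {i}" using eq[OF X(1)] by simp
  then have *: "(j' \<in> X) = a" "(l' \<in> X) = b" by (auto simp: toffoli_def flip_def split: if_splits)
  then have "sym_diff X {i'} = sym_diff X {i}" using moved' by (simp add: toffoli_def flip_def)
  then have i: "i = i'" by blast
  \<comment> \<open>If c controlled only the first gate, toggling it would stop the first gate while
    the second still fires.\<close>
  have mem: "c \<in> {j', l'}" if c: "c \<in> {j, l}" for c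
  proof (rule ccontr)
    assume c': "c \<notin> {j', l'}"
    define Y where "Y = sym_diff X {c}"
    have Y: "Y \<subseteq> {..<n}" using X c lt by (auto simp: Y_def)
    have "toffoli i j l a b Y = Y" using X(2,3) c dist by (auto simp: toffoli_def flip_def Y_def)
    moreover have "toffoli i' j' l' a b Y = sym_diff Y {i'}"
      using * c' by (auto simp: toffoli_def flip_def Y_def)
    ultimately show False using eq[OF Y] by auto
  qed
  have "{j, l} = {j', l'}" using mem[of j] mem[of l] dist by auto
  with i show ?thesis by simp
qed

lemma simple_perm_and_inj:
  assumes eq: "simple_perm n i j l (\<lambda>u v. u = a \<and> v = b) = simple_perm n i' j' l' (\<lambda>u v. u = a \<and> v = b)"
    and lt: "i < n" "j < n" "l < n" "i' < n" "j' < n" "l' < n"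
    and dist: "i \<noteq> j" "i \<noteq> l" "j \<noteq> l" "i' \<noteq> j'" "i' \<noteq> l'" "j' \<noteq> l'"
  shows "i = i' \<and> {j, l} = {j', l'}"
proof (rule toffoli_inj[where n = n and a = a and b = b])
  fix X assume X: "X \<subseteq> {..<n}"
  have "string_of n (toffoli i j l a b X) = string_of n (toffoli i' j' l' a b X)"
    using fun_cong[OF eq, of "string_of n X"] lt by (simp add: simple_perm_string_of toffoli_def)
  moreover have "toffoli i j l a b X \<subseteq> {..<n}" "toffoli i' j' l' a b X \<subseteq> {..<n}"
    using X lt by (auto simp: toffoli_def flip_def)
  ultimately show "toffoli i j l a b X = toffoli i' j' l' a b X"
    using bij_betw_string_of[of n] by (auto simp: bij_betw_def dest: inj_onD)
qed (use lt dist in auto)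

lemma energy_string_of:
  assumes "\<And>X. X \<subseteq> {..<n} \<Longrightarrow> \<sigma> (string_of n X) = string_of n (\<sigma>' X)"
  shows "energy (Theta k (Pow {..<n})) (\<lambda>ys. g (map (string_of n) ys)) \<sigma>' = energy (Theta k (bits n)) g \<sigma>"
proof -
  have "energy (Theta k (Pow {..<n})) (\<lambda>ys. g (map (string_of n) ys)) \<sigma>'
      = (\<Sum>ys\<in>Theta k (Pow {..<n}). (g (map (string_of n) ys) - g (map \<sigma> (map (string_of n) ys)))\<^sup>2)"
    unfolding energy_def
  proof (rule sum.cong[OF refl])
    fix ys assume "ys \<in> Theta k (Pow {..<n})"
    then have eq: "map (string_of n) (map \<sigma>' ys) = map \<sigma> (map (string_of n) ys)"
      using assms by (auto simp: Theta_def)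
    show "(g (map (string_of n) ys) - g (map (string_of n) (map \<sigma>' ys)))\<^sup>2
        = (g (map (string_of n) ys) - g (map \<sigma> (map (string_of n) ys)))\<^sup>2"
      by (simp only: eq)
  qed
  also have "\<dots> = energy (Theta k (bits n)) g \<sigma>" unfolding energy_def
    by (rule sum.reindex_bij_betw[OF bij_betw_map_Theta[OF bij_betw_string_of],
          where g = "\<lambda>xs. (g xs - g (map \<sigma> xs))\<^sup>2"])
  finally show ?thesis .
qed

text \<open>A gate determines its unordered pair of controls. The triples with j < l and those with
  l < j are therefore each parametrised injectively, and each family costs at most the full sum over
  the generators.\<close>

lemma sum_toffoli_energy_le:
  "(\<Sum>i<n. \<Sum>j\<in>{..<n} - {i}. \<Sum>l\<in>{..<n} - {i} - {j}.
      energy (Theta k (Pow {..<n})) (\<lambda>ys. g (map (string_of n) ys)) (toffoli i j l a b))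
   \<le> 2 * (\<Sum>\<sigma>\<in>Sigma_rev n. energy (Theta k (bits n)) g \<sigma>)"
proof -
  define T where "T = (SIGMA i:{..<n}. SIGMA j:{..<n} - {i}. {..<n} - {i} - {j})"
  define G where "G = (\<lambda>(i, j, l). simple_perm n i j l (\<lambda>u v. u = a \<and> v = b))"
  define e where "e = energy (Theta k (bits n)) g"
  have part: "(\<Sum>t\<in>T'. e (G t)) \<le> (\<Sum>\<sigma>\<in>Sigma_rev n. e \<sigma>)"
    if T': "T' \<subseteq> T" and ord: "(\<forall>(i, j, l)\<in>T'. j < l) \<or> (\<forall>(i, j, l)\<in>T'. l < j)" for T'
  proof -
    have "inj_on G T'"
    proof (rule inj_onI)
      fix t t' assume t: "t \<in> T'" "t' \<in> T'" "G t = G t'"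
      obtain i j l where tt: "t = (i, j, l)" by (cases t) auto
      obtain i' j' l' where tt': "t' = (i', j', l')" by (cases t') auto
      have "i = i' \<and> {j, l} = {j', l'}"
        by (rule simple_perm_and_inj[where n = n and a = a and b = b])
           (use t T' in \<open>auto simp: tt tt' T_def G_def\<close>)
      moreover have "j < l \<and> j' < l' \<or> l < j \<and> l' < j'" using ord t by (auto simp: tt tt')
      ultimately show "t = t'" by (auto simp: tt tt' doubleton_eq_iff)
    qed
    then have "(\<Sum>t\<in>T'. e (G t)) = (\<Sum>\<sigma>\<in>G ` T'. e \<sigma>)" by (simp add: sum.reindex)
    also have "\<dots> \<le> (\<Sum>\<sigma>\<in>Sigma_rev n. e \<sigma>)"
    proof (rule sum_mono2[OF finite_Sigma_rev])
      show "G ` T' \<subseteq> Sigma_rev n" using T' by (fastforce simp: T_def G_def Sigma_rev_def)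
    qed (simp add: e_def energy_nonneg)
    finally show ?thesis .
  qed
  have "(\<Sum>i<n. \<Sum>j\<in>{..<n} - {i}. \<Sum>l\<in>{..<n} - {i} - {j}.
      energy (Theta k (Pow {..<n})) (\<lambda>ys. g (map (string_of n) ys)) (toffoli i j l a b))
      = (\<Sum>i<n. \<Sum>j\<in>{..<n} - {i}. \<Sum>l\<in>{..<n} - {i} - {j}. e (G (i, j, l)))"
    unfolding e_def
    by (intro sum.cong refl energy_string_of) (auto simp: G_def simple_perm_string_of toffoli_def)
  also have "\<dots> = (\<Sum>t\<in>T. e (G t))"
    unfolding T_def by (simp add: sum.Sigma case_prod_unfold)
  also have "\<dots> = (\<Sum>t\<in>{(i, j, l) \<in> T. j < l}. e (G t)) + (\<Sum>t\<in>{(i, j, l) \<in> T. l < j}. e (G t))"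
  proof -
    have fin: "finite T" by (simp add: T_def)
    have "T = {(i, j, l) \<in> T. j < l} \<union> {(i, j, l) \<in> T. l < j}" by (auto simp: T_def)
    then have "(\<Sum>t\<in>T. e (G t)) = (\<Sum>t\<in>{(i, j, l) \<in> T. j < l} \<union> {(i, j, l) \<in> T. l < j}. e (G t))" by simp
    also have "\<dots> = (\<Sum>t\<in>{(i, j, l) \<in> T. j < l}. e (G t)) + (\<Sum>t\<in>{(i, j, l) \<in> T. l < j}. e (G t))"
      by (rule sum.union_disjoint) (auto intro: finite_subset[OF _ fin])
    finally show ?thesis .
  qed
  also have "\<dots> \<le> (\<Sum>\<sigma>\<in>Sigma_rev n. e \<sigma>) + (\<Sum>\<sigma>\<in>Sigma_rev n. e \<sigma>)"
    by (intro add_mono part) auto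
  finally show ?thesis by (simp add: e_def)
qed

lemma ent_sum_le_rev_energy:
  fixes f :: "bool list list \<Rightarrow> real"
  assumes n: "n \<ge> 2" and k: "k > 0" "3 * k \<le> 2 ^ n"
    and f: "\<And>xs. xs \<in> rev_states k n \<Longrightarrow> f xs \<ge> 0"
  shows "ent_sum (rev_states k n) f \<le> 45682560 * real k *
    (\<Sum>\<sigma>\<in>Sigma_rev n. energy (rev_states k n) (\<lambda>xs. sqrt (f xs)) \<sigma>)"
proof -
  define g where "g = (\<lambda>xs. sqrt (f xs))"
  define f' where "f' = (\<lambda>ys. f (map (string_of n) ys))"
  define g' where "g' = (\<lambda>ys. g (map (string_of n) ys))"
  define Tot where "Tot = (\<Sum>\<sigma>\<in>Sigma_rev n. energy (rev_states k n) g \<sigma>)"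
  define V where "V = Theta k (Pow {..<n})"
  have Tot0: "Tot \<ge> 0" by (simp add: Tot_def sum_nonneg energy_nonneg)
  have bij: "bij_betw (map (string_of n)) V (rev_states k n)"
    unfolding V_def rev_states_def by (rule bij_betw_map_Theta[OF bij_betw_string_of])
  interpret gate_energy n k g' Tot
  proof
    show "finite (Pow {..<n})" by simp
  next
    fix a b
    show "(\<Sum>i<n. \<Sum>j\<in>{..<n} - {i}. \<Sum>l\<in>{..<n} - {i} - {j}.
        energy (Theta k (Pow {..<n})) g' (toffoli i j l a b)) \<le> 2 * Tot"
      unfolding g'_def Tot_def rev_states_def by (rule sum_toffoli_energy_le)
  next
    fix i j a assume ij: "i < n" "j < n" "i \<noteq> j"
    \<comment> \<open>A generator may have equal controls, so every CNOT is a generator.\<close>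
    define \<sigma> where "\<sigma> = simple_perm n i j j (\<lambda>u v. u = a)"
    have "\<sigma> \<in> Sigma_rev n" using ij by (auto simp: \<sigma>_def Sigma_rev_def)
    have "energy (Theta k (Pow {..<n})) g' (cnot i j a) = energy (rev_states k n) g \<sigma>"
      unfolding g'_def rev_states_def
      by (rule energy_string_of) (simp add: \<sigma>_def simple_perm_string_of ij cnot_def)
    also have "\<dots> \<le> Tot" unfolding Tot_def
      by (rule member_le_sum[OF \<open>\<sigma> \<in> Sigma_rev n\<close>]) (auto simp: energy_nonneg finite_Sigma_rev)
    finally show "energy (Theta k (Pow {..<n})) g' (cnot i j a) \<le> Tot" .
  qed (use n Tot0 in auto)
  have "ent_sum (rev_states k n) f = ent_sum V f'"
    unfolding ent_sum_def f'_def sum.reindex_bij_betw[OF bij, symmetric] bij_betw_same_card[OF bij]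
    by (rule refl)
  also have "\<dots> \<le> (3 + 2 * ln (real (card (Pow {..<n})))) / real (card (Pow {..<n})) *
      (\<Sum>X\<in>Pow {..<n}. \<Sum>Z\<in>Pow {..<n}. energy V (\<lambda>ys. sqrt (f' ys)) (transpose X Z))"
    unfolding V_def
    by (rule ent_sum_le_transposition_energy)
       (use k f bij_betw_apply[OF bij] in \<open>auto simp: card_Pow f'_def V_def\<close>)
  also have "(\<lambda>ys. sqrt (f' ys)) = g'" by (simp add: f'_def g'_def g_def)
  also have "real (card (Pow {..<n})) = 2 ^ n" by (simp add: card_Pow)
  also have "(3 + 2 * ln (2 ^ n :: real)) / 2 ^ n *
      (\<Sum>X\<in>Pow {..<n}. \<Sum>Z\<in>Pow {..<n}. energy V g' (transpose X Z))
      \<le> (3 + 2 * ln (2 ^ n :: real)) / 2 ^ n * (11420640 * 2 ^ n * real k * Tot / real n)"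
    unfolding V_def by (intro mult_left_mono sum_transpositions_le_gate_energy k) simp
  \<comment> \<open>The n from the logarithm cancels against the 1/n of the gate bound;
    \<open>n \<ge> 2\<close> absorbs the additive 3.\<close>
  also have "\<dots> \<le> 4 * real n / 2 ^ n * (11420640 * 2 ^ n * real k * Tot / real n)"
  proof (intro mult_right_mono divide_right_mono)
    have "ln (2 ^ n :: real) = real n * ln 2" by (simp add: ln_realpow)
    also have "\<dots> \<le> real n * 1" using ln_2_less_1 by (intro mult_left_mono) auto
    finally show "3 + 2 * ln (2 ^ n :: real) \<le> 4 * real n" using n by linarith
  qed (use Tot0 in auto)
  also have "\<dots> = 45682560 * real k * Tot" using n by (simp add: field_simps)
  finally show ?thesis by (simp add: Tot_def g_def)
qed

text \<open>Pointwise, \<open>f ln (f / m)\<close> is at least f - m, strictly unless f = m, and the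
  right sides sum to zero. Positivity is needed to divide by the entropy and to conclude that a
  function of zero entropy is constant.\<close>

lemma ent_sum_pos:
  assumes V: "finite V" and f: "\<And>x. x \<in> V \<Longrightarrow> f x \<ge> 0" and nc: "x \<in> V" "y \<in> V" "f x \<noteq> f y"
  shows "ent_sum V f > 0"
proof -
  define m where "m = sum f V / real (card V)"
  obtain w where w: "w \<in> V" "f w > 0" using nc f by (metis less_eq_real_def)
  have cV: "real (card V) > 0" using V nc(1) by (auto simp: card_gt_0_iff)
  have "sum f V > 0" by (rule sum_pos2[where i = w]) (use V w f in auto)
  then have m: "m > 0" using cV by (simp add: m_def)
  have le: "f z - m \<le> f z * ln (f z / m)" "f z \<noteq> m \<Longrightarrow> f z - m < f z * ln (f z / m)" if z: "z \<in> V" for z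
  proof -
    consider "f z = 0" | "f z > 0" using f[OF z] by linarith
    then have "f z - m \<le> f z * ln (f z / m) \<and> (f z \<noteq> m \<longrightarrow> f z - m < f z * ln (f z / m))"
    proof cases
      case 2
      have ln: "ln (f z / m) = - ln (m / f z)" using 2 m by (simp add: ln_div)
      have le: "ln (m / f z) \<le> m / f z - 1" using 2 m by (intro ln_le_minus_one) simp
      have ne: "ln (m / f z) \<noteq> m / f z - 1" if "f z \<noteq> m"
        using ln_eq_minus_one[of "m / f z"] 2 m that by auto
      have eq: "f z * (m / f z - 1) = m - f z" using 2 by (simp add: field_simps)
      show ?thesis
      proof (intro conjI impI)
        show "f z - m \<le> f z * ln (f z / m)"
          using mult_left_mono[OF le, of "f z"] 2 unfolding eq ln by simp
        assume "f z \<noteq> m"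
        then have "ln (m / f z) < m / f z - 1" using le ne by simp
        then show "f z - m < f z * ln (f z / m)"
          using mult_strict_left_mono[of "ln (m / f z)" "m / f z - 1" "f z"] 2 unfolding eq ln by simp
      qed
    qed (use m in auto)
    then show "f z - m \<le> f z * ln (f z / m)" "f z \<noteq> m \<Longrightarrow> f z - m < f z * ln (f z / m)" by auto
  qed
  have "f x \<noteq> m \<or> f y \<noteq> m" using nc(3) by auto
  then obtain z where z: "z \<in> V" "f z \<noteq> m" using nc by auto
  have "0 = (\<Sum>z\<in>V. f z - m)" using cV by (simp add: sum_subtractf m_def)
  also have "\<dots> < (\<Sum>z\<in>V. f z * ln (f z / m))"
    by (rule sum_strict_mono_ex1[OF V]) (use le z in auto)
  finally show ?thesis by (simp add: ent_sum_def m_def)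
qed

section \<open>Stationary distribution and log-Sobolev constant\<close>

context
  fixes n k :: nat
  assumes n: "n \<ge> 2" and k: "k > 0" "3 * k \<le> 2 ^ n"
begin

abbreviation (input) "states \<equiv> rev_states k n"
abbreviation (input) "P \<equiv> P_rev k n"

definition uniform :: "bool list list \<Rightarrow> real" where
  "uniform xs = (if xs \<in> states then 1 / real (card states) else 0)"

lemma finite_states: "finite states"
  unfolding rev_states_def by (rule finite_Theta[OF finite_bits])

lemma card_states_pos: "card states > 0"
  unfolding rev_states_def by (rule card_Theta_pos[OF finite_bits]) (use k in \<open>simp add: card_bits\<close>)

lemma map_in_states:
  assumes \<sigma>: "\<sigma> \<in> Sigma_rev n" and xs: "xs \<in> states"
  shows "map \<sigma> xs \<in> states" "map \<sigma> (map \<sigma> xs) = xs"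
proof -
  obtain i j1 j2 h where s: "\<sigma> = simple_perm n i j1 j2 h" "i \<noteq> j1" "i \<noteq> j2"
    using \<sigma> by (auto simp: Sigma_rev_def)
  have inv: "\<sigma> (\<sigma> x) = x" if "x \<in> bits n" for x
    unfolding s(1) by (rule simple_perm_involution[OF s(2,3) that])
  have "bij_betw \<sigma> (bits n) (bits n)"
    by (rule bij_betw_byWitness[where f' = \<sigma>]) (use inv simple_perm_in_bits s(1) in auto)
  then show "map \<sigma> xs \<in> states" using xs unfolding rev_states_def by (rule map_in_Theta)
  show "map \<sigma> (map \<sigma> xs) = xs"
    using xs inv by (auto simp: rev_states_def Theta_def intro!: map_idI)
qed

lemma card_Sigma_rev_pos: "card (Sigma_rev n) > 0"
proof -
  have "simple_perm n 0 1 1 (\<lambda>_ _. True) \<in> Sigma_rev n"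
    unfolding Sigma_rev_def mem_Collect_eq
    by (rule exI[of _ 0], rule exI[of _ 1], rule exI[of _ 1]) (use n in auto)
  then show ?thesis using finite_Sigma_rev by (auto simp: card_gt_0_iff)
qed

lemma sum_P_rev:
  assumes "xs \<in> states"
  shows "(\<Sum>ys\<in>states. F ys * P xs ys) = (\<Sum>\<sigma>\<in>Sigma_rev n. F (map \<sigma> xs)) / real (card (Sigma_rev n))"
proof -
  have "(\<Sum>\<sigma>\<in>Sigma_rev n. F (map \<sigma> xs))
      = (\<Sum>ys\<in>states. \<Sum>\<sigma>\<in>{\<sigma> \<in> Sigma_rev n. map \<sigma> xs = ys}. F (map \<sigma> xs))"
    by (rule sum.group[symmetric, OF finite_Sigma_rev finite_states])
       (use map_in_states(1) assms in blast)
  also have "\<dots> = (\<Sum>ys\<in>states. F ys * real (card {\<sigma> \<in> Sigma_rev n. map \<sigma> xs = ys}))"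
    by (intro sum.cong refl) simp
  finally show ?thesis by (simp add: P_rev_def sum_divide_distrib)
qed

text \<open>Every generator is an involution, so the same generators lead from xs to ys and
  back.\<close>

lemma P_rev_sym:
  assumes "xs \<in> states" "ys \<in> states"
  shows "P xs ys = P ys xs"
proof -
  have "{\<sigma> \<in> Sigma_rev n. map \<sigma> xs = ys} = {\<sigma> \<in> Sigma_rev n. map \<sigma> ys = xs}"
    using map_in_states(2) assms by blast
  then show ?thesis by (simp add: P_rev_def)
qed

lemma sum_P_rev_1: "xs \<in> states \<Longrightarrow> (\<Sum>ys\<in>states. P xs ys) = 1"
  using sum_P_rev[of xs "\<lambda>_. 1"] card_Sigma_rev_pos by simp

lemma dirichlet_uniform:
  "dirichlet states P uniform g =
    (\<Sum>\<sigma>\<in>Sigma_rev n. energy states g \<sigma>) / (2 * real (card states) * real (card (Sigma_rev n)))"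
proof -
  have "dirichlet states P uniform g =
      1/2 * (\<Sum>xs\<in>states. 1 / real (card states) * (\<Sum>ys\<in>states. (g xs - g ys)\<^sup>2 * P xs ys))"
    unfolding dirichlet_def by (simp add: uniform_def sum_distrib_left)
  also have "\<dots> = 1/2 * (\<Sum>xs\<in>states. 1 / real (card states) *
      ((\<Sum>\<sigma>\<in>Sigma_rev n. (g xs - g (map \<sigma> xs))\<^sup>2) / real (card (Sigma_rev n))))"
    by (intro arg_cong[where f = "(*) (1/2)"] sum.cong refl) (simp add: sum_P_rev[where F = "\<lambda>ys. (_ - g ys)\<^sup>2"])
  also have "\<dots> = (\<Sum>xs\<in>states. \<Sum>\<sigma>\<in>Sigma_rev n. (g xs - g (map \<sigma> xs))\<^sup>2)
      / (2 * real (card states) * real (card (Sigma_rev n)))"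
    by (simp add: sum_distrib_left sum_divide_distrib mult.assoc)
  also have "(\<Sum>xs\<in>states. \<Sum>\<sigma>\<in>Sigma_rev n. (g xs - g (map \<sigma> xs))\<^sup>2) = (\<Sum>\<sigma>\<in>Sigma_rev n. energy states g \<sigma>)"
    unfolding energy_def by (rule sum.swap)
  finally show ?thesis .
qed

lemma entropy_uniform: "entropy states uniform f = ent_sum states f / real (card states)"
proof -
  have "expec states uniform f = sum f states / real (card states)"
    by (simp add: expec_def uniform_def sum_divide_distrib)
  then show ?thesis by (simp add: entropy_def ent_sum_def uniform_def sum_divide_distrib)
qed

text \<open>1461841920 = 45682560 * 2 * 16, with the 2 from the factor 1/2 of the Dirichlet form and
  \<open>16 * n^3\<close> from the number of generators. The inequality refers to
  \<open>uniform\<close>, not to \<open>stat_dist\<close>, so it is available for the proof of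
  uniqueness.\<close>

lemma entropy_le_dirichlet:
  assumes "\<And>xs. xs \<in> states \<Longrightarrow> f xs \<ge> 0"
  shows "entropy states uniform f \<le>
    1461841920 * real n ^ 3 * real k * dirichlet states P uniform (\<lambda>xs. sqrt (f xs))"
proof -
  define T where "T = (\<Sum>\<sigma>\<in>Sigma_rev n. energy states (\<lambda>xs. sqrt (f xs)) \<sigma>)"
  define D where "D = dirichlet states P uniform (\<lambda>xs. sqrt (f xs))"
  have v: "real (card states) > 0" and s: "real (card (Sigma_rev n)) > 0"
    using card_states_pos card_Sigma_rev_pos by simp_all
  have T: "T = 2 * real (card states) * real (card (Sigma_rev n)) * D"
    using v s by (simp add: D_def T_def dirichlet_uniform)
  have "T \<ge> 0" by (simp add: T_def sum_nonneg energy_nonneg)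
  then have D0: "D \<ge> 0" using v s by (simp add: D_def T_def dirichlet_uniform)
  have c: "real (card (Sigma_rev n)) \<le> 16 * real n ^ 3"
    using of_nat_mono[OF card_Sigma_rev_le[of n], where 'a = real] by simp
  have "entropy states uniform f \<le> 45682560 * real k * T / real (card states)"
    unfolding entropy_uniform T_def
    by (intro divide_right_mono ent_sum_le_rev_energy n k assms) auto
  also have "\<dots> = 91365120 * real k * D * real (card (Sigma_rev n))" using v by (simp add: T)
  also have "\<dots> \<le> 91365120 * real k * D * (16 * real n ^ 3)"
    by (intro mult_left_mono c) (use D0 in auto)
  finally show ?thesis by (simp add: D_def mult_ac)
qed

lemma stationary_uniform: "is_stationary states P uniform"
  unfolding is_stationary_def
proof (intro conjI ballI)
  show "sum uniform states = 1" using card_states_pos by (simp add: uniform_def)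
  fix ys assume ys: "ys \<in> states"
  show "0 \<le> uniform ys" by (simp add: uniform_def)
  have "(\<Sum>xs\<in>states. uniform xs * P xs ys) = uniform ys * (\<Sum>xs\<in>states. P ys xs)"
    unfolding sum_distrib_left by (intro sum.cong refl) (simp add: uniform_def P_rev_sym ys)
  then show "(\<Sum>xs\<in>states. uniform xs * P xs ys) = uniform ys" by (simp add: sum_P_rev_1 ys)
qed

text \<open>Expanding the square shows that a stationary \<pi> of a symmetric chain has zero
  Dirichlet energy. The entropy inequality for \<open>f = \<pi>\<^sup>2\<close> then forces \<pi> to
  be constant, which replaces a proof of irreducibility.\<close>

lemma stationary_unique:
  assumes st: "is_stationary states P \<pi>" and out: "\<And>x. x \<notin> states \<Longrightarrow> \<pi> x = 0"
  shows "\<pi> = uniform"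
proof -
  have \<pi>0: "\<pi> x \<ge> 0" if "x \<in> states" for x using st that by (simp add: is_stationary_def)
  have \<pi>1: "sum \<pi> states = 1" using st by (simp add: is_stationary_def)
  have bal: "(\<Sum>x\<in>states. \<pi> x * P x y) = \<pi> y" if "y \<in> states" for y
    using st that by (simp add: is_stationary_def)
  have "(\<Sum>x\<in>states. \<Sum>y\<in>states. (\<pi> x - \<pi> y)\<^sup>2 * P x y)
      = (\<Sum>x\<in>states. \<Sum>y\<in>states. (\<pi> x)\<^sup>2 * P x y) + (\<Sum>x\<in>states. \<Sum>y\<in>states. (\<pi> y)\<^sup>2 * P x y)
        - 2 * (\<Sum>x\<in>states. \<Sum>y\<in>states. \<pi> y * (\<pi> x * P x y))"
    by (simp add: power2_eq_square algebra_simps sum.distrib sum_subtractf sum_distrib_left)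
  also have "(\<Sum>x\<in>states. \<Sum>y\<in>states. (\<pi> x)\<^sup>2 * P x y) = (\<Sum>x\<in>states. (\<pi> x)\<^sup>2)"
    by (intro sum.cong refl) (simp add: sum_P_rev_1 flip: sum_distrib_left)
  also have "(\<Sum>x\<in>states. \<Sum>y\<in>states. (\<pi> y)\<^sup>2 * P x y) = (\<Sum>y\<in>states. (\<pi> y)\<^sup>2)"
  proof (subst sum.swap, intro sum.cong refl)
    fix y assume y: "y \<in> states"
    have "(\<Sum>x\<in>states. (\<pi> y)\<^sup>2 * P x y) = (\<pi> y)\<^sup>2 * (\<Sum>x\<in>states. P y x)"
      unfolding sum_distrib_left by (intro sum.cong refl) (simp add: P_rev_sym y)
    then show "(\<Sum>x\<in>states. (\<pi> y)\<^sup>2 * P x y) = (\<pi> y)\<^sup>2" by (simp add: sum_P_rev_1 y)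
  qed
  also have "(\<Sum>x\<in>states. \<Sum>y\<in>states. \<pi> y * (\<pi> x * P x y)) = (\<Sum>y\<in>states. (\<pi> y)\<^sup>2)"
    by (subst sum.swap, intro sum.cong refl) (simp add: bal power2_eq_square flip: sum_distrib_left)
  finally have zero: "(\<Sum>x\<in>states. \<Sum>y\<in>states. (\<pi> x - \<pi> y)\<^sup>2 * P x y) = 0" by simp
  have "dirichlet states P uniform \<pi> =
      1/2 * (1 / real (card states) * (\<Sum>x\<in>states. \<Sum>y\<in>states. (\<pi> x - \<pi> y)\<^sup>2 * P x y))"
    unfolding dirichlet_def by (simp add: uniform_def sum_distrib_left)
  then have "dirichlet states P uniform \<pi> = 0" by (simp add: zero)
  moreover have "dirichlet states P uniform (\<lambda>x. sqrt ((\<pi> x)\<^sup>2)) = dirichlet states P uniform \<pi>"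
    unfolding dirichlet_def using \<pi>0 by (intro arg_cong[where f = "(*) (1/2)"] sum.cong refl) simp
  ultimately have "entropy states uniform (\<lambda>x. (\<pi> x)\<^sup>2) \<le> 0"
    using entropy_le_dirichlet[of "\<lambda>x. (\<pi> x)\<^sup>2"] by simp
  then have "ent_sum states (\<lambda>x. (\<pi> x)\<^sup>2) \<le> 0"
    using card_states_pos by (simp add: entropy_uniform divide_le_0_iff)
  then have "(\<pi> x)\<^sup>2 = (\<pi> y)\<^sup>2" if "x \<in> states" "y \<in> states" for x y
    using ent_sum_pos[OF finite_states, of "\<lambda>x. (\<pi> x)\<^sup>2" x y] that by force
  then have const: "\<pi> x = \<pi> y" if "x \<in> states" "y \<in> states" for x y
    using that \<pi>0 by (meson power2_eq_imp_eq)
  show ?thesis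
  proof
    fix x show "\<pi> x = uniform x"
    proof (cases "x \<in> states")
      case True
      have "(\<Sum>y\<in>states. \<pi> y) = (\<Sum>y\<in>states. \<pi> x)" by (intro sum.cong refl const True)
      then show ?thesis using \<pi>1 card_states_pos True by (simp add: uniform_def field_simps)
    qed (simp add: out uniform_def)
  qed
qed

lemma stat_dist_uniform: "stat_dist states P = uniform"
  unfolding stat_dist_def
proof (rule the_equality)
  show "is_stationary states P uniform \<and> (\<forall>x. x \<notin> states \<longrightarrow> uniform x = 0)"
    using stationary_uniform by (simp add: uniform_def)
qed (use stationary_unique in auto)

text \<open>This provides a non-constant f, so the infimum in \<open>log_sobolev\<close> ranges over
  a nonempty set and a lower bound for its elements carries over.\<close>

lemma ex_two_states: "\<exists>xs\<in>states. \<exists>ys\<in>states. xs \<noteq> ys"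
proof -
  obtain xs where xs: "xs \<in> states" using card_states_pos by (auto simp: card_gt_0_iff)
  define \<sigma> where "\<sigma> = simple_perm n 0 1 1 (\<lambda>_ _. True)"
  have "\<sigma> \<in> Sigma_rev n"
    unfolding Sigma_rev_def mem_Collect_eq \<sigma>_def
    by (rule exI[of _ 0], rule exI[of _ 1], rule exI[of _ 1]) (use n in auto)
  then have ys: "map \<sigma> xs \<in> states" using xs by (rule map_in_states)
  have len: "length xs = k" and x0: "xs ! 0 \<in> bits n"
    using xs k by (auto simp: rev_states_def Theta_def)
  have "\<sigma> (xs ! 0) ! 0 \<noteq> xs ! 0 ! 0" using x0 n by (simp add: \<sigma>_def simple_perm_def bits_def)
  then have "map \<sigma> xs ! 0 \<noteq> xs ! 0" using len k by auto
  then have "map \<sigma> xs \<noteq> xs" by metis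
  then show ?thesis using xs ys by blast
qed

lemma log_sobolev_ge: "log_sobolev states P \<ge> 1 / 1461841920 / (real n ^ 3 * real k)"
  unfolding log_sobolev_def stat_dist_uniform Let_def
proof (rule cInf_greatest)
  obtain xs ys where "xs \<in> states" "ys \<in> states" "xs \<noteq> ys" using ex_two_states by blast
  then show "{dirichlet states P uniform (\<lambda>x. sqrt (f x)) / entropy states uniform f | f.
      (\<forall>x\<in>states. 0 \<le> f x) \<and> (\<exists>x\<in>states. \<exists>y\<in>states. f x \<noteq> f y)} \<noteq> {}"
    by (auto intro!: exI[of _ "\<lambda>x. if x = xs then 1 else 0"])
next
  fix r assume "r \<in> {dirichlet states P uniform (\<lambda>x. sqrt (f x)) / entropy states uniform f | f.
      (\<forall>x\<in>states. 0 \<le> f x) \<and> (\<exists>x\<in>states. \<exists>y\<in>states. f x \<noteq> f y)}"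
  then obtain f x y where r: "r = dirichlet states P uniform (\<lambda>x. sqrt (f x)) / entropy states uniform f"
    and f: "\<And>x. x \<in> states \<Longrightarrow> 0 \<le> f x" and xy: "x \<in> states" "y \<in> states" "f x \<noteq> f y" by blast
  have "entropy states uniform f > 0"
    unfolding entropy_uniform using ent_sum_pos[OF finite_states f xy] card_states_pos by simp
  moreover have "real n ^ 3 * real k > 0" using n k by simp
  ultimately show "1 / 1461841920 / (real n ^ 3 * real k) \<le> r"
    using entropy_le_dirichlet[of f, OF f] unfolding r by (simp add: field_simps)
qed

end

theorem mainTheorem2:
  shows "\<exists>c>0. \<forall>n k::nat. 0 < n \<longrightarrow> 0 < k \<longrightarrow> real k \<le> 2 ^ n / 3 \<longrightarrow>
     log_sobolev (rev_states k n) (P_rev k n) \<ge> c / (real n ^ 3 * real k)"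
proof (intro exI[of _ "1 / 1461841920"] conjI allI impI)
  fix n k :: nat assume n: "0 < n" and k: "0 < k" "real k \<le> 2 ^ n / 3"
  have "real (3 * k) \<le> real (2 ^ n)" using k(2) by simp
  then have k3: "3 * k \<le> 2 ^ n" by (simp only: of_nat_le_iff)
  \<comment> \<open>For a single wire the density hypothesis reads \<open>3 * k \<le> 2\<close> and
    contradicts k > 0.\<close>
  have "n \<noteq> 1" using k(1) k3 by (intro notI) simp
  then have "n \<ge> 2" using n by simp
  then show "1 / 1461841920 / (real n ^ 3 * real k) \<le> log_sobolev (rev_states k n) (P_rev k n)"
    using k(1) k3 by (rule log_sobolev_ge)
qed simp

end
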